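(* Let $\mathcal{A}$ be an arrangement of $m$ lines in $\mathbb{P}^2$, and let $F$ be its Milnor fiber. Then for every integer $0<k<m$ and every line $H\in\mathcal{A}$, $$b_1(F)_k\le \sum_x (m_x-2),$$ where the sum runs over all points $x\in H$ with $m_x>2$ and such that $m$ divides $k m_x$.
   Context: Let $Q$ be a reduced homogeneous polynomial of degree $m$ in $\mathbb{C}[x,y,z]$ defining the central arrangement in $\mathbb{C}^3$ corresponding to $\mathcal{A}$ (a product of linear forms). The Milnor fiber is $F=\{Q=1\}\subset\mathbb{C}^3$, with monodromy $h:F\to F$ given by multiplication by $\tau=\exp(2\pi i/m)$. $b_1(F)_k$ denotes the dimension of the $\tau^k$-eigenspace of the action of $h$ on $H^1(F,\mathbb{C})$. For a point $x\in\mathbb{P}^2$, $m_x$ is the number of lines of $\mathcal{A}$ passing through $x$. *)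

theory Defs
  imports "HOL-Analysis.Analysis" "HOL-Homology.Homology"
begin

text \<open>Singular 1-cochains with complex coefficients on a topological space X:
  complex-valued functions on singular 1-simplices.\<close>

type_synonym 'a cochain = "((nat \<Rightarrow> real) \<Rightarrow> 'a) \<Rightarrow> complex"

definition cocycle1 :: "'a topology \<Rightarrow> 'a cochain \<Rightarrow> bool" where
  "cocycle1 X \<phi> \<longleftrightarrow> (\<forall>\<sigma>. singular_simplex 2 X \<sigma> \<longrightarrow>
      \<phi> (singular_face 2 0 \<sigma>) - \<phi> (singular_face 2 1 \<sigma>) + \<phi> (singular_face 2 2 \<sigma>) = 0)"

definition coboundary1 :: "'a topology \<Rightarrow> 'a cochain \<Rightarrow> bool" where
  "coboundary1 X \<phi> \<longleftrightarrow> (\<exists>\<psi> :: 'a cochain. \<forall>\<sigma>. singular_simplex 1 X \<sigma> \<longrightarrow>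
      \<phi> \<sigma> = \<psi> (singular_face 1 0 \<sigma>) - \<psi> (singular_face 1 1 \<sigma>))"

definition pullback1 :: "('a \<Rightarrow> 'a) \<Rightarrow> 'a cochain \<Rightarrow> 'a cochain" where
  "pullback1 h \<phi> = (\<lambda>\<sigma>. \<phi> (simplex_map 1 h \<sigma>))"

text \<open>n linearly independent classes in the lambda-eigenspace of h^* on H^1(X;C) = Z^1/B^1.\<close>
definition eigen_family :: "'a topology \<Rightarrow> ('a \<Rightarrow> 'a) \<Rightarrow> complex \<Rightarrow> nat \<Rightarrow> (nat \<Rightarrow> 'a cochain) \<Rightarrow> bool" where
  "eigen_family X h e n c \<longleftrightarrow>
     (\<forall>i<n. cocycle1 X (c i) \<and> coboundary1 X (\<lambda>\<sigma>. pullback1 h (c i) \<sigma> - e * c i \<sigma>)) \<and>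
     (\<forall>a :: nat \<Rightarrow> complex. coboundary1 X (\<lambda>\<sigma>. \<Sum>i<n. a i * c i \<sigma>) \<longrightarrow> (\<forall>i<n. a i = 0))"

definition H1_eigendim :: "'a topology \<Rightarrow> ('a \<Rightarrow> 'a) \<Rightarrow> complex \<Rightarrow> enat" where
  "H1_eigendim X h e = Sup {enat n | n. \<exists>c. eigen_family X h e n c}"

definition lf :: "complex^3 \<Rightarrow> complex^3 \<Rightarrow> complex" where
  "lf a v = (\<Sum>j\<in>UNIV. a $ j * v $ j)"

definition defQ :: "(complex^3) set \<Rightarrow> complex^3 \<Rightarrow> complex" where
  "defQ A v = (\<Prod>a\<in>A. lf a v)"

definition milnor_fiber :: "(complex^3) set \<Rightarrow> (complex^3) set" where
  "milnor_fiber A = {v. defQ A v = 1}"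

definition monodromy :: "nat \<Rightarrow> complex^3 \<Rightarrow> complex^3" where
  "monodromy m v = exp (2 * pi * \<i> / of_nat m) *s v"

definition proj_point :: "complex^3 \<Rightarrow> (complex^3) set" where
  "proj_point p = {c *s p | c. True}"

definition P2 :: "((complex^3) set) set" where
  "P2 = {proj_point p | p. p \<noteq> 0}"

definition mult_pt :: "(complex^3) set \<Rightarrow> (complex^3) set \<Rightarrow> nat" where
  "mult_pt A x = card {a\<in>A. \<forall>v\<in>x. lf a v = 0}"

definition line_arrangement :: "(complex^3) set \<Rightarrow> bool" where
  "line_arrangement A \<longleftrightarrow> finite A \<and> 0 \<notin> A \<and>
     (\<forall>a\<in>A. \<forall>b\<in>A. a \<noteq> b \<longrightarrow> \<not> (\<exists>c. a = c *s b))"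

end

theory Submission
  imports Defs
begin

text \<open>Take \<open>H\<close> as the line at infinity. The other lines become \<open>y = \<alpha>\<^sub>i x + \<beta>\<^sub>i\<close> and the Milnor fibre becomes
  the cyclic cover \<open>C z\<^sup>m \<Prod>\<^sub>i (y - \<alpha>\<^sub>i x - \<beta>\<^sub>i) = 1\<close>; points of \<open>H\<close> on other lines are the slopes \<open>\<alpha>\<close>.
  Let \<open>P\<close> be the integral of a cocycle along paths, with \<open>P (h p) = e P p\<close>. If a homotopy
  inside the fibre joins the identity of a region to \<open>h\<^sup>l\<close> and \<open>e\<^sup>l \<noteq> 1\<close>, then \<open>P\<close> has a canonical primitive on the
  region, namely the integral along the tracks divided by \<open>e\<^sup>l - 1\<close>. Rotation about \<open>H\<close> gives \<open>l = 1\<close> on the region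
  far from all lines; rotation about a point of \<open>H\<close> of multiplicity \<open>m\<^sub>x\<close> gives \<open>l = m\<^sub>x\<close> near that point.

  On one line \<open>x = s1\<close> with \<open>s1\<close> large, separate the punctures by vertical lines. The far primitive
  extends over this line as soon as \<open>P\<close> integrates to the expected value along each vertical line. This is automatic between
  different slopes and inside a cluster with \<open>e\<close> to the power \<open>m\<^sub>x\<close> different from \<open>1\<close>, so there remain
  \<open>m\<^sub>x - 2\<close> conditions for each other point. Extendability is an open and closed condition on the lines \<open>x = s\<close> that
  meet the arrangement generically, and it passes to limits, so the conditions imply that \<open>P\<close> is exact everywhere.\<close>

section \<open>Integrals of cocycles along paths\<close>

text \<open>The obstacle is to glue primitives over overlaps that need not be connected. The factor
  \<open>e \<noteq> 1\<close> overcomes it: if \<open>v\<close> and its deck image are joined by a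
  path inside the region, a primitive that scales by \<open>e\<close> under the deck map has no free
  constant at \<open>v\<close>, so two such primitives agree there.

  The primitive on the whole fibre arises from rays. From each point a ray is followed inside its
  own line \<open>x = const\<close> to the far region, and the far primitive is carried back. The
  result is independent of the direction of the ray as soon as integrals between far points of that
  line are differences of the far primitive. Hence the problem splits into conditions on single
  lines \<open>x = const\<close>.

  The number \<open>m\<^sub>x - 2\<close>: a cluster has \<open>m\<^sub>x - 1\<close> punctures, and
  the vertical lines to its left and right lie in the far region, which leaves the gaps between
  neighbouring punctures.

  Cohomology provides eigenvectors only modulo coboundaries, whereas the canonical primitives
  require \<open>P (h p) = e P p\<close> for every path; averaging over the deck group repairs
  this.\<close>

definition primitive_on :: "((real \<Rightarrow> 'a::topological_space) \<Rightarrow> complex) \<Rightarrow> 'a set \<Rightarrow> ('a \<Rightarrow> complex) \<Rightarrow> bool" where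
  "primitive_on P Y \<psi> \<longleftrightarrow>
     (\<forall>p. path p \<longrightarrow> path_image p \<subseteq> Y \<longrightarrow> P p = \<psi> (pathfinish p) - \<psi> (pathstart p))"

lemma primitive_onD:
  "primitive_on P Y \<psi> \<Longrightarrow> path p \<Longrightarrow> path_image p \<subseteq> Y \<Longrightarrow> P p = \<psi> (pathfinish p) - \<psi> (pathstart p)"
  by (auto simp: primitive_on_def)

lemma primitive_on_subset: "primitive_on P Y \<psi> \<Longrightarrow> Z \<subseteq> Y \<Longrightarrow> primitive_on P Z \<psi>"
  by (auto simp: primitive_on_def)

lemma primitive_on_cong:
  assumes "primitive_on P Y \<psi>" "\<And>v. v \<in> Y \<Longrightarrow> \<psi> v = \<psi>' v"
  shows "primitive_on P Y \<psi>'"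
  unfolding primitive_on_def
proof (intro allI impI)
  fix p assume "path p" "path_image p \<subseteq> Y"
  then show "P p = \<psi>' (pathfinish p) - \<psi>' (pathstart p)"
    using assms primitive_onD[OF assms(1), of p] pathfinish_in_path_image[of p] pathstart_in_path_image[of p]
    by (metis subsetD)
qed

text \<open>Everything a 1-cocycle contributes to the argument: additivity under subdivision and
  vanishing around squares. Linear combinations and pullbacks are again of this kind.
  \<open>subpath_add\<close> allows any order of \<open>u\<close>, \<open>v\<close>,
  \<open>w\<close>, so it also covers constant and reversed paths.\<close>

locale path_functional =
  fixes X :: "'a::real_normed_vector set" and P :: "(real \<Rightarrow> 'a) \<Rightarrow> complex"
  assumes cong: "(\<And>t. t \<in> {0..1} \<Longrightarrow> p t = q t) \<Longrightarrow> P p = P q"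
    and subpath_add: "path p \<Longrightarrow> path_image p \<subseteq> X \<Longrightarrow> u \<in> {0..1} \<Longrightarrow> v \<in> {0..1} \<Longrightarrow> w \<in> {0..1}
        \<Longrightarrow> P (subpath u v p) + P (subpath v w p) = P (subpath u w p)"
    and square: "continuous_on ({0..1} \<times> {0..1}) K \<Longrightarrow> K ` ({0..1} \<times> {0..1}) \<subseteq> X
        \<Longrightarrow> P (\<lambda>t. K (t, 0)) + P (\<lambda>t. K (1, t)) = P (\<lambda>t. K (0, t)) + P (\<lambda>t. K (t, 1))"
begin

lemma subpath_self: "path p \<Longrightarrow> path_image p \<subseteq> X \<Longrightarrow> u \<in> {0..1} \<Longrightarrow> P (subpath u u p) = 0"
  using subpath_add[of p u u u] by simp

lemma reverse: "path p \<Longrightarrow> path_image p \<subseteq> X \<Longrightarrow> P (reversepath p) = - P p"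
  using subpath_add[of p 0 1 0] subpath_self[of p 0] subpath_reversepath[of p]
  by (simp add: eq_neg_iff_add_eq_0 add.commute)

lemma join:
  assumes "path p" "path q" "pathfinish p = pathstart q" "path_image p \<subseteq> X" "path_image q \<subseteq> X"
  shows "P (p +++ q) = P p + P q"
proof -
  have "P (subpath 0 (1/2) (p +++ q)) = P p"
    by (rule cong) (auto simp: subpath_def joinpaths_def)
  moreover have "P (subpath (1/2) 1 (p +++ q)) = P q"
    using assms(3) by (intro cong) (auto simp: subpath_def joinpaths_def pathfinish_def pathstart_def)
  moreover have "path (p +++ q)" "path_image (p +++ q) \<subseteq> X"
    using assms by (auto simp: path_image_join)
  ultimately show ?thesis
    using subpath_add[of "p +++ q" 0 "1/2" 1] by simp
qed

text \<open>The path is subdivided until each piece lies in one neighbourhood; the increments of the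
  single function \<psi> then telescope. Bolzano bisection takes the place of a Lebesgue
  number.\<close>

lemma local_primitive:
  assumes Y: "Y \<subseteq> X" and pY: "path p" "path_image p \<subseteq> Y"
    and loc: "\<And>v. v \<in> path_image p \<Longrightarrow> \<exists>N. open N \<and> v \<in> N \<and> primitive_on P (N \<inter> Y) \<psi>"
  shows "P p = \<psi> (pathfinish p) - \<psi> (pathstart p)"
proof -
  have p: "path p" "path_image p \<subseteq> X" using Y pY by auto
  define R where "R a b \<longleftrightarrow> (0 \<le> a \<longrightarrow> b \<le> 1 \<longrightarrow> P (subpath a b p) = \<psi> (p b) - \<psi> (p a))" for a b
  have "R 0 1"
  proof (rule Bolzano)
    fix a b c :: real assume "R a b" "R b c" "a \<le> b" "b \<le> c"
    then show "R a c"
      unfolding R_def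
    proof (intro impI)
      assume "0 \<le> a" "c \<le> 1"
      then have "P (subpath a b p) = \<psi> (p b) - \<psi> (p a)" "P (subpath b c p) = \<psi> (p c) - \<psi> (p b)"
        "P (subpath a b p) + P (subpath b c p) = P (subpath a c p)"
        using \<open>R a b\<close> \<open>R b c\<close> \<open>a \<le> b\<close> \<open>b \<le> c\<close> subpath_add[OF p, of a b c] by (auto simp: R_def)
      then show "P (subpath a c p) = \<psi> (p c) - \<psi> (p a)" by simp
    qed
  next
    fix x :: real assume x: "0 \<le> x" "x \<le> 1"
    then have "p x \<in> path_image p" by (auto simp: path_image_def)
    then obtain N where N: "open N" "p x \<in> N" "primitive_on P (N \<inter> Y) \<psi>" using loc by blast
    have "continuous_on {0..1} p" using p(1) by (simp add: path_def)
    then obtain d where d: "d > 0" "\<And>y. y \<in> {0..1} \<Longrightarrow> dist y x < d \<Longrightarrow> p y \<in> N"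
    proof -
      obtain e where e: "e > 0" "ball (p x) e \<subseteq> N" using N openE by blast
      then obtain d where "d > 0" "\<And>y. y \<in> {0..1} \<Longrightarrow> dist y x < d \<Longrightarrow> dist (p y) (p x) < e"
        using \<open>continuous_on {0..1} p\<close> x unfolding continuous_on_iff by (metis atLeastAtMost_iff)
      then show ?thesis using e that[of d] by (metis dist_commute mem_ball subsetD)
    qed
    have "R a b" if ab: "a \<le> x" "x \<le> b" "b - a < d" for a b
      unfolding R_def
    proof (intro impI)
      assume 0: "0 \<le> a" "b \<le> 1"
      have "path (subpath a b p)" using p(1) 0 ab by auto
      moreover have "path_image (subpath a b p) \<subseteq> N \<inter> Y"
      proof -
        have "path_image (subpath a b p) = p ` {a..b}" using ab by (simp add: path_image_subpath)
        moreover have "p ` {a..b} \<subseteq> N" using ab 0 d(2) by (auto simp: dist_real_def)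
        moreover have "p ` {a..b} \<subseteq> Y" using 0 pY(2) by (auto simp: path_image_def)
        ultimately show ?thesis by auto
      qed
      ultimately show "P (subpath a b p) = \<psi> (p b) - \<psi> (p a)"
        using primitive_onD[OF N(3)] by simp
    qed
    then show "\<exists>d>0. \<forall>a b. a \<le> x \<and> x \<le> b \<and> b - a < d \<longrightarrow> R a b" using d(1) by blast
  qed simp
  then show ?thesis by (simp add: R_def pathfinish_def pathstart_def)
qed

text \<open>The primitives have to agree as functions on the overlap, which may then be
  disconnected. Canonical primitives, with no free constant, are what makes this applicable.\<close>

lemma primitive_on_Un:
  assumes "Y \<subseteq> X" "open M" "open N" "primitive_on P (M \<inter> Y) \<psi>1" "primitive_on P (N \<inter> Y) \<psi>2"
    and "\<And>v. v \<in> M \<inter> N \<inter> Y \<Longrightarrow> \<psi>1 v = \<psi>2 v"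
  shows "primitive_on P ((M \<union> N) \<inter> Y) (\<lambda>v. if v \<in> M then \<psi>1 v else \<psi>2 v)"
proof -
  let ?\<psi> = "\<lambda>v. if v \<in> M then \<psi>1 v else \<psi>2 v"
  have 1: "primitive_on P (M \<inter> Y) ?\<psi>"
    by (rule primitive_on_cong[OF assms(4)]) auto
  have 2: "primitive_on P (N \<inter> Y) ?\<psi>"
    by (rule primitive_on_cong[OF assms(5)]) (use assms(6) in auto)
  show ?thesis
    unfolding primitive_on_def
  proof (intro allI impI)
    fix p assume p: "path p" "path_image p \<subseteq> (M \<union> N) \<inter> Y"
    show "P p = ?\<psi> (pathfinish p) - ?\<psi> (pathstart p)"
    proof (rule local_primitive[OF assms(1)])
      fix v assume "v \<in> path_image p"
      then have "v \<in> M \<or> v \<in> N" using p by auto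
      then show "\<exists>N. open N \<and> v \<in> N \<and> primitive_on P (N \<inter> Y) ?\<psi>"
        using 1 2 assms(2,3) by blast
    qed (use p in auto)
  qed
qed

lemma pullback:
  fixes g :: "'b::real_normed_vector \<Rightarrow> 'a"
  assumes "continuous_on Y g" "g ` Y \<subseteq> X"
  shows "path_functional Y (\<lambda>p. P (g \<circ> p))"
proof
  fix p q :: "real \<Rightarrow> 'b" assume "\<And>t. t \<in> {0..1} \<Longrightarrow> p t = q t"
  then show "P (g \<circ> p) = P (g \<circ> q)" by (intro cong) auto
next
  fix p :: "real \<Rightarrow> 'b" and u v w :: real
  assume p: "path p" "path_image p \<subseteq> Y" "u \<in> {0..1}" "v \<in> {0..1}" "w \<in> {0..1}"
  have "path (g \<circ> p)" using p assms(1) continuous_on_subset path_continuous_image by blast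
  moreover have "path_image (g \<circ> p) \<subseteq> X" using p assms(2) by (auto simp: path_image_compose)
  ultimately show "P (g \<circ> subpath u v p) + P (g \<circ> subpath v w p) = P (g \<circ> subpath u w p)"
    using subpath_add[of "g \<circ> p" u v w] p by (simp add: subpath_image)
next
  fix K :: "real \<times> real \<Rightarrow> 'b"
  assume K: "continuous_on ({0..1} \<times> {0..1}) K" "K ` ({0..1} \<times> {0..1}) \<subseteq> Y"
  have "continuous_on ({0..1} \<times> {0..1}) (g \<circ> K)"
    using K assms(1) continuous_on_compose continuous_on_subset by blast
  moreover have "(g \<circ> K) ` ({0..1} \<times> {0..1}) \<subseteq> X" using K assms(2) by auto
  ultimately show "P (g \<circ> (\<lambda>t. K (t, 0))) + P (g \<circ> (\<lambda>t. K (1, t))) = P (g \<circ> (\<lambda>t. K (0, t))) + P (g \<circ> (\<lambda>t. K (t, 1)))"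
    using square[of "g \<circ> K"] by (simp add: o_def)
qed

end

section \<open>Singular 1-cochains as functionals on paths\<close>

definition path_simplex :: "(real \<Rightarrow> 'a) \<Rightarrow> (nat \<Rightarrow> real) \<Rightarrow> 'a" where
  "path_simplex p = restrict (\<lambda>x. p (x 1)) (standard_simplex 1)"

lemma singular_simplex_top_of_set:
  "singular_simplex n (top_of_set X) f \<longleftrightarrow>
     continuous_on (standard_simplex n) f \<and> f ` standard_simplex n \<subseteq> X \<and> f \<in> extensional (standard_simplex n)"
  by (auto simp: singular_simplex_def euclidean_product_topology continuous_map_in_subtopology)

lemma continuous_on_coordinate [continuous_intros]: "continuous_on A (\<lambda>x::nat \<Rightarrow> real. x i)"
  by (rule continuous_on_subset[OF continuous_on_product_coordinates]) auto

lemma standard_simplex_1_eq: "x \<in> standard_simplex 1 \<Longrightarrow> x 0 = 1 - x 1 \<and> x 1 \<in> {0..1}"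
  by (auto simp: standard_simplex_def)

lemma standard_simplex_2_eq: "x \<in> standard_simplex 2 \<Longrightarrow> x 0 = 1 - x 1 - x 2 \<and> 0 \<le> x 0 \<and> 0 \<le> x 1 \<and> 0 \<le> x 2"
  by (auto simp: standard_simplex_def numeral_2_eq_2)

lemma cocycle1_triangle:
  assumes c: "cocycle1 (top_of_set X) \<phi>"
    and f: "continuous_on (standard_simplex 2) f" "f ` standard_simplex 2 \<subseteq> X"
    and "\<And>t. t \<in> {0..1} \<Longrightarrow> p t = f (\<lambda>i. if i = 0 then 1 - t else if i = 1 then t else 0)"
    and "\<And>t. t \<in> {0..1} \<Longrightarrow> q t = f (\<lambda>i. if i = 1 then 1 - t else if i = 2 then t else 0)"
    and "\<And>t. t \<in> {0..1} \<Longrightarrow> r t = f (\<lambda>i. if i = 0 then 1 - t else if i = 2 then t else 0)"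
  shows "\<phi> (path_simplex p) + \<phi> (path_simplex q) = \<phi> (path_simplex r)"
proof -
  let ?\<sigma> = "restrict f (standard_simplex 2)"
  have "singular_simplex 2 (top_of_set X) ?\<sigma>"
    using f by (auto simp: singular_simplex_top_of_set intro: continuous_on_eq)
  then have "\<phi> (singular_face 2 0 ?\<sigma>) - \<phi> (singular_face 2 1 ?\<sigma>) + \<phi> (singular_face 2 2 ?\<sigma>) = 0"
    using c unfolding cocycle1_def by blast
  moreover have z: "x i = 0" if "x \<in> standard_simplex 1" "i > 1" for x i
    using that by (auto simp: standard_simplex_def)
  have "simplical_face 0 x = (\<lambda>i. if i = 1 then 1 - x 1 else if i = 2 then x 1 else 0)"
    "simplical_face 1 x = (\<lambda>i. if i = 0 then 1 - x 1 else if i = 2 then x 1 else 0)"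
    "simplical_face 2 x = (\<lambda>i. if i = 0 then 1 - x 1 else if i = 1 then x 1 else 0)"
    if x: "x \<in> standard_simplex 1" for x
  proof -
    have *: "x 0 = 1 - x 1" using standard_simplex_1_eq[OF x] by simp
    have "i = 0 \<or> i = 1 \<or> i = 2 \<or> i > 2" for i :: nat by auto
    then show "simplical_face 0 x = (\<lambda>i. if i = 1 then 1 - x 1 else if i = 2 then x 1 else 0)"
      "simplical_face 1 x = (\<lambda>i. if i = 0 then 1 - x 1 else if i = 2 then x 1 else 0)"
      "simplical_face 2 x = (\<lambda>i. if i = 0 then 1 - x 1 else if i = 1 then x 1 else 0)"
      using z[OF x] * by (auto simp: fun_eq_iff simplical_face_def)
  qed
  note face = this
  have "singular_face 2 k ?\<sigma> = path_simplex g"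
    if "k \<le> 2" "\<And>x. x \<in> standard_simplex 1 \<Longrightarrow> f (simplical_face k x) = g (x 1)" for k g
  proof
    fix x
    show "singular_face 2 k ?\<sigma> x = path_simplex g x"
      using that(2)[of x] simplical_face_in_standard_simplex[of 2 k x] that(1)
      by (cases "x \<in> standard_simplex 1") (auto simp: singular_face_def path_simplex_def)
  qed
  note this[of 0 q] this[of 1 r] this[of 2 p]
  then have "singular_face 2 0 ?\<sigma> = path_simplex q" "singular_face 2 1 ?\<sigma> = path_simplex r"
    "singular_face 2 2 ?\<sigma> = path_simplex p"
    using assms(4-6) standard_simplex_1_eq by (simp_all add: face del: One_nat_def)
  ultimately show ?thesis by (simp add: algebra_simps)
qed

lemma path_functional_cocycle1:
  fixes X :: "'a::real_normed_vector set"
  assumes c: "cocycle1 (top_of_set X) \<phi>"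
  shows "path_functional X (\<lambda>p. \<phi> (path_simplex p))"
proof
  fix p q :: "real \<Rightarrow> 'a" assume "\<And>t. t \<in> {0..1} \<Longrightarrow> p t = q t"
  then have "path_simplex p = path_simplex q"
    by (auto simp: path_simplex_def fun_eq_iff dest: standard_simplex_1_eq[unfolded One_nat_def])
  then show "\<phi> (path_simplex p) = \<phi> (path_simplex q)" by simp
next
  fix p :: "real \<Rightarrow> 'a" and u v w :: real
  assume p: "path p" "path_image p \<subseteq> X" and uvw: "u \<in> {0..1}" "v \<in> {0..1}" "w \<in> {0..1}"
  \<comment> \<open>The affine function with values \<open>u\<close>, \<open>v\<close>,
    \<open>w\<close> at the vertices: the triangle is folded onto the path.\<close>
  define g where "g x = x 0 * u + x 1 * v + x 2 * w" for x :: "nat \<Rightarrow> real"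
  have g: "g x \<in> {0..1}" if "x \<in> standard_simplex 2" for x
  proof -
    have x: "x 0 = 1 - x 1 - x 2" "0 \<le> x 0" "0 \<le> x 1" "0 \<le> x 2" using standard_simplex_2_eq[OF that] by auto
    have "g x \<le> x 0 * 1 + x 1 * 1 + x 2 * 1" unfolding g_def
      using uvw x by (intro add_mono mult_left_mono) auto
    then show ?thesis using x uvw by (auto simp: g_def)
  qed
  show "\<phi> (path_simplex (subpath u v p)) + \<phi> (path_simplex (subpath v w p)) = \<phi> (path_simplex (subpath u w p))"
  proof (rule cocycle1_triangle[OF c, where f = "p \<circ> g"])
    show "continuous_on (standard_simplex 2) (p \<circ> g)"
    proof (rule continuous_on_compose)
      show "continuous_on (standard_simplex 2) g"
        unfolding g_def by (intro continuous_intros)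
      show "continuous_on (g ` standard_simplex 2) p"
        using p(1) g unfolding path_def by (blast intro: continuous_on_subset)
    qed
    show "(p \<circ> g) ` standard_simplex 2 \<subseteq> X"
      using g p(2) by (auto simp: path_image_def)
  qed (auto simp: subpath_def g_def algebra_simps)
next
  fix K :: "real \<times> real \<Rightarrow> 'a"
  assume K: "continuous_on ({0..1} \<times> {0..1}) K" "K ` ({0..1} \<times> {0..1}) \<subseteq> X"
  have cont: "continuous_on (standard_simplex 2) (K \<circ> g)" "(K \<circ> g) ` standard_simplex 2 \<subseteq> X"
    if "continuous_on (standard_simplex 2) g" "g ` standard_simplex 2 \<subseteq> {0..1} \<times> {0..1}" for g
    using that K by (blast intro: continuous_on_compose continuous_on_subset, unfold image_comp[symmetric], blast)
  \<comment> \<open>The square is cut along its diagonal. This triangle has the vertices (0,0),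
    (1,0), (1,1), the next one (0,0), (0,1), (1,1).\<close>
  have "\<phi> (path_simplex (\<lambda>t. K (t, 0))) + \<phi> (path_simplex (\<lambda>t. K (1, t))) = \<phi> (path_simplex (\<lambda>t. K (t, t)))"
    by (rule cocycle1_triangle[OF c, where f = "K \<circ> (\<lambda>x. (x 1 + x 2, x 2))"]; (rule cont)?)
       (auto intro!: continuous_intros dest: standard_simplex_2_eq[unfolded One_nat_def])
  moreover have "\<phi> (path_simplex (\<lambda>t. K (0, t))) + \<phi> (path_simplex (\<lambda>t. K (t, 1))) = \<phi> (path_simplex (\<lambda>t. K (t, t)))"
    by (rule cocycle1_triangle[OF c, where f = "K \<circ> (\<lambda>x. (x 2, x 1 + x 2))"]; (rule cont)?)
       (auto intro!: continuous_intros dest: standard_simplex_2_eq[unfolded One_nat_def])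
  ultimately show "\<phi> (path_simplex (\<lambda>t. K (t, 0))) + \<phi> (path_simplex (\<lambda>t. K (1, t))) =
       \<phi> (path_simplex (\<lambda>t. K (0, t))) + \<phi> (path_simplex (\<lambda>t. K (t, 1)))" by simp
qed

text \<open>A 0-cochain is a function of points, and every singular 1-simplex comes from a path, so
  exactness can be tested on paths. One direction serves to read off the eigenvector equation, the
  other to contradict independence.\<close>

lemma coboundary1_iff_primitive_on:
  fixes X :: "'a::real_normed_vector set"
  shows "coboundary1 (top_of_set X) \<phi> \<longleftrightarrow> (\<exists>\<psi>. primitive_on (\<lambda>p. \<phi> (path_simplex p)) X \<psi>)"
proof
  let ?v = "\<lambda>a. restrict (\<lambda>x. a) (standard_simplex 0) :: (nat \<Rightarrow> real) \<Rightarrow> 'a"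
  have face: "singular_face 1 0 (path_simplex p) = ?v (pathfinish p)"
    "singular_face 1 1 (path_simplex p) = ?v (pathstart p)" for p :: "real \<Rightarrow> 'a"
  proof -
    have "simplical_face 0 (\<lambda>j. if j = 0 then 1 else (0::real)) = (\<lambda>j. if j = 1 then 1 else 0)"
      "simplical_face 1 (\<lambda>j. if j = 0 then 1 else (0::real)) = (\<lambda>j. if j = 0 then 1 else 0)"
      by (auto simp: simplical_face_def fun_eq_iff)
    moreover have "(\<lambda>j. if j = 1 then 1 else 0) \<in> standard_simplex 1" "(\<lambda>j. if j = 0 then 1 else 0) \<in> standard_simplex 1"
      by (simp_all del: One_nat_def)
    ultimately have "singular_face 1 0 (path_simplex p) x = ?v (pathfinish p) x \<and>
        singular_face 1 1 (path_simplex p) x = ?v (pathstart p) x" for x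
      by (cases "x \<in> standard_simplex 0")
         (simp_all add: singular_face_def path_simplex_def standard_simplex_0 pathfinish_def pathstart_def
           del: One_nat_def)
    then show "singular_face 1 0 (path_simplex p) = ?v (pathfinish p)"
    "singular_face 1 1 (path_simplex p) = ?v (pathstart p)"
      by (simp_all add: fun_eq_iff)
  qed
  have ss: "singular_simplex 1 (top_of_set X) (path_simplex p)" if "path p" "path_image p \<subseteq> X" for p
  proof -
    have "continuous_on (standard_simplex 1) (\<lambda>x. p (x 1))"
    proof (rule continuous_on_compose2[where g = p and f = "\<lambda>x. x 1"])
      show "continuous_on {0..1} p" using that(1) by (simp add: path_def)
      show "continuous_on (standard_simplex 1) (\<lambda>x::nat\<Rightarrow>real. x 1)" by (rule continuous_on_coordinate)
      show "(\<lambda>x. x 1) ` standard_simplex 1 \<subseteq> {0..1::real}" using standard_simplex_1_eq by blast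
    qed
    then have "continuous_on (standard_simplex 1) (path_simplex p)"
      by (rule continuous_on_eq) (auto simp: path_simplex_def)
    then show ?thesis using that(2)
      by (auto simp: singular_simplex_top_of_set path_simplex_def path_image_def dest: standard_simplex_1_eq[unfolded One_nat_def])
  qed
  {
    assume "coboundary1 (top_of_set X) \<phi>"
    then obtain \<psi> where \<psi>: "\<And>\<sigma>. singular_simplex 1 (top_of_set X) \<sigma> \<Longrightarrow>
        \<phi> \<sigma> = \<psi> (singular_face 1 0 \<sigma>) - \<psi> (singular_face 1 1 \<sigma>)" by (auto simp: coboundary1_def)
    have "\<phi> (path_simplex p) = \<psi> (?v (pathfinish p)) - \<psi> (?v (pathstart p))"
      if "path p" "path_image p \<subseteq> X" for p
      using \<psi>[OF ss[OF that]] unfolding face .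
    then have "primitive_on (\<lambda>p. \<phi> (path_simplex p)) X (\<lambda>a. \<psi> (?v a))"
      by (simp add: primitive_on_def)
    then show "\<exists>\<psi>. primitive_on (\<lambda>p. \<phi> (path_simplex p)) X \<psi>" by blast
  next
    assume "\<exists>\<psi>. primitive_on (\<lambda>p. \<phi> (path_simplex p)) X \<psi>"
    then obtain \<psi> where \<psi>: "primitive_on (\<lambda>p. \<phi> (path_simplex p)) X \<psi>" by blast
    \<comment> \<open>The faces are evaluated at the only point of the 0-simplex, which turns a
      singular 0-simplex into a point of the space.\<close>
    have "\<phi> \<sigma> = \<psi> (singular_face 1 0 \<sigma> (\<lambda>j. if j = 0 then 1 else 0)) - \<psi> (singular_face 1 1 \<sigma> (\<lambda>j. if j = 0 then 1 else 0))"
      if \<sigma>: "singular_simplex 1 (top_of_set X) \<sigma>" for \<sigma>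
    proof -
      let ?g = "\<lambda>t (i::nat). if i = 0 then 1 - t else if i = 1 then t else (0::real)"
      define p where "p = \<sigma> \<circ> ?g"
      have g: "?g t \<in> standard_simplex 1" if "t \<in> {0..1}" for t :: real
        using that by (auto simp: standard_simplex_def)
      have cont: "continuous_on {0..1} ?g"
      proof (rule continuous_on_coordinatewise_then_product)
        fix i :: nat
        consider "i = 0" | "i = 1" | "i > 1" by linarith
        then show "continuous_on {0..1} (\<lambda>t. ?g t i)" by cases (auto intro!: continuous_intros)
      qed
      have "path p"
        unfolding path_def p_def
      proof (rule continuous_on_compose[OF cont])
        show "continuous_on (?g ` {0..1}) \<sigma>"
          using \<sigma> g by (force simp: singular_simplex_top_of_set intro: continuous_on_subset)
      qed
      moreover have "path_image p \<subseteq> X"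
        using \<sigma> g by (auto simp: p_def path_image_def singular_simplex_top_of_set)
      moreover have "path_simplex p = \<sigma>"
      proof
        fix x show "path_simplex p x = \<sigma> x"
        proof (cases "x \<in> standard_simplex 1")
          case True
          then have "?g (x 1) = x"
            using standard_simplex_1_eq[OF True] by (auto simp: fun_eq_iff standard_simplex_def)
          then show ?thesis using True by (simp add: path_simplex_def p_def del: One_nat_def)
        next
          case False
          then show ?thesis using \<sigma> by (auto simp: path_simplex_def singular_simplex_def extensional_def)
        qed
      qed
      ultimately show ?thesis
        using primitive_onD[OF \<psi>, of p] face[of p] by (simp add: standard_simplex_0)
    qed
    then show "coboundary1 (top_of_set X) \<phi>"
      unfolding coboundary1_def
      by (intro exI[of _ "\<lambda>\<sigma>. \<psi> (\<sigma> (\<lambda>j. if j = 0 then 1 else 0))"]) auto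
  }
qed

lemma pullback1_path_simplex: "pullback1 h \<phi> (path_simplex p) = \<phi> (path_simplex (h \<circ> p))"
  by (simp add: pullback1_def simplex_map_def path_simplex_def o_def fun_eq_iff restrict_def if_distrib cong: if_cong)

section \<open>Primitives from rotations\<close>

text \<open>Both points lie in the open half plane of numbers with positive component along
  \<open>a\<close>, so their arguments differ by less than pi. This keeps \<open>Ln\<close> of the
  ratio, and with it the lifts below, continuous.\<close>

lemma norm_less_imp_ratio_notin_nonpos_Reals:
  fixes a d d' :: complex
  assumes "norm d < norm a" "norm d' < norm a"
  shows "(a + d') / (a + d) \<notin> \<real>\<^sub>\<le>\<^sub>0"
proof
  assume "(a + d') / (a + d) \<in> \<real>\<^sub>\<le>\<^sub>0"
  then obtain k where k: "k \<le> 0" "(a + d') / (a + d) = of_real k" by (auto elim!: nonpos_Reals_cases)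
  have nz: "a + d \<noteq> 0" using assms(1) by (metis add_eq_0_iff norm_minus_cancel order_less_irrefl)
  then have "a + d' = of_real k * (a + d)" using k(2) by (simp add: field_simps)
  then have "a * of_real (1 - k) = of_real k * d - d'" by (simp add: algebra_simps)
  then have "norm a * (1 - k) = norm (of_real k * d - d')"
    using k(1) by (metis norm_mult norm_of_real abs_of_nonneg diff_ge_0_iff_ge order.trans zero_le_one)
  also have "\<dots> \<le> (- k) * norm d + norm d'"
    using norm_triangle_ineq4[of "of_real k * d" d'] k(1) by (simp add: norm_mult)
  also have "\<dots> < (- k) * norm a + norm a"
    using assms k(1) by (intro add_le_less_mono mult_left_mono) auto
  finally show False by (simp add: algebra_simps)
qed

text \<open>Line \<open>i\<close> is \<open>y = al i * x + be i\<close>; a point \<open>(x, y, z)\<close> of \<open>F\<close> stands for \<open>z (x e1 + y e2 + e3)\<close> in the Milnor fibre.\<close>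

locale lines =
  fixes I :: "'i set" and al be :: "'i \<Rightarrow> complex" and C :: complex and B :: real
  assumes finite_I: "finite I" and C_nonzero: "C \<noteq> 0"
    and be_less_B: "i \<in> I \<Longrightarrow> norm (be i) < B" and B_pos: "0 < B"
    and be_distinct: "i \<in> I \<Longrightarrow> j \<in> I \<Longrightarrow> i \<noteq> j \<Longrightarrow> al i = al j \<Longrightarrow> Re (be i) \<noteq> Re (be j)"
begin

definition m :: nat where "m = Suc (card I)"

definition q :: "'i \<Rightarrow> complex \<times> complex \<Rightarrow> complex" where
  "q i b = snd b - al i * fst b - be i"

definition base :: "complex \<times> complex \<times> complex \<Rightarrow> complex \<times> complex" where
  "base v = (fst v, fst (snd v))"

definition F :: "(complex \<times> complex \<times> complex) set" where
  "F = {v. C * snd (snd v) ^ m * (\<Prod>i\<in>I. q i (base v)) = 1}"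

definition deck :: "nat \<Rightarrow> complex \<times> complex \<times> complex \<Rightarrow> complex \<times> complex \<times> complex" where
  "deck l v = (fst v, fst (snd v), exp (2 * pi * \<i> / of_nat m) ^ l * snd (snd v))"

text \<open>If \<open>r i / q i\<close> stays off the branch cut and the product of the \<open>q i\<close> at \<open>b\<close> is \<open>exp c\<close> times that of the \<open>r i\<close>, this is the
  continuous lift to \<open>F\<close>.\<close>

definition lift where
  "lift v c r b = (fst b, snd b,
     snd (snd v) * exp (- (c + (\<Sum>i\<in>I. Ln (r i / q i (base v)))) / of_nat m))"

text \<open>The substitute for path lifting in the cover: while every ratio
  \<open>q i b / q i (base v)\<close> avoids the branch cut, the sheet of \<open>v\<close> is
  carried along with the moving base point \<open>b\<close>.\<close>

definition relocate where "relocate v b = lift v 0 (\<lambda>i. q i b) b"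

text \<open>The summand \<open>f\<close> of the second coordinate turns with the first coordinate, the rest of it stays: \<open>f = snd\<close> is the rotation
  about \<open>H\<close>, and \<open>f b = a * fst b\<close> the one about the point of slope \<open>a\<close>. The set \<open>J\<close> collects the lines that the
  loop winds around.\<close>

definition rot where
  "rot f J v t = lift v (2 * pi * \<i> * of_nat (card J) * of_real t)
     (\<lambda>i. if i \<in> J then (f (base v) - al i * fst v) + exp (- (2 * pi * \<i> * of_real t)) * (fst (snd v) - f (base v) - be i)
          else q i (base v))
     (exp (2 * pi * \<i> * of_real t) * fst v, exp (2 * pi * \<i> * of_real t) * f (base v) + (fst (snd v) - f (base v)))"

lemma m_pos: "m > 0" by (simp add: m_def)

lemma base_lift [simp]: "base (lift v c r b) = b" by (simp add: base_def lift_def)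

lemma base_relocate [simp]: "base (relocate v b) = b" by (simp add: relocate_def)

lemma fst_relocate [simp]: "fst (relocate v b) = fst b" "fst (snd (relocate v b)) = snd b" by (simp_all add: relocate_def lift_def)

lemma fst_rot: "fst (rot f J v t) = exp (2 * pi * \<i> * of_real t) * fst v"
  and snd_rot: "fst (snd (rot f J v t)) = exp (2 * pi * \<i> * of_real t) * f (base v) + (fst (snd v) - f (base v))"
  by (simp_all add: rot_def lift_def)

lemma base_deck [simp]: "base (deck l v) = base v" by (simp add: base_def deck_def)

lemma fst_deck [simp]: "fst (deck l v) = fst v" "fst (snd (deck l v)) = fst (snd v)" by (simp_all add: deck_def)

lemma F_nonzero:
  assumes "v \<in> F" shows "i \<in> I \<Longrightarrow> q i (base v) \<noteq> 0" "snd (snd v) \<noteq> 0"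
proof -
  have 1: "C * snd (snd v) ^ m * (\<Prod>i\<in>I. q i (base v)) = 1" using assms by (simp add: F_def)
  then show "i \<in> I \<Longrightarrow> q i (base v) \<noteq> 0" using finite_I by (metis mult_zero_right prod_zero_iff zero_neq_one)
  show "snd (snd v) \<noteq> 0" using 1 m_pos by (metis mult_zero_left mult_zero_right zero_neq_one zero_power)
qed

lemma F_root_iff:
  assumes "v \<in> F" "base w = base v"
  shows "w \<in> F \<longleftrightarrow> snd (snd w) ^ m = snd (snd v) ^ m"
proof -
  have "C * snd (snd v) ^ m * (\<Prod>i\<in>I. q i (base v)) = 1" using assms by (simp add: F_def)
  moreover have "(\<Prod>i\<in>I. q i (base v)) \<noteq> 0" using F_nonzero[OF assms(1)] finite_I by auto
  ultimately show ?thesis using C_nonzero assms(2) by (auto simp: F_def) (metis mult_cancel_left mult_cancel_right)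
qed

lemma root_of_unity_pow: "exp (2 * pi * \<i> / of_nat m) ^ m = 1"
  using m_pos by (simp flip: exp_of_nat_mult)

lemma deck_in_F: "v \<in> F \<Longrightarrow> deck l v \<in> F"
proof -
  assume v: "v \<in> F"
  have "(exp (2 * pi * \<i> / of_nat m) ^ l) ^ m = (exp (2 * pi * \<i> / of_nat m) ^ m) ^ l"
    by (simp only: power_mult[symmetric] mult.commute)
  then have "snd (snd (deck l v)) ^ m = snd (snd v) ^ m"
    by (simp only: deck_def snd_conv power_mult_distrib root_of_unity_pow) simp
  then show ?thesis using F_root_iff[OF v, of "deck l v"] by simp
qed

lemma F_same_base:
  assumes "v \<in> F" "w \<in> F" "base w = base v"
  obtains l where "w = deck l v"
proof -
  have "snd (snd w) ^ m = snd (snd v) ^ m" using assms F_root_iff by blast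
  then have "(snd (snd w) / snd (snd v)) ^ m = 1" using F_nonzero[OF assms(1)] by (simp add: power_divide)
  then obtain l where "snd (snd w) / snd (snd v) = exp (2 * of_real pi * \<i> * of_nat l / of_nat m)"
    using complex_root_unity_eq[of m 1]  m_pos complex_roots_unity[of m] by auto
  then have "snd (snd w) = exp (2 * of_real pi * \<i> / of_nat m) ^ l * snd (snd v)"
    using F_nonzero[OF assms(1)] by (simp add: field_simps flip: exp_of_nat_mult)
  then have "w = deck l v" using assms(3) by (auto simp: deck_def base_def prod_eq_iff)
  then show ?thesis using that by blast
qed

lemma lift_in_F:
  assumes v: "v \<in> F" and r: "\<And>i. i \<in> I \<Longrightarrow> r i \<noteq> 0"
    and eq: "(\<Prod>i\<in>I. q i b) = exp c * (\<Prod>i\<in>I. r i)"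
  shows "lift v c r b \<in> F"
proof -
  let ?R = "\<Sum>i\<in>I. Ln (r i / q i (base v))"
  have q: "q i (base v) \<noteq> 0" if "i \<in> I" for i using F_nonzero[OF v] that by blast
  have "exp (- (c + ?R) / of_nat m) ^ m = exp (- (c + ?R))"
    using m_pos by (simp flip: exp_of_nat_mult)
  also have "\<dots> = exp (- c) * (\<Prod>i\<in>I. q i (base v)) / (\<Prod>i\<in>I. r i)"
  proof -
    have "exp ?R = (\<Prod>i\<in>I. r i / q i (base v))"
      unfolding exp_sum[OF finite_I] by (intro prod.cong) (auto simp: r q)
    then show ?thesis by (simp add: exp_diff exp_minus prod_dividef field_simps exp_add)
  qed
  finally have *: "exp (- (c + ?R) / of_nat m) ^ m = exp (- c) * (\<Prod>i\<in>I. q i (base v)) / (\<Prod>i\<in>I. r i)" .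
  have "(\<Prod>i\<in>I. r i) \<noteq> 0" using r finite_I by auto
  then have "C * (snd (snd v) * exp (- (c + ?R) / of_nat m)) ^ m * (\<Prod>i\<in>I. q i b)
      = C * snd (snd v) ^ m * (\<Prod>i\<in>I. q i (base v))"
    unfolding power_mult_distrib * eq by (simp add: exp_minus field_simps)
  then show ?thesis using v unfolding F_def mem_Collect_eq base_lift by (simp only: lift_def snd_conv)
qed

lemma lift_deck: "lift (deck l v) c r b = deck l (lift v c r b)"
  by (simp add: lift_def deck_def base_def)

lemma relocate_deck: "relocate (deck l v) b = deck l (relocate v b)"
  by (simp add: relocate_def lift_deck)

lemma rot_deck: "rot f J (deck l v) t = deck l (rot f J v t)"
  unfolding rot_def lift_deck[symmetric] by (simp cong: if_cong)

lemma lift_self: "v \<in> F \<Longrightarrow> lift v 0 (\<lambda>i. q i (base v)) (base v) = v"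
  using F_nonzero[of v] by (simp add: lift_def base_def cong: sum.cong)

lemma relocate_self [simp]: "v \<in> F \<Longrightarrow> relocate v (base v) = v"
  by (simp add: relocate_def lift_self)

lemma relocate_in_F: "v \<in> F \<Longrightarrow> (\<And>i. i \<in> I \<Longrightarrow> q i b \<noteq> 0) \<Longrightarrow> relocate v b \<in> F"
  unfolding relocate_def by (rule lift_in_F) auto

lemma continuous_on_q [continuous_intros]: "continuous_on S b \<Longrightarrow> continuous_on S (\<lambda>x. q i (b x))"
  unfolding q_def by (intro continuous_intros)

lemma continuous_on_base [continuous_intros]: "continuous_on S v \<Longrightarrow> continuous_on S (\<lambda>x. base (v x))"
  unfolding base_def by (intro continuous_intros)

lemma continuous_on_deck [continuous_intros]: "continuous_on S v \<Longrightarrow> continuous_on S (\<lambda>x. deck l (v x))"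
  unfolding deck_def by (intro continuous_intros)

lemma continuous_on_lift:
  assumes "continuous_on S v" "v ` S \<subseteq> F" "continuous_on S c" "continuous_on S b"
    and "\<And>i. i \<in> I \<Longrightarrow> continuous_on S (\<lambda>x. r x i)"
    and "\<And>i x. i \<in> I \<Longrightarrow> x \<in> S \<Longrightarrow> r x i / q i (base (v x)) \<notin> \<real>\<^sub>\<le>\<^sub>0"
  shows "continuous_on S (\<lambda>x. lift (v x) (c x) (r x) (b x))"
proof -
  have "continuous_on S (\<lambda>x. Ln (r x i / q i (base (v x))))" if "i \<in> I" for i
  proof (intro continuous_on_Ln' continuous_on_divide continuous_on_q continuous_on_base assms(1) assms(5)[OF that])
    show "\<forall>x\<in>S. q i (base (v x)) \<noteq> 0" using F_nonzero(1) assms(2) that by blast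
  qed (use assms(6) that in blast)
  then have "continuous_on S (\<lambda>x. \<Sum>i\<in>I. Ln (r x i / q i (base (v x))))" by (rule continuous_on_sum)
  then show ?thesis
    unfolding lift_def using m_pos
    by (intro continuous_on_Pair continuous_on_mult continuous_on_exp continuous_on_divide continuous_on_minus
        continuous_on_add continuous_on_fst continuous_on_snd continuous_on_const assms) auto
qed

lemma continuous_on_relocate:
  assumes "continuous_on S v" "v ` S \<subseteq> F" "continuous_on S b"
    and "\<And>i x. i \<in> I \<Longrightarrow> x \<in> S \<Longrightarrow> q i (b x) / q i (base (v x)) \<notin> \<real>\<^sub>\<le>\<^sub>0"
  shows "continuous_on S (\<lambda>x. relocate (v x) (b x))"
  unfolding relocate_def using assms by (intro continuous_on_lift continuous_intros) auto

text \<open>\<open>q i\<close> is the sum of the turning term \<open>f - al i x\<close> and the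
  fixed term \<open>y - f - be i\<close>. For \<open>i\<close> in \<open>J\<close> the turning term
  dominates, so \<open>q i\<close> winds once around 0; for the other lines it vanishes, so
  \<open>q i\<close> does not move.\<close>

definition rotatable where
  "rotatable f J v \<longleftrightarrow> (\<forall>i\<in>J. norm (fst (snd v) - f (base v) - be i) < norm (f (base v) - al i * fst v)) \<and>
     (\<forall>i\<in>I - J. f (base v) = al i * fst v)"

lemma rot_ratio:
  assumes "v \<in> F" "rotatable f J v" "i \<in> I"
  shows "(if i \<in> J then (f (base v) - al i * fst v) + exp (- (2 * pi * \<i> * of_real t)) * (fst (snd v) - f (base v) - be i)
          else q i (base v)) / q i (base v) \<notin> \<real>\<^sub>\<le>\<^sub>0"
proof (cases "i \<in> J")
  case True
  have *: "q i (base v) = (f (base v) - al i * fst v) + (fst (snd v) - f (base v) - be i)"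
    by (simp add: q_def base_def)
  have "norm (exp (- (2 * pi * \<i> * of_real t)) :: complex) = 1" by (simp add: norm_exp_eq_Re)
  then show ?thesis
    unfolding * using True assms(2)
    by (simp only: if_True) (intro norm_less_imp_ratio_notin_nonpos_Reals, auto simp: rotatable_def norm_mult)
next
  case False
  then show ?thesis using F_nonzero(1)[OF assms(1,3)] by simp
qed

lemma rot_in_F:
  assumes "v \<in> F" "rotatable f J v" "J \<subseteq> I"
  shows "rot f J v t \<in> F"
  unfolding rot_def
proof (rule lift_in_F[OF assms(1)])
  let ?E = "exp (2 * pi * \<i> * of_real t)"
  let ?r = "\<lambda>i. if i \<in> J then (f (base v) - al i * fst v) + exp (- (2 * pi * \<i> * of_real t)) * (fst (snd v) - f (base v) - be i)
          else q i (base v)"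
  let ?b = "(?E * fst v, ?E * f (base v) + (fst (snd v) - f (base v)))"
  show "?r i \<noteq> 0" if "i \<in> I" for i using rot_ratio[OF assms(1,2) that, of t] by auto
  \<comment> \<open>With \<open>?E\<close> pulled out, the remaining factor stays in a half plane;
    the \<open>card J\<close> copies of \<open>?E\<close> account for the whole winding.\<close>
  have "q i ?b = (if i \<in> J then ?E else 1) * ?r i" if "i \<in> I" for i
    using assms that by (auto simp: q_def base_def rotatable_def algebra_simps exp_minus)
  then have "(\<Prod>i\<in>I. q i ?b) = (\<Prod>i\<in>I. (if i \<in> J then ?E else 1) * ?r i)" by (intro prod.cong) auto
  also have "\<dots> = (\<Prod>i\<in>I. if i \<in> J then ?E else 1) * (\<Prod>i\<in>I. ?r i)" by (rule prod.distrib)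
  also have "(\<Prod>i\<in>I. if i \<in> J then ?E else 1) = ?E ^ card J"
    using assms(3) finite_I by (simp add: prod.If_cases Int_absorb1 prod_constant)
  also have "\<dots> = exp (2 * pi * \<i> * of_nat (card J) * of_real t)"
    by (simp add: algebra_simps flip: exp_of_nat_mult)
  finally show "(\<Prod>i\<in>I. q i ?b) = exp (2 * pi * \<i> * of_nat (card J) * of_real t) * (\<Prod>i\<in>I. ?r i)" .
qed

lemma rot_int:
  assumes "exp (2 * pi * \<i> * of_real t) = 1"
  shows "rot f J v t = lift v (2 * pi * \<i> * of_nat (card J) * of_real t) (\<lambda>i. q i (base v)) (base v)"
proof -
  have "exp (- (2 * pi * \<i> * of_real t)) = 1" using assms by (simp add: exp_minus)
  then have "(\<lambda>i. if i \<in> J then (f (base v) - al i * fst v) + exp (- (2 * pi * \<i> * of_real t)) * (fst (snd v) - f (base v) - be i)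
      else q i (base v)) = (\<lambda>i. q i (base v))"
    by (simp only:) (simp add: fun_eq_iff q_def base_def)
  moreover have "(exp (2 * pi * \<i> * of_real t) * fst v, exp (2 * pi * \<i> * of_real t) * f (base v) + (fst (snd v) - f (base v))) = base v"
    unfolding assms by (simp add: base_def)
  ultimately show ?thesis unfolding rot_def by (simp only:)
qed

lemma rot_0: "v \<in> F \<Longrightarrow> rot f J v 0 = v"
  using rot_int[of 0 f J v] lift_self[of v] by simp

text \<open>After a full turn all logarithms vanish, and the winding of \<open>card J\<close>
  factors multiplies the last coordinate by a root of unity with exponent \<open>- card J\<close>,
  which is \<open>m - card J\<close> modulo \<open>m\<close>. For \<open>J = I\<close> this is 1,
  since \<open>m\<close> also counts the line at infinity.\<close>

lemma rot_1:
  assumes "v \<in> F" "J \<subseteq> I" shows "rot f J v 1 = deck (m - card J) v"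
proof -
  have *: "rot f J v 1 = lift v (2 * pi * \<i> * of_nat (card J)) (\<lambda>i. q i (base v)) (base v)"
    using rot_int[of 1 f J v] by simp
  have J: "card J \<le> m" using assms(2) finite_I card_mono[of I J] by (simp add: m_def)
  have "exp (- (2 * pi * \<i> * of_nat (card J)) / of_nat m) = exp (2 * pi * \<i> / of_nat m) ^ (m - card J)"
  proof -
    have "exp (2 * pi * \<i> / of_nat m) ^ (m - card J) = exp (of_nat (m - card J) * (2 * pi * \<i> / of_nat m))"
      by (rule exp_of_nat_mult[symmetric])
    also have "of_nat (m - card J) * (2 * pi * \<i> / of_nat m) = 2 * pi * \<i> + (- (2 * pi * \<i> * of_nat (card J)) / of_nat m)"
      using J m_pos by (simp add: of_nat_diff field_simps)
    finally have "exp (2 * pi * \<i> / of_nat m) ^ (m - card J) =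
        exp (2 * pi * \<i>) * exp (- (2 * pi * \<i> * of_nat (card J)) / of_nat m)" by (simp only: exp_add)
    moreover have "exp (2 * pi * \<i>) = 1" by simp
    ultimately show ?thesis by (simp only: mult_1_left)
  qed
  moreover have "Ln (q i (base v) / q i (base v)) = 0" if "i \<in> I" for i
    using F_nonzero(1)[OF assms(1) that] by simp
  ultimately show ?thesis
    unfolding * by (simp add: lift_def deck_def mult.commute) (simp add: base_def)
qed

lemma continuous_on_rot:
  assumes "continuous_on S v" "v ` S \<subseteq> F" "continuous_on S u" "continuous_on UNIV f"
    and "\<And>x. x \<in> S \<Longrightarrow> rotatable f J (v x)"
  shows "continuous_on S (\<lambda>x. rot f J (v x) (u x))"
proof -
  have [continuous_intros]: "continuous_on S (\<lambda>x. f (base (v x)))"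
    by (rule continuous_on_compose2[OF assms(4)]) (auto intro!: continuous_intros assms)
  show ?thesis
    unfolding rot_def
  proof (rule continuous_on_lift)
    fix i assume "i \<in> I"
    show "continuous_on S (\<lambda>x. if i \<in> J then f (base (v x)) - al i * fst (v x) +
             exp (- (2 * pi * \<i> * of_real (u x))) * (fst (snd (v x)) - f (base (v x)) - be i) else q i (base (v x)))"
      by (cases "i \<in> J") (auto intro!: continuous_intros assms)
  next
    fix i x assume "i \<in> I" "x \<in> S"
    then show "(if i \<in> J then f (base (v x)) - al i * fst (v x) +
             exp (- (2 * pi * \<i> * of_real (u x))) * (fst (snd (v x)) - f (base (v x)) - be i) else q i (base (v x)))
          / q i (base (v x)) \<notin> \<real>\<^sub>\<le>\<^sub>0"
      using assms(2,5) by (intro rot_ratio) auto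
  qed (use assms in \<open>auto intro!: continuous_intros\<close>)
qed

section \<open>The regions on which the two kinds of rotation exist\<close>

definition far_region :: "(complex \<times> complex \<times> complex) set" where "far_region = {v. \<forall>i\<in>I. B < norm (fst (snd v) - al i * fst v)}"

text \<open>The affine part of a neighbourhood of the point at infinity of slope \<open>a\<close>:
  \<open>y - a x\<close> may be small, but is dominated by \<open>(a - al i) x\<close> for every
  other slope. The margin \<open>B\<close> absorbs the intercepts.\<close>

definition cluster_region :: "complex \<Rightarrow> (complex \<times> complex \<times> complex) set" where "cluster_region a = {v. \<forall>i\<in>I. al i \<noteq> a \<longrightarrow> norm (fst (snd v) - a * fst v) + B < norm (a - al i) * norm (fst v)}"

lemma open_far_region: "open far_region"
proof -
  have "open (\<Inter>i\<in>I. {v::complex \<times> complex \<times> complex. B < norm (fst (snd v) - al i * fst v)})"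
    using finite_I by (intro open_INT ballI open_Collect_less continuous_intros)
  also have "\<dots> = far_region" by (auto simp: far_region_def)
  finally show ?thesis .
qed

lemma open_cluster_region: "open (cluster_region a)"
proof -
  have "open (\<Inter>i\<in>{i\<in>I. al i \<noteq> a}. {v::complex \<times> complex \<times> complex.
      norm (fst (snd v) - a * fst v) + B < norm (a - al i) * norm (fst v)})"
    using finite_I by (intro open_INT ballI open_Collect_less continuous_intros) simp
  also have "\<dots> = cluster_region a" by (auto simp: cluster_region_def)
  finally show ?thesis .
qed

lemma rotatable_far_region: "v \<in> far_region \<Longrightarrow> rotatable snd I v"
  using be_less_B by (force simp: far_region_def rotatable_def base_def)

lemma rotatable_cluster_region: "v \<in> cluster_region a \<Longrightarrow> rotatable (\<lambda>b. a * fst b) {i\<in>I. al i \<noteq> a} v"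
proof -
  assume v: "v \<in> cluster_region a"
  have "norm (fst (snd v) - a * fst v - be i) < norm (a * fst v - al i * fst v)" if "i \<in> I" "al i \<noteq> a" for i
  proof -
    have "norm (fst (snd v) - a * fst v - be i) \<le> norm (fst (snd v) - a * fst v) + B"
      using norm_triangle_ineq4[of "fst (snd v) - a * fst v" "be i"] be_less_B[OF that(1)] by linarith
    also have "\<dots> < norm (a - al i) * norm (fst v)" using v that by (auto simp: cluster_region_def)
    finally show ?thesis by (simp flip: norm_mult add: algebra_simps)
  qed
  then show ?thesis by (auto simp: rotatable_def base_def)
qed

text \<open>The rotation about \<open>H\<close> multiplies both affine coordinates by the same unit,
  and the region is cut out by absolute values. Its tracks therefore stay in the region, which
  permits the comparison of the two canonical primitives.\<close>

lemma rot_snd_cluster_region_iff: "rot snd I v t \<in> cluster_region a \<longleftrightarrow> v \<in> cluster_region a"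
proof -
  have "norm (exp (2 * pi * \<i> * of_real t) * x - a * (exp (2 * pi * \<i> * of_real t) * y)) = norm (x - a * y)" for x y
  proof -
    have "exp (2 * pi * \<i> * of_real t) * x - a * (exp (2 * pi * \<i> * of_real t) * y) = exp (2 * pi * \<i> * of_real t) * (x - a * y)"
      by (simp add: algebra_simps)
    then show ?thesis by (simp add: norm_mult norm_exp_eq_Re)
  qed
  then show ?thesis by (simp add: cluster_region_def fst_rot snd_rot base_def norm_mult norm_exp_eq_Re)
qed

end

text \<open>An eigenvector on the level of paths and not merely of classes; otherwise each canonical
  primitive would carry a correction term.\<close>

locale eigen_functional = lines I al be C B + path_functional "lines.F I al be C" P
  for I :: "'i set" and al be C B P +
  fixes e :: complex
  assumes deck_1: "path p \<Longrightarrow> path_image p \<subseteq> F \<Longrightarrow> P (deck 1 \<circ> p) = e * P p"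
    and e_ne_1: "e \<noteq> 1"
begin

lemma deck_pow:
  assumes "path p" "path_image p \<subseteq> F"
  shows "P (deck l \<circ> p) = e ^ l * P p"
proof (induction l)
  case 0
  have "deck 0 \<circ> p = p" by (simp add: deck_def fun_eq_iff)
  then show ?case by simp
next
  case (Suc l)
  have "path (deck l \<circ> p)" using assms(1) unfolding path_def o_def by (rule continuous_on_deck)
  moreover have "path_image (deck l \<circ> p) \<subseteq> F" 
    using assms(2) deck_in_F unfolding path_image_compose by blast
  moreover have "deck 1 \<circ> (deck l \<circ> p) = deck (Suc l) \<circ> p" by (simp add: deck_def fun_eq_iff)
  ultimately have "P (deck (Suc l) \<circ> p) = e * P (deck l \<circ> p)" using deck_1[of "deck l \<circ> p"] by (simp only:)
  then show ?case by (simp only: Suc power_Suc mult.assoc)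
qed

lemma path_rot:
  assumes "v \<in> F" "J \<subseteq> I" "rotatable f J v" "continuous_on UNIV f"
  shows "path (rot f J v)" "path_image (rot f J v) \<subseteq> F"
proof -
  show "path (rot f J v)"
    unfolding path_def using assms by (intro continuous_on_rot) (auto intro: continuous_intros)
  show "path_image (rot f J v) \<subseteq> F" 
    using rot_in_F[OF assms(1,3,2)] unfolding path_image_def by blast
qed

lemma rot_primitive:
  assumes J: "J \<subseteq> I" and f: "continuous_on UNIV f" and X: "X \<subseteq> F" "\<And>v. v \<in> X \<Longrightarrow> rotatable f J v"
    and e: "e ^ (m - card J) \<noteq> 1"
  shows "primitive_on P X (\<lambda>v. P (rot f J v) / (e ^ (m - card J) - 1))"
  unfolding primitive_on_def
proof (intro allI impI)
  fix p assume p: "path p" "path_image p \<subseteq> X"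
  have pX: "p t \<in> X" if "t \<in> {0..1}" for t using p that by (auto simp: path_image_def)
  have pF: "p t \<in> F" and rp: "rotatable f J (p t)" if "t \<in> {0..1}" for t
    using X pX[OF that] by blast+
  define K where "K x = rot f J (p (fst x)) (snd x)" for x :: "real \<times> real"
  have "continuous_on ({0..1} \<times> {0..1}) K"
    unfolding K_def
  proof (rule continuous_on_rot)
    show "continuous_on ({0..1} \<times> {0..1}) (\<lambda>x. p (fst x))"
      using p(1) unfolding path_def by (rule continuous_on_compose2) (auto intro!: continuous_intros)
  qed (use pF rp f in \<open>auto intro!: continuous_intros\<close>)
  moreover have "K ` ({0..1} \<times> {0..1}) \<subseteq> F"
  proof
    fix w assume "w \<in> K ` ({0..1} \<times> {0..1})"
    then obtain t u where "t \<in> {0..1}" "w = rot f J (p t) u" by (auto simp: K_def)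
    then show "w \<in> F" using rot_in_F[OF pF rp J] by simp
  qed
  \<comment> \<open>The four sides of the swept square are \<open>p\<close>, its deck image and the
    rotation tracks of the two ends.\<close>
  ultimately have "P (\<lambda>t. K (t, 0)) + P (\<lambda>t. K (1, t)) = P (\<lambda>t. K (0, t)) + P (\<lambda>t. K (t, 1))"
    by (rule square)
  moreover have "P (\<lambda>t. K (t, 0)) = P p"
    by (rule cong) (simp add: K_def rot_0 pF)
  moreover have "P (\<lambda>t. K (t, 1)) = P (deck (m - card J) \<circ> p)"
    by (rule cong) (simp add: K_def rot_1 pF J)
  moreover have "\<dots> = e ^ (m - card J) * P p" using deck_pow[OF p(1)] p(2) X(1) by blast
  ultimately have "(e ^ (m - card J) - 1) * P p = P (rot f J (p 1)) - P (rot f J (p 0))"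
    by (simp add: K_def algebra_simps)
  then have "P p = (P (rot f J (p 1)) - P (rot f J (p 0))) / (e ^ (m - card J) - 1)"
    using e by (simp add: field_simps)
  then show "P p = P (rot f J (pathfinish p)) / (e ^ (m - card J) - 1) - P (rot f J (pathstart p)) / (e ^ (m - card J) - 1)"
    by (simp add: pathfinish_def pathstart_def diff_divide_distrib)
qed

lemma rot_deck_P:
  assumes "v \<in> F" "J \<subseteq> I" "rotatable f J v" "continuous_on UNIV f"
  shows "P (rot f J (deck l v)) = e ^ l * P (rot f J v)"
proof -
  have "rot f J (deck l v) = deck l \<circ> rot f J v" by (simp add: rot_deck fun_eq_iff)
  then show ?thesis using deck_pow path_rot[OF assms] by (simp only:)
qed

definition far_primitive where "far_primitive v = P (rot snd I v) / (e - 1)"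

lemma m_minus_card: "m - card I = 1" by (simp add: m_def)

lemma primitive_on_far_region: "primitive_on P (far_region \<inter> F) far_primitive"
  using rot_primitive[of I snd "far_region \<inter> F"] rotatable_far_region e_ne_1
  unfolding far_primitive_def by (auto simp: m_minus_card continuous_on_snd continuous_on_id)

lemma far_primitive_deck:
  assumes "v \<in> F" "v \<in> far_region" shows "far_primitive (deck l v) = e ^ l * far_primitive v"
  using rot_deck_P[of v I snd l] assms rotatable_far_region unfolding far_primitive_def
  by (simp add: continuous_on_snd continuous_on_id)

text \<open>The rotation track about \<open>H\<close> leads from \<open>v\<close> to
  \<open>deck 1 v\<close>. Along it the cluster primitive grows by \<open>(e - 1)\<close> times its
  value at \<open>v\<close>, and the same integral defines \<open>(e - 1)\<close> times
  \<open>far_primitive\<close>. So the two agree pointwise on the overlap.\<close>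

lemma primitive_on_cluster_region:
  assumes "e ^ Suc (card {i\<in>I. al i = a}) \<noteq> 1"
  obtains \<psi> where "primitive_on P ((far_region \<union> cluster_region a) \<inter> F) \<psi>" "\<And>v. v \<in> far_region \<Longrightarrow> \<psi> v = far_primitive v"
proof -
  define J where "J = {i\<in>I. al i \<noteq> a}"
  define f where "f b = a * fst b" for b :: "complex \<times> complex"
  have f: "continuous_on UNIV f" unfolding f_def by (intro continuous_intros)
  have J: "J \<subseteq> I" by (auto simp: J_def)
  have "card I = card J + card {i\<in>I. al i = a}"
    using finite_I by (subst card_Un_disjoint[symmetric]) (auto simp: J_def intro!: arg_cong[where f = card])
  \<comment> \<open>\<open>m - card J\<close> counts the lines of slope \<open>a\<close> together
    with \<open>H\<close>; it is the multiplicity of the point.\<close>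
  then have ne: "e ^ (m - card J) \<noteq> 1" using assms by (simp add: m_def)
  have ra: "rotatable f J v" if "v \<in> cluster_region a" for v using rotatable_cluster_region[OF that] by (simp add: f_def[abs_def] J_def)
  define \<psi>a where "\<psi>a v = P (rot f J v) / (e ^ (m - card J) - 1)" for v
  have prim: "primitive_on P (cluster_region a \<inter> F) \<psi>a"
    using rot_primitive[OF J f _ _ ne, of "cluster_region a \<inter> F"] ra unfolding \<psi>a_def by auto
  have agree: "far_primitive v = \<psi>a v" if v: "v \<in> far_region \<inter> cluster_region a \<inter> F" for v
  proof -
    have "path (rot snd I v)" "path_image (rot snd I v) \<subseteq> F"
      using path_rot[of v I snd] v rotatable_far_region by (auto simp: continuous_on_snd continuous_on_id)
    moreover have "path_image (rot snd I v) \<subseteq> cluster_region a"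
      using v rot_snd_cluster_region_iff unfolding path_image_def by blast
    ultimately have "P (rot snd I v) = \<psi>a (rot snd I v 1) - \<psi>a (rot snd I v 0)"
      using primitive_onD[OF prim, of "rot snd I v"] by (simp add: pathfinish_def pathstart_def)
    also have "\<dots> = \<psi>a (deck 1 v) - \<psi>a v" using v by (simp add: rot_0 rot_1 m_minus_card)
    also have "\<dots> = (e - 1) * \<psi>a v"
      using rot_deck_P[of v J f 1] v J f ra by (simp add: \<psi>a_def algebra_simps diff_divide_distrib)
    finally show ?thesis using e_ne_1 by (simp add: far_primitive_def)
  qed
  show ?thesis
    using that[OF primitive_on_Un[OF order_refl open_far_region open_cluster_region primitive_on_far_region prim agree]] by simp
qed

end

section \<open>Primitives from rays\<close>

text \<open>A nonpositive ratio would put 0 on the segment from \<open>q\<close> to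
  \<open>q + r w\<close>, and then \<open>q\<close> would be a nonpositive multiple of
  \<open>w\<close>.\<close>

lemma segment_notin_nonpos_Reals:
  fixes q w :: complex
  assumes "q \<noteq> 0" "q / w \<notin> \<real>\<^sub>\<le>\<^sub>0" "w \<noteq> 0" "0 \<le> r"
  shows "(q + of_real r * w) / q \<notin> \<real>\<^sub>\<le>\<^sub>0"
proof
  assume "(q + of_real r * w) / q \<in> \<real>\<^sub>\<le>\<^sub>0"
  then obtain k where k: "k \<le> 0" "(q + of_real r * w) / q = of_real k" by (auto elim!: nonpos_Reals_cases)
  then have eq: "of_real r * w = of_real (k - 1) * q" using assms(1) by (simp add: field_simps)
  have "q / w = of_real (- (r / (1 - k)))"
    using eq k(1) assms by (simp add: field_simps)
  then show False using assms k(1) by (metis divide_nonneg_nonneg neg_le_0_iff_le nonpos_Reals_of_real_iff diff_ge_0_iff_ge order.trans zero_le_one)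
qed

context lines
begin

text \<open>One constant for all size estimates: over \<open>x\<close> the punctures lie in the disc
  of radius \<open>K (1 + norm x)\<close>, and outside this disc every point is in
  \<open>far_region\<close>.\<close>

definition K :: real where "K = B + (\<Sum>i\<in>I. norm (al i))"

lemma al_le_K: "i \<in> I \<Longrightarrow> norm (al i) + B \<le> K"
  unfolding K_def using member_le_sum[of i I "\<lambda>i. norm (al i)"] finite_I by simp

lemma B_le_K: "B \<le> K"
  unfolding K_def by (simp add: sum_nonneg)

lemma far_region_large:
  assumes "norm (fst (snd v)) > K * (1 + norm (fst v))" shows "v \<in> far_region"
  unfolding far_region_def
proof (intro CollectI ballI)
  fix i assume i: "i \<in> I"
  have "norm (fst (snd v)) - norm (al i) * norm (fst v) \<le> norm (fst (snd v) - al i * fst v)"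
    using norm_triangle_ineq2[of "fst (snd v)" "al i * fst v"] by (simp add: norm_mult)
  moreover have "norm (al i) * norm (fst v) \<le> K * norm (fst v)"
    using al_le_K[OF i] B_pos by (intro mult_right_mono) auto
  moreover have "K * (1 + norm (fst v)) = K + K * norm (fst v)" by (simp add: algebra_simps)
  ultimately show "B < norm (fst (snd v) - al i * fst v)"
    using assms B_le_K by linarith
qed

text \<open>The length of the rays. The term \<open>2 * norm y\<close> outweighs the starting point,
  so the end has norm above \<open>K (2 + norm x + s)\<close>. The parameter \<open>s\<close> will
  be \<open>norm s1\<close>; this puts the end beyond the radius used when sweeping from
  \<open>s1\<close> to \<open>x\<close>.\<close>

definition len :: "real \<Rightarrow> complex \<times> complex \<times> complex \<Rightarrow> real" where
  "len s v = K * (3 + norm (fst v) + s) + 2 * norm (fst (snd v))"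

definition ray :: "real \<Rightarrow> complex \<Rightarrow> complex \<times> complex \<times> complex \<Rightarrow> real \<Rightarrow> complex \<times> complex \<times> complex" where
  "ray s w v u = relocate v (fst v, fst (snd v) + of_real (u * len s v) * w)"

text \<open>The ray from \<open>y\<close> in direction \<open>w\<close> inside
  \<open>x = const\<close> hits the puncture of line \<open>i\<close> exactly when
  \<open>q i\<close> is a nonpositive multiple of \<open>w\<close>.\<close>

definition ray_free :: "complex \<Rightarrow> (complex \<times> complex \<times> complex) set" where
  "ray_free w = {v. \<forall>i\<in>I. q i (base v) / w \<notin> \<real>\<^sub>\<le>\<^sub>0}"

lemma open_ray_free: "open (ray_free w)"
proof -
  have "continuous_on UNIV (\<lambda>v. q i (base v) / w)" for i
    unfolding divide_inverse by (intro continuous_intros)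
  then have "open ((\<lambda>v. q i (base v) / w) -` (- \<real>\<^sub>\<le>\<^sub>0))" for i
    using open_Compl[OF closed_nonpos_Reals_complex] open_vimage by blast
  then have "open (\<Inter>i\<in>I. (\<lambda>v. q i (base v) / w) -` (- \<real>\<^sub>\<le>\<^sub>0))"
    using finite_I by (intro open_INT) auto
  also have "\<dots> = ray_free w" by (auto simp: ray_free_def)
  finally show ?thesis .
qed

lemma len_nonneg: "0 \<le> s \<Longrightarrow> 0 \<le> len s v"
  unfolding len_def using B_le_K B_pos by (intro add_nonneg_nonneg mult_nonneg_nonneg) auto

lemma ray_ratio:
  assumes "v \<in> F" "v \<in> ray_free w" "w \<noteq> 0" "0 \<le> s" "0 \<le> u" "i \<in> I"
  shows "q i (fst v, fst (snd v) + of_real (u * len s v) * w) / q i (base v) \<notin> \<real>\<^sub>\<le>\<^sub>0"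
proof -
  have "q i (fst v, fst (snd v) + of_real (u * len s v) * w) = q i (base v) + of_real (u * len s v) * w"
    by (simp add: q_def base_def)
  then show ?thesis
    using segment_notin_nonpos_Reals[of "q i (base v)" w "u * len s v"] F_nonzero(1)[OF assms(1,6)] assms len_nonneg[OF assms(4), of v]
    by (auto simp: ray_free_def)
qed

lemma ray_0: "v \<in> F \<Longrightarrow> ray s w v 0 = v"
  using relocate_self[of v] by (simp add: ray_def base_def)

lemma ray_deck: "ray s w (deck l v) u = deck l (ray s w v u)"
  by (simp add: ray_def relocate_deck[symmetric] len_def)

lemma fst_ray [simp]: "fst (ray s w v u) = fst v" "fst (snd (ray s w v u)) = fst (snd v) + of_real (u * len s v) * w"
  by (simp_all add: ray_def)

lemma path_ray:
  assumes "v \<in> F" "v \<in> ray_free w" "w \<noteq> 0" "0 \<le> s"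
  shows "path (ray s w v)" "path_image (ray s w v) \<subseteq> F"
proof -
  show "path (ray s w v)"
    unfolding path_def ray_def
  proof (rule continuous_on_relocate)
    show "(\<lambda>x. v) ` {0..1} \<subseteq> F" using assms(1) by blast
  qed (use ray_ratio[OF assms] in \<open>simp_all add: continuous_intros\<close>)
  have "ray s w v u \<in> F" if "u \<ge> 0" for u
    unfolding ray_def
  proof (rule relocate_in_F[OF assms(1)])
    show "q i (fst v, fst (snd v) + of_real (u * len s v) * w) \<noteq> 0" if "i \<in> I" for i
      using ray_ratio[OF assms \<open>u \<ge> 0\<close> that] by auto
  qed
  then show "path_image (ray s w v) \<subseteq> F" unfolding path_image_def by force
qed

lemma ray_end_norm:
  assumes "norm w = 1" "0 \<le> s"
  shows "norm (fst (snd (ray s w v 1))) > K * (2 + norm (fst v) + s)"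
proof -
  have "norm (of_real (len s v) * w) = len s v" using assms len_nonneg by (simp add: norm_mult)
  then have "len s v - norm (fst (snd v)) \<le> norm (fst (snd (ray s w v 1)))"
    using norm_diff_ineq[of "of_real (len s v) * w" "fst (snd v)"] by (simp add: add.commute)
  moreover have "K * (3 + norm (fst v) + s) = K * (2 + norm (fst v) + s) + K" by (simp add: algebra_simps)
  ultimately show ?thesis using B_le_K B_pos norm_ge_zero[of "fst (snd v)"] unfolding len_def by linarith
qed

lemma ray_end_far_region:
  assumes "norm w = 1" "0 \<le> s"
  shows "ray s w v 1 \<in> far_region"
proof (rule far_region_large)
  have "K * (1 + norm (fst v)) \<le> K * (2 + norm (fst v) + s)"
    using assms B_le_K B_pos by (intro mult_left_mono) auto
  then show "norm (fst (snd (ray s w v 1))) > K * (1 + norm (fst (ray s w v 1)))"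
    using ray_end_norm[OF assms, of v] by simp
qed

lemma ratio_notin_imp_relocate_in_F:
  assumes "v \<in> F" "\<And>i. i \<in> I \<Longrightarrow> q i b / q i (base v) \<notin> \<real>\<^sub>\<le>\<^sub>0"
  shows "relocate v b \<in> F"
proof (rule relocate_in_F[OF assms(1)])
  show "q i b \<noteq> 0" if "i \<in> I" for i using assms(2)[OF that] by auto
qed

end

context eigen_functional
begin

text \<open>Homotopy lifting by a formula: \<open>G\<close> moves the base points of
  \<open>p\<close>, and \<open>relocate\<close> lifts each track from the sheet of
  \<open>p t\<close>. The ratio condition makes the whole square continuous.\<close>

lemma push:
  assumes p: "path p" "path_image p \<subseteq> F"
    and G: "continuous_on ({0..1} \<times> {0..1}) G" "\<And>t. t \<in> {0..1} \<Longrightarrow> G (t, 0) = base (p t)"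
    and r: "\<And>t u i. t \<in> {0..1} \<Longrightarrow> u \<in> {0..1} \<Longrightarrow> i \<in> I \<Longrightarrow> q i (G (t, u)) / q i (base (p t)) \<notin> \<real>\<^sub>\<le>\<^sub>0"
  shows "P p + P (\<lambda>u. relocate (p 1) (G (1, u))) = P (\<lambda>u. relocate (p 0) (G (0, u))) + P (\<lambda>t. relocate (p t) (G (t, 1)))"
    and "u \<in> {0..1} \<Longrightarrow> path (\<lambda>t. relocate (p t) (G (t, u)))"
    and "u \<in> {0..1} \<Longrightarrow> path_image (\<lambda>t. relocate (p t) (G (t, u))) \<subseteq> F"
    and "t \<in> {0..1} \<Longrightarrow> path (\<lambda>u. relocate (p t) (G (t, u)))"
    and "t \<in> {0..1} \<Longrightarrow> path_image (\<lambda>u. relocate (p t) (G (t, u))) \<subseteq> F"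
proof -
  have pF: "p t \<in> F" if "t \<in> {0..1}" for t using p that by (auto simp: path_image_def)
  define H where "H x = relocate (p (fst x)) (G x)" for x
  have contH: "continuous_on ({0..1} \<times> {0..1}) H"
    unfolding H_def
  proof (rule continuous_on_relocate[OF _ _ G(1)])
    show "continuous_on ({0..1} \<times> {0..1}) (\<lambda>x. p (fst x))"
      using p(1) unfolding path_def by (rule continuous_on_compose2) (auto intro!: continuous_intros)
  qed (use pF r in auto)
  have HF: "H (t, u) \<in> F" if "t \<in> {0..1}" "u \<in> {0..1}" for t u
    unfolding H_def using ratio_notin_imp_relocate_in_F[OF pF r] that by simp
  have "P (\<lambda>t. H (t, 0)) + P (\<lambda>t. H (1, t)) = P (\<lambda>t. H (0, t)) + P (\<lambda>t. H (t, 1))"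
    using contH HF by (intro square) auto
  moreover have "P (\<lambda>t. H (t, 0)) = P p"
    by (rule cong) (simp add: H_def G(2) pF)
  ultimately show "P p + P (\<lambda>u. relocate (p 1) (G (1, u))) = P (\<lambda>u. relocate (p 0) (G (0, u))) + P (\<lambda>t. relocate (p t) (G (t, 1)))"
    by (simp add: H_def)
  show "u \<in> {0..1} \<Longrightarrow> path (\<lambda>t. relocate (p t) (G (t, u)))" "u \<in> {0..1} \<Longrightarrow> path_image (\<lambda>t. relocate (p t) (G (t, u))) \<subseteq> F"
  proof -
    assume u: "u \<in> {0..1}"
    have "continuous_on {0..1} (\<lambda>t. H (t, u))"
      using u by (intro continuous_on_compose2[OF contH]) (auto intro!: continuous_intros)
    then show "path (\<lambda>t. relocate (p t) (G (t, u)))" by (simp add: path_def H_def)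
    show "path_image (\<lambda>t. relocate (p t) (G (t, u))) \<subseteq> F" using HF u unfolding path_image_def H_def by force
  qed
  show "t \<in> {0..1} \<Longrightarrow> path (\<lambda>u. relocate (p t) (G (t, u)))" "t \<in> {0..1} \<Longrightarrow> path_image (\<lambda>u. relocate (p t) (G (t, u))) \<subseteq> F"
  proof -
    assume t: "t \<in> {0..1}"
    have "continuous_on {0..1} (\<lambda>u. H (t, u))"
      using t by (intro continuous_on_compose2[OF contH]) (auto intro!: continuous_intros)
    then show "path (\<lambda>u. relocate (p t) (G (t, u)))" by (simp add: path_def H_def)
    show "path_image (\<lambda>u. relocate (p t) (G (t, u))) \<subseteq> F" using HF t unfolding path_image_def H_def by force
  qed
qed

text \<open>The only value at \<open>v\<close> of a primitive that continues
  \<open>far_primitive\<close> back along the ray.\<close>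

definition ray_primitive :: "real \<Rightarrow> complex \<Rightarrow> complex \<times> complex \<times> complex \<Rightarrow> complex" where
  "ray_primitive s w v = far_primitive (ray s w v 1) - P (ray s w v)"

text \<open>Carrying \<open>p\<close> along its rays sweeps a square whose opposite side lies in
  \<open>far_region\<close>, where integrals are known.\<close>

lemma primitive_on_ray_free:
  assumes w: "norm w = 1" and s: "0 \<le> s"
  shows "primitive_on P (ray_free w \<inter> F) (ray_primitive s w)"
  unfolding primitive_on_def
proof (intro allI impI)
  fix p assume p: "path p" "path_image p \<subseteq> ray_free w \<inter> F"
  have w0: "w \<noteq> 0" using w by auto
  have pN: "p t \<in> ray_free w" "p t \<in> F" if "t \<in> {0..1}" for t using p that by (auto simp: path_image_def)
  define G where "G x = (fst (p (fst x)), fst (snd (p (fst x))) + of_real (snd x * len s (p (fst x))) * w)" for x :: "real \<times> real"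
  have cp: "continuous_on ({0..1} \<times> {0..1}) (\<lambda>x. p (fst x))"
    using p(1) unfolding path_def by (rule continuous_on_compose2) (auto intro!: continuous_intros)
  have "continuous_on ({0..1} \<times> {0..1}) (\<lambda>x. len s (p (fst x)))"
    unfolding len_def by (intro continuous_intros cp)
  then have G: "continuous_on ({0..1} \<times> {0..1}) G" unfolding G_def by (intro continuous_intros cp)
  have *: "path p" "path_image p \<subseteq> F" using p by auto
  note pu = push[OF * G]
  have g0: "G (t, 0) = base (p t)" for t by (simp add: G_def base_def)
  have r: "q i (G (t, u)) / q i (base (p t)) \<notin> \<real>\<^sub>\<le>\<^sub>0" if "t \<in> {0..1}" "u \<in> {0..1}" "i \<in> I" for t u i
    using ray_ratio[OF pN(2)[OF that(1)] pN(1)[OF that(1)] w0 s _ that(3)] that(2) by (simp add: G_def)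
  have rayG: "relocate (p t) (G (t, u)) = ray s w (p t) u" for t u by (simp add: ray_def G_def)
  have 1: "P p + P (ray s w (p 1)) = P (ray s w (p 0)) + P (\<lambda>t. ray s w (p t) 1)"
    using pu(1)[OF g0 r] by (simp add: rayG)
  have 2: "path (\<lambda>t. ray s w (p t) 1)" "path_image (\<lambda>t. ray s w (p t) 1) \<subseteq> F"
    using pu(2,3)[OF g0 r, of 1] by (simp_all add: rayG)
  have "path_image (\<lambda>t. ray s w (p t) 1) \<subseteq> far_region \<inter> F"
    using 2(2) ray_end_far_region[OF w s] unfolding path_image_def by blast
  then have "P (\<lambda>t. ray s w (p t) 1) = far_primitive (ray s w (p 1) 1) - far_primitive (ray s w (p 0) 1)"
    using primitive_onD[OF primitive_on_far_region 2(1)] by (simp add: pathfinish_def pathstart_def)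
  with 1 show "P p = ray_primitive s w (pathfinish p) - ray_primitive s w (pathstart p)"
    by (simp add: ray_primitive_def pathfinish_def pathstart_def algebra_simps)
qed

lemma ray_primitive_deck:
  assumes "v \<in> F" "v \<in> ray_free w" "norm w = 1" "0 \<le> s"
  shows "ray_primitive s w (deck l v) = e ^ l * ray_primitive s w v"
proof -
  have w0: "w \<noteq> 0" using assms by auto
  note pr = path_ray[OF assms(1,2) w0 assms(4)]
  have "ray s w v 1 \<in> F" using pr(2) by (auto simp: path_image_def)
  then have "far_primitive (ray s w (deck l v) 1) = e ^ l * far_primitive (ray s w v 1)"
    using far_primitive_deck ray_end_far_region[OF assms(3,4)] by (simp add: ray_deck)
  moreover have "ray s w (deck l v) = deck l \<circ> ray s w v" by (simp add: fun_eq_iff ray_deck)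
  then have "P (ray s w (deck l v)) = e ^ l * P (ray s w v)" using deck_pow[OF pr] by simp
  ultimately show ?thesis by (simp add: ray_primitive_def algebra_simps)
qed

lemma ray_primitive_eq:
  assumes "v \<in> F" "v \<in> ray_free w" "norm w = 1" "0 \<le> s"
    and "primitive_on P (X \<inter> F) \<psi>" "path_image (ray s w v) \<subseteq> X" "\<And>v. v \<in> far_region \<Longrightarrow> \<psi> v = far_primitive v"
  shows "ray_primitive s w v = \<psi> v"
proof -
  have w0: "w \<noteq> 0" using assms by auto
  note pr = path_ray[OF assms(1,2) w0 assms(4)]
  have "P (ray s w v) = \<psi> (ray s w v 1) - \<psi> (ray s w v 0)"
    using primitive_onD[OF assms(5) pr(1)] pr(2) assms(6) by (simp add: pathfinish_def pathstart_def)
  then show ?thesis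
    using assms(7)[OF ray_end_far_region[OF assms(3,4), of v]] ray_0[OF assms(1)] by (simp add: ray_primitive_def)
qed

text \<open>The defect of the vertical line through \<open>v\<close> in the y-plane: the difference
  of \<open>far_primitive\<close> between the upper and the lower end, minus the integral of
  \<open>P\<close> from the lower to the upper end. It vanishes exactly when the upward and downward
  continuations agree at \<open>v\<close>.\<close>

definition kappa where "kappa s v = ray_primitive s \<i> v - ray_primitive s (- \<i>) v"

definition free_line where "free_line v \<longleftrightarrow> (\<forall>i\<in>I. Re (q i (base v)) \<noteq> 0)"

lemma free_line_ray_free: "free_line v \<Longrightarrow> v \<in> ray_free \<i>" "free_line v \<Longrightarrow> v \<in> ray_free (- \<i>)"
  by (auto simp: free_line_def ray_free_def complex_nonpos_Reals_iff)

lemma kappa_deck: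
  assumes "v \<in> F" "free_line v" "0 \<le> s"
  shows "kappa s (deck l v) = e ^ l * kappa s v"
  using assms ray_primitive_deck[of v] free_line_ray_free by (simp add: kappa_def algebra_simps)

text \<open>While no real part of a \<open>q i\<close> changes sign, the moving vertical line
  crosses no puncture, and both ray primitives change by the same integral of \<open>P\<close>.
  Within a sheet, \<open>kappa\<close> depends only on the strip between punctures.\<close>

lemma kappa_move:
  assumes v: "v \<in> F" and s: "0 \<le> s"
    and sg: "\<And>i. i \<in> I \<Longrightarrow> 0 < Re (q i (base v)) * Re (q i (fst v, y))"
  shows "relocate v (fst v, y) \<in> F" "free_line (relocate v (fst v, y))" "kappa s (relocate v (fst v, y)) = kappa s v"
proof -
  define G where "G x = (fst v, fst (snd v) + of_real x * (y - fst (snd v)))" for x :: real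
  define p where "p x = relocate v (G x)" for x
  have qG: "q i (G t) = of_real (1 - t) * q i (base v) + of_real t * q i (fst v, y)" for i t
    by (simp add: G_def q_def base_def algebra_simps)
  have pos: "0 < Re (q i (base v)) * Re (q i (G t))" if "i \<in> I" "t \<in> {0..1}" for i t
  proof -
    have "Re (q i (base v)) * Re (q i (G t)) = (1 - t) * (Re (q i (base v)))\<^sup>2 + t * (Re (q i (base v)) * Re (q i (fst v, y)))"
      by (simp add: qG algebra_simps power2_eq_square)
    moreover have "(Re (q i (base v)))\<^sup>2 > 0" using sg[OF that(1)] by auto
    ultimately show ?thesis using sg[OF that(1)] that(2)
      by (cases "t = 0") (auto intro!: add_nonneg_pos mult_nonneg_nonneg mult_pos_pos)
  qed
  have r: "q i (G t) / q i (base v) \<notin> \<real>\<^sub>\<le>\<^sub>0" if "i \<in> I" "t \<in> {0..1}" for i t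
  proof
    assume "q i (G t) / q i (base v) \<in> \<real>\<^sub>\<le>\<^sub>0"
    then obtain k where k: "k \<le> 0" "q i (G t) / q i (base v) = of_real k" by (auto elim!: nonpos_Reals_cases)
    then have "q i (G t) = of_real k * q i (base v)" using F_nonzero(1)[OF v that(1)] by (simp add: field_simps)
    then have "Re (q i (base v)) * Re (q i (G t)) = k * (Re (q i (base v)))\<^sup>2" by (simp add: power2_eq_square)
    then show False using pos[OF that] k(1) by (metis mult_nonpos_nonneg not_less zero_le_power2)
  qed
  have pF: "p t \<in> F" if "t \<in> {0..1}" for t
    unfolding p_def using ratio_notin_imp_relocate_in_F[OF v r] that by simp
  have fr: "free_line (p t)" if "t \<in> {0..1}" for t
    unfolding free_line_def using pos that by (force simp: p_def)
  have path: "path p"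
    unfolding path_def p_def
  proof (rule continuous_on_relocate)
    show "(\<lambda>x. v) ` {0..1} \<subseteq> F" using v by blast
    show "continuous_on {0..1} G" unfolding G_def by (intro continuous_intros)
  qed (use r in simp_all)
  have "path_image p \<subseteq> ray_free \<i> \<inter> F" "path_image p \<subseteq> ray_free (- \<i>) \<inter> F"
    using pF fr free_line_ray_free unfolding path_image_def by blast+
  then have "P p = ray_primitive s \<i> (p 1) - ray_primitive s \<i> (p 0)" "P p = ray_primitive s (- \<i>) (p 1) - ray_primitive s (- \<i>) (p 0)"
    using primitive_onD[OF primitive_on_ray_free path, of \<i> s] primitive_onD[OF primitive_on_ray_free path, of "- \<i>" s] s
    by (simp_all add: pathfinish_def pathstart_def)
  then have "ray_primitive s \<i> (p 1) = P p + ray_primitive s \<i> (p 0)" "ray_primitive s (- \<i>) (p 1) = P p + ray_primitive s (- \<i>) (p 0)"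
    by (metis diff_add_cancel)+
  then have "kappa s (p 1) = kappa s (p 0)" by (simp add: kappa_def)
  moreover have "p 0 = v" "p 1 = relocate v (fst v, y)"
    using relocate_self[OF v] by (simp_all add: p_def G_def base_def)
  ultimately show "relocate v (fst v, y) \<in> F" "free_line (relocate v (fst v, y))" "kappa s (relocate v (fst v, y)) = kappa s v"
    using pF[of 1] fr[of 1] by simp_all
qed

end

section \<open>One line far from the origin\<close>

text \<open>The gap to the right of the puncture \<open>i\<close>, for those \<open>i\<close> that are not rightmost in their cluster; only resonant
  clusters count. The cluster of slope \<open>a\<close> is a point of multiplicity \<open>Suc (card {j. al j = a})\<close>, because the line at
  infinity passes through it.\<close>

definition (in lines) gaps :: "complex \<Rightarrow> 'i set" where
  "gaps e = {i\<in>I. (\<exists>j\<in>I. al j = al i \<and> Re (be i) < Re (be j)) \<and> e ^ Suc (card {j\<in>I. al j = al i}) = 1}"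

text \<open>The separation \<open>8 * B\<close> leaves room for the discs of radius
  \<open>3 * B\<close> and the strips of half width \<open>2 * B\<close> around
  \<open>al i * s1\<close> used below. \<open>pt i\<close> lies at distance \<open>ep\<close> to the
  right of puncture \<open>i\<close>, before the next puncture of its cluster, and serves to test
  the gap there.\<close>

locale generic_line = lines I al be C B for I :: "'i set" and al be C B +
  fixes s1 :: complex and ep :: real and pt :: "'i \<Rightarrow> complex \<times> complex \<times> complex"
  assumes sep: "i \<in> I \<Longrightarrow> j \<in> I \<Longrightarrow> al i \<noteq> al j \<Longrightarrow> 8 * B < \<bar>Re ((al i - al j) * s1)\<bar>"
    and ep: "0 < ep" "ep \<le> B"
    and ep_less: "i \<in> I \<Longrightarrow> j \<in> I \<Longrightarrow> i \<noteq> j \<Longrightarrow> al i = al j \<Longrightarrow> ep < \<bar>Re (be i) - Re (be j)\<bar>"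
    and pt: "i \<in> I \<Longrightarrow> pt i \<in> F" "i \<in> I \<Longrightarrow> base (pt i) = (s1, al i * s1 + be i + of_real ep)"
begin

lemma Re_q: "fst b = s1 \<Longrightarrow> Re (q i b) = Re (snd b - al j * s1) + Re ((al j - al i) * s1) - Re (be i)"
  by (simp add: q_def algebra_simps)

lemma Re_be: "i \<in> I \<Longrightarrow> \<bar>Re (be i)\<bar> < B"
  using be_less_B[of i] abs_Re_le_cmod[of "be i"] by linarith

lemma Re_q_distinct:
  assumes "i \<in> I" "j \<in> I" "i \<noteq> j"
  shows "Re (al i * s1 + be i) \<noteq> Re (al j * s1 + be j)"
proof (cases "al i = al j")
  case True
  then show ?thesis using be_distinct[OF assms] by simp
next
  case False
  then show ?thesis
    using sep[OF assms(1,2) False] Re_be[OF assms(1)] Re_be[OF assms(2)] B_pos by (auto simp: algebra_simps)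
qed

text \<open>The punctures over \<open>s1\<close> have distinct real parts, so a vertical line
  contains at most one of them and obstructs at most one of the two directions.\<close>

lemma fibre_cover:
  assumes "v \<in> F" "fst v = s1" shows "v \<in> ray_free \<i> \<or> v \<in> ray_free (- \<i>)"
proof (rule ccontr)
  assume "\<not> ?thesis"
  then obtain i j where ij: "i \<in> I" "j \<in> I" "q i (base v) / \<i> \<in> \<real>\<^sub>\<le>\<^sub>0" "q j (base v) / (- \<i>) \<in> \<real>\<^sub>\<le>\<^sub>0"
    by (auto simp: ray_free_def)
  then have 0: "Re (q i (base v)) = 0" "Im (q i (base v)) \<le> 0" "Re (q j (base v)) = 0" "0 \<le> Im (q j (base v))"
    by (auto simp: complex_nonpos_Reals_iff)
  have "Re (al i * s1 + be i) = Re (al j * s1 + be j)"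
    using 0(1,3) assms(2) by (simp add: q_def base_def)
  then have "i = j" using Re_q_distinct[OF ij(1,2)] by blast
  then have "q i (base v) = 0" using 0 by (simp add: complex_eq_iff)
  then show False using F_nonzero(1)[OF assms(1) ij(1)] by simp
qed

lemma same_sign_other_class:
  assumes "i \<in> I" "j \<in> I" "al i \<noteq> al j" "fst b = s1" "fst b' = s1"
    and "\<bar>Re (snd b - al j * s1)\<bar> \<le> 2 * B" "\<bar>Re (snd b' - al j * s1)\<bar> \<le> 2 * B"
  shows "0 < Re (q i b) * Re (q i b')"
proof -
  have s: "8 * B < \<bar>Re ((al j - al i) * s1)\<bar>" using sep[OF assms(2,1)] assms(3) by metis
  note Re_q[OF assms(4), of i j] Re_q[OF assms(5), of i j] Re_be[OF assms(1)]
  then have "(0 < Re (q i b) \<and> 0 < Re (q i b')) \<or> (Re (q i b) < 0 \<and> Re (q i b') < 0)"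
    using s assms(6,7) B_pos by linarith
  then show ?thesis using mult_neg_neg by auto
qed

end

locale generic_functional = generic_line I al be C B s1 ep pt + eigen_functional I al be C B P e
  for I :: "'i set" and al be C B s1 ep pt P e +
  assumes gaps_kappa: "i \<in> gaps e \<Longrightarrow> kappa (norm s1) (pt i) = 0"
begin

text \<open>Both vertical rays keep their real distance from all \<open>al i * s1\<close> and never
  leave \<open>far_region\<close>, so both continuations give \<open>far_primitive\<close>.\<close>

lemma kappa_wide:
  assumes v: "v \<in> F" "fst v = s1" "free_line v"
    and wide: "\<And>i. i \<in> I \<Longrightarrow> B < \<bar>Re (fst (snd v) - al i * s1)\<bar>"
  shows "kappa (norm s1) v = 0"
proof -
  have "path_image (ray (norm s1) w v) \<subseteq> far_region" if "Re w = 0" for w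
  proof -
    have "ray (norm s1) w v u \<in> far_region" for u
      unfolding far_region_def
    proof (intro CollectI ballI)
      fix i assume "i \<in> I"
      have "Re (fst (snd (ray (norm s1) w v u)) - al i * fst (ray (norm s1) w v u)) = Re (fst (snd v) - al i * s1)"
        using that v(2) by simp
      then show "B < norm (fst (snd (ray (norm s1) w v u)) - al i * fst (ray (norm s1) w v u))"
        using wide[OF \<open>i \<in> I\<close>] abs_Re_le_cmod[of "fst (snd (ray (norm s1) w v u)) - al i * fst (ray (norm s1) w v u)"]
        by linarith
    qed
    then show ?thesis unfolding path_image_def by blast
  qed
  then have "ray_primitive (norm s1) \<i> v = far_primitive v" "ray_primitive (norm s1) (- \<i>) v = far_primitive v"
    using ray_primitive_eq[OF v(1) _ _ _ primitive_on_far_region] free_line_ray_free[OF v(3)] by simp_all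
  then show ?thesis by (simp add: kappa_def)
qed

text \<open>The whole vertical line lies in the union of \<open>far_region\<close> and the region of
  the cluster, where nonresonance provides an extension of \<open>far_primitive\<close>. Both
  continuations equal this extension.\<close>

lemma kappa_nonresonant:
  assumes v: "v \<in> F" "fst v = s1" "free_line v"
    and j: "j \<in> I" "\<bar>Re (fst (snd v) - al j * s1)\<bar> \<le> B"
    and e: "e ^ Suc (card {i\<in>I. al i = al j}) \<noteq> 1"
  shows "kappa (norm s1) v = 0"
proof -
  obtain \<psi> where \<psi>: "primitive_on P ((far_region \<union> cluster_region (al j)) \<inter> F) \<psi>" "\<And>v. v \<in> far_region \<Longrightarrow> \<psi> v = far_primitive v"
    using primitive_on_cluster_region[OF e] by blast
  have sep': "8 * B < \<bar>Re ((al j - al i) * s1)\<bar>" if "i \<in> I" "al i \<noteq> al j" for i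
    using sep[OF j(1) that(1)] that(2) by metis
  have "path_image (ray (norm s1) w v) \<subseteq> far_region \<union> cluster_region (al j)" if w: "Re w = 0" for w
  proof -
    have "ray (norm s1) w v u \<in> far_region \<union> cluster_region (al j)" for u
    proof -
      let ?x = "ray (norm s1) w v u"
      let ?Y = "fst (snd ?x) - al j * s1"
      have ReY: "\<bar>Re ?Y\<bar> \<le> B" using w j(2) by simp
      show ?thesis
      \<comment> \<open>Within radius \<open>3 * B\<close>, the sum \<open>3 * B + B\<close> is
        below the separation, as \<open>cluster_region\<close> demands. Outside, the distance to the
        lines of the same slope exceeds \<open>B\<close>, and the other slopes are far away in real
        part.\<close>
      proof (cases "norm ?Y \<le> 3 * B")
        case True
        have "norm ?Y + B < norm (al j - al i) * norm s1" if "i \<in> I" "al i \<noteq> al j" for i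
        proof -
          have "norm ?Y + B < \<bar>Re ((al j - al i) * s1)\<bar>" using sep'[OF that] True B_pos by linarith
          also have "\<dots> \<le> norm (al j - al i) * norm s1" using abs_Re_le_cmod by (metis norm_mult)
          finally show ?thesis .
        qed
        then show ?thesis using v(2) by (auto simp: cluster_region_def)
      next
        case False
        have "B < norm (fst (snd ?x) - al i * s1)" if "i \<in> I" for i
        proof (cases "al i = al j")
          case True
          then show ?thesis using False B_pos by simp
        next
          case ne: False
          have "Re (fst (snd ?x) - al i * s1) = Re ?Y + Re ((al j - al i) * s1)"
            using v(2) by (simp add: algebra_simps)
          then show ?thesis using sep'[OF that ne] ReY B_pos abs_Re_le_cmod[of "fst (snd ?x) - al i * s1"] by linarith
        qed
        then show ?thesis using v(2) by (auto simp: far_region_def)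
      qed
    qed
    then show ?thesis unfolding path_image_def by blast
  qed
  then have "ray_primitive (norm s1) \<i> v = \<psi> v" "ray_primitive (norm s1) (- \<i>) v = \<psi> v"
    using ray_primitive_eq[OF v(1) _ _ _ \<psi>(1) _ \<psi>(2)] free_line_ray_free[OF v(3)] by simp_all
  then show ?thesis by (simp add: kappa_def)
qed

text \<open>The vertical line slides within its strip to a place where the defect is known: out of
  the cluster if all its punctures lie on one side, otherwise, in a resonant cluster, to the test
  point of the gap.\<close>

lemma kappa_0:
  assumes v: "v \<in> F" "fst v = s1" "free_line v"
  shows "kappa (norm s1) v = 0"
proof -
  let ?y = "fst (snd v)"
  have bv: "base v = (s1, ?y)" using v(2) by (simp add: base_def)
  show ?thesis
  proof (cases "\<exists>j\<in>I. \<bar>Re (?y - al j * s1)\<bar> \<le> B")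
    case False
    then show ?thesis using kappa_wide[OF v] by force
  next
    case True
    then obtain j where j: "j \<in> I" "\<bar>Re (?y - al j * s1)\<bar> \<le> B" by blast
    have q_class: "Re (q i (s1, y)) = Re (y - al j * s1) - Re (be i)" if "al i = al j" for i y
      using Re_q[of "(s1, y)" i j] that by simp
    have move: "kappa (norm s1) v = kappa (norm s1) (relocate v (s1, y'))" "relocate v (s1, y') \<in> F" "free_line (relocate v (s1, y'))"
      if "\<bar>Re (y' - al j * s1)\<bar> \<le> 2 * B" "\<And>i. i \<in> I \<Longrightarrow> al i = al j \<Longrightarrow> 0 < Re (q i (s1, ?y)) * Re (q i (s1, y'))" for y'
    proof -
      have "0 < Re (q i (base v)) * Re (q i (fst v, y'))" if "i \<in> I" for i
      proof (cases "al i = al j")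
        case True
        then show ?thesis using \<open>i \<in> I\<close> \<open>\<And>i. i \<in> I \<Longrightarrow> al i = al j \<Longrightarrow> _ i\<close> bv v(2) by simp
      next
        case False
        show ?thesis
          unfolding bv v(2) using j(2) B_pos \<open>\<bar>Re (y' - al j * s1)\<bar> \<le> 2 * B\<close>
          by (intro same_sign_other_class[OF that j(1) False]) auto
      qed
      from kappa_move[OF v(1) norm_ge_zero[of s1] this] show "kappa (norm s1) v = kappa (norm s1) (relocate v (s1, y'))" "relocate v (s1, y') \<in> F" "free_line (relocate v (s1, y'))"
        by (simp_all add: v(2))
    qed
    have edge: "kappa (norm s1) v = 0"
      if "\<bar>Re (y' - al j * s1)\<bar> = 2 * B" "\<And>i. i \<in> I \<Longrightarrow> al i = al j \<Longrightarrow> 0 < Re (q i (s1, ?y)) * Re (q i (s1, y'))" for y'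
    proof -
      have "kappa (norm s1) (relocate v (s1, y')) = 0"
      proof (rule kappa_wide)
        fix i assume i: "i \<in> I"
        have "B < \<bar>Re (y' - al i * s1)\<bar>"
        proof (cases "al i = al j")
          case True
          then show ?thesis using that(1) B_pos by simp
        next
          case False
          have "Re (y' - al i * s1) = Re (y' - al j * s1) + Re ((al j - al i) * s1)" by (simp add: algebra_simps)
          moreover have "8 * B < \<bar>Re ((al j - al i) * s1)\<bar>" using sep[OF j(1) i] False by metis
          ultimately show ?thesis using that(1) B_pos by linarith
        qed
        then show "B < \<bar>Re (fst (snd (relocate v (s1, y'))) - al i * s1)\<bar>" by simp
      qed (use move[of y'] that in auto)
      then show ?thesis using move(1)[of y'] that by simp
    qed
    show ?thesis
    proof (cases "e ^ Suc (card {i\<in>I. al i = al j}) = 1")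
      case False
      then show ?thesis using kappa_nonresonant[OF v j] by blast
    next
      case e1: True
      \<comment> \<open>The punctures of the cluster to the left of \<open>v\<close>.\<close>
      define L where "L = {i\<in>I. al i = al j \<and> 0 < Re (q i (s1, ?y))}"
      have neg: "Re (q i (s1, ?y)) < 0" if "i \<in> I" "al i = al j" "i \<notin> L" for i
        using that v(3) bv unfolding L_def free_line_def by force
      show ?thesis
      proof (cases "L = {}")
        case True
        \<comment> \<open>A real shift brings the offset from \<open>al j * s1\<close> to
          \<open>- 2 * B\<close>, to the left of all punctures of the cluster.\<close>
        show ?thesis
        proof (rule edge[of "?y - of_real (Re (?y - al j * s1) + 2 * B)"])
          fix i assume i: "i \<in> I" "al i = al j"
          have "Re (q i (s1, ?y - of_real (Re (?y - al j * s1) + 2 * B))) < 0"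
            using q_class[OF i(2)] Re_be[OF i(1)] B_pos by simp
          then show "0 < Re (q i (s1, ?y)) * Re (q i (s1, ?y - of_real (Re (?y - al j * s1) + 2 * B)))"
            using neg[OF i] True mult_neg_neg by blast
        qed (use B_pos in simp)
      next
        case False
        have finL: "finite L" using finite_I by (simp add: L_def)
        \<comment> \<open>The right-most puncture to the left of \<open>v\<close>, so
          \<open>v\<close> lies in the gap to the right of \<open>i\<close>.\<close>
        obtain i where i: "i \<in> L" "\<And>k. k \<in> L \<Longrightarrow> Re (be k) \<le> Re (be i)"
        proof -
          have "Max ((\<lambda>k. Re (be k)) ` L) \<in> (\<lambda>k. Re (be k)) ` L" using finL False by (intro Max_in) auto
          then obtain i where "i \<in> L" "Re (be i) = Max ((\<lambda>k. Re (be k)) ` L)" by auto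
          then show ?thesis using that[of i] finL by simp
        qed
        then have iI: "i \<in> I" "al i = al j" and qi: "0 < Re (q i (s1, ?y))" by (auto simp: L_def)
        show ?thesis
        proof (cases "\<exists>k\<in>I. al k = al i \<and> Re (be i) < Re (be k)")
          case True
          then have "i \<in> gaps e" using iI e1 by (simp add: gaps_def)
          let ?y' = "al i * s1 + be i + of_real ep"
          have "Re (q k (s1, ?y')) = Re (be i) + ep - Re (be k)" if "al k = al j" for k
            using q_class[OF that, of ?y'] iI(2) by simp
          note qk = this
          have pos: "0 < Re (q k (s1, ?y)) * Re (q k (s1, ?y'))" if k: "k \<in> I" "al k = al j" for k
          proof (cases "k \<in> L")
            case True
            then show ?thesis using i(2)[OF True] qk[OF k(2)] ep(1) by (auto simp: L_def)
          next
            case False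
            have "Re (be i) < Re (be k)" using neg[OF k False] qi q_class[OF k(2), of ?y] q_class[OF iI(2), of ?y] by linarith
            then have "ep < Re (be k) - Re (be i)" using ep_less[OF iI(1) k(1)] iI(2) k(2) by force
            then show ?thesis using qk[OF k(2)] neg[OF k False] by (simp add: mult_neg_neg)
          qed
          have bound: "\<bar>Re (?y' - al j * s1)\<bar> \<le> 2 * B" using iI Re_be[OF iI(1)] ep by simp
          note mv = move[OF bound pos]
          \<comment> \<open>The relocated point may lie on another sheet than \<open>pt i\<close>;
            this multiplies \<open>kappa\<close> by a power of \<open>e\<close> and preserves its
            vanishing.\<close>
          obtain l where l: "relocate v (s1, ?y') = deck l (pt i)"
            using F_same_base[OF pt(1)[OF iI(1)] mv(2)] pt(2)[OF iI(1)] by auto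
          have "free_line (pt i)"
            unfolding free_line_def pt(2)[OF iI(1)]
            using mv(3) by (simp add: free_line_def)
          then show ?thesis
            using mv(1) l kappa_deck[OF pt(1)[OF iI(1)] _ norm_ge_zero, of s1] gaps_kappa[OF \<open>i \<in> gaps e\<close>] by simp
        next
          case top: False
          show ?thesis
          proof (rule edge[of "?y - of_real (Re (?y - al j * s1) - 2 * B)"])
            fix k assume k: "k \<in> I" "al k = al j"
            have "Re (q k (s1, ?y - of_real (Re (?y - al j * s1) - 2 * B))) > 0"
              using q_class[OF k(2)] Re_be[OF k(1)] B_pos by simp
            moreover have "Re (be k) \<le> Re (be i)" using top k iI by force
            then have "0 < Re (q k (s1, ?y))" using qi q_class[OF k(2), of ?y] q_class[OF iI(2), of ?y] by linarith
            ultimately show "0 < Re (q k (s1, ?y)) * Re (q k (s1, ?y - of_real (Re (?y - al j * s1) - 2 * B)))"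
              by simp
          qed (use B_pos in simp)
        qed
      qed
    qed
  qed
qed

text \<open>With all defects zero the upward and downward ray primitives glue over the fibre. At
  points of large norm the glued function is \<open>far_primitive\<close>, because a ray leading
  away from the real axis never decreases the norm.\<close>

lemma fibre_primitive:
  assumes "path p" "path_image p \<subseteq> F \<inter> {v. fst v = s1}"
    and R: "K * (1 + norm s1) \<le> R" "R < norm (fst (snd (pathstart p)))" "R < norm (fst (snd (pathfinish p)))"
  shows "P p = far_primitive (pathfinish p) - far_primitive (pathstart p)"
proof -
  let ?Y = "F \<inter> {v. fst v = s1}" and ?s = "norm s1"
  let ?\<psi> = "\<lambda>v. if v \<in> ray_free \<i> then ray_primitive ?s \<i> v else ray_primitive ?s (- \<i>) v"
  have eq: "ray_primitive ?s \<i> v = ray_primitive ?s (- \<i>) v" if "v \<in> ray_free \<i> \<inter> ray_free (- \<i>) \<inter> ?Y" for v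
  proof -
    have "free_line v"
      unfolding free_line_def
    proof (intro ballI notI)
      fix i assume i: "i \<in> I" "Re (q i (base v)) = 0"
      have "q i (base v) / \<i> \<notin> \<real>\<^sub>\<le>\<^sub>0" "q i (base v) / (- \<i>) \<notin> \<real>\<^sub>\<le>\<^sub>0" using that i by (auto simp: ray_free_def)
      then show False using i(2) by (auto simp: complex_nonpos_Reals_iff)
    qed
    then show ?thesis using kappa_0[of v] that by (simp add: kappa_def)
  qed
  have prim: "primitive_on P ((ray_free \<i> \<union> ray_free (- \<i>)) \<inter> ?Y) ?\<psi>"
  proof (rule primitive_on_Un[OF _ open_ray_free open_ray_free _ _ eq])
    show "primitive_on P (ray_free \<i> \<inter> ?Y) (ray_primitive ?s \<i>)" "primitive_on P (ray_free (- \<i>) \<inter> ?Y) (ray_primitive ?s (- \<i>))"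
      using primitive_on_ray_free[of \<i> ?s] primitive_on_ray_free[of "- \<i>" ?s] by (auto elim!: primitive_on_subset)
  qed auto
  have "path_image p \<subseteq> (ray_free \<i> \<union> ray_free (- \<i>)) \<inter> ?Y" using assms(2) fibre_cover by blast
  then have Pp: "P p = ?\<psi> (pathfinish p) - ?\<psi> (pathstart p)"
    using primitive_onD[OF prim assms(1)] by blast
  have outer: "?\<psi> v = far_primitive v" if v: "v \<in> ?Y" "R < norm (fst (snd v))" for v
  proof -
    let ?y = "fst (snd v)"
    have vF: "v \<in> F" "fst v = s1" using v by auto
    have ray_eq: "ray_primitive ?s w v = far_primitive v" if w: "w = \<i> \<and> 0 \<le> Im ?y \<or> w = - \<i> \<and> Im ?y \<le> 0" and N: "v \<in> ray_free w" for w
    proof -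
      have T: "ray ?s w v u \<in> far_region" if "0 \<le> u" for u
      proof (rule far_region_large)
        define r where "r = u * len ?s v"
        have r: "0 \<le> r" using that len_nonneg[of ?s v] by (simp add: r_def)
        have "\<bar>Re ?y\<bar> \<le> \<bar>Re (?y + of_real r * w)\<bar>" "\<bar>Im ?y\<bar> \<le> \<bar>Im (?y + of_real r * w)\<bar>"
          using w r by auto
        then have "norm ?y \<le> norm (?y + of_real r * w)"
          unfolding norm_complex_def by (intro real_sqrt_le_mono add_mono) (simp_all add: abs_le_square_iff)
        then show "K * (1 + norm (fst (ray ?s w v u))) < norm (fst (snd (ray ?s w v u)))"
          using R(1) v vF by (simp add: r_def)
      qed
      have "path_image (ray ?s w v) \<subseteq> far_region" using T unfolding path_image_def by force
      then show ?thesis using ray_primitive_eq[OF vF(1) N _ _ primitive_on_far_region] w by auto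
    qed
    have inNw: "v \<in> ray_free w" if w: "w = \<i> \<and> 0 \<le> Im ?y \<or> w = - \<i> \<and> Im ?y \<le> 0" for w
    proof -
      have "q i (base v) / w \<notin> \<real>\<^sub>\<le>\<^sub>0" if i: "i \<in> I" for i
      proof
        assume "q i (base v) / w \<in> \<real>\<^sub>\<le>\<^sub>0"
        then obtain k where k: "k \<le> 0" "q i (base v) / w = of_real k" by (auto elim!: nonpos_Reals_cases)
        have w0: "w \<noteq> 0" using w by auto
        have eq: "al i * s1 + be i = ?y - of_real k * w"
          using k(2) w0 vF by (simp add: field_simps q_def base_def)
        have "norm ?y \<le> norm (?y - of_real k * w)"
          unfolding norm_complex_def using w k(1)
          by (intro real_sqrt_le_mono) (auto simp: power_mono abs_le_square_iff[symmetric])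
        also have "\<dots> \<le> norm (al i) * norm s1 + B"
          using eq norm_triangle_ineq[of "al i * s1" "be i"] be_less_B[OF i] by (simp add: norm_mult)
        also have "\<dots> \<le> K * norm s1 + K"
          using al_le_K[OF i] B_pos B_le_K by (intro add_mono mult_right_mono) auto
        finally show False using R(1) v(2) by (simp add: algebra_simps)
      qed
      then show ?thesis by (simp add: ray_free_def)
    qed
    show ?thesis
    proof (cases "0 \<le> Im ?y")
      case True
      then show ?thesis using inNw ray_eq by auto
    next
      case False
      \<comment> \<open>The glued function may use the upward branch at this point;
        \<open>eq\<close> identifies it with the downward one.\<close>
      then have "v \<in> ray_free (- \<i>)" "ray_primitive ?s (- \<i>) v = far_primitive v" using inNw[of "- \<i>"] ray_eq[of "- \<i>"] by auto
      then show ?thesis using eq[of v] v by auto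
    qed
  qed
  have "pathstart p \<in> ?Y" "pathfinish p \<in> ?Y" using assms(2) by auto
  then show ?thesis unfolding Pp using outer R(2,3) by simp
qed

end

section \<open>Sweeping the parallel lines\<close>

lemma finite_positive_lower_bound:
  fixes A :: "real set"
  assumes "finite A" "\<And>x. x \<in> A \<Longrightarrow> 0 < x"
  obtains d where "0 < d" "\<And>x. x \<in> A \<Longrightarrow> d \<le> x"
  using that[of "Min (insert 1 A)"] assms by simp

text \<open>Each nonzero \<open>d\<close> excludes at most one \<open>r\<close> for a direction
  proportional to \<open>Complex 1 r\<close>. This serves the choice of free rays, of
  \<open>s1\<close> and of the coordinates.\<close>

lemma generic_direction:
  fixes D :: "complex set"
  assumes "finite D" "0 \<notin> D"
  obtains w where "norm w = 1" "\<And>d. d \<in> D \<Longrightarrow> Re (d * w) \<noteq> 0"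
proof -
  have "finite ((\<lambda>d. Re d / Im d) ` D)" using assms by simp
  then obtain r where r: "r \<notin> (\<lambda>d. Re d / Im d) ` D" using ex_new_if_finite[OF infinite_UNIV_char_0] by blast
  define w where "w = sgn (Complex 1 r)"
  have "norm w = 1" by (simp add: w_def norm_sgn complex_eq_iff)
  moreover have "Re (d * w) \<noteq> 0" if d: "d \<in> D" for d
  proof
    assume "Re (d * w) = 0"
    moreover have "w = Complex 1 r / of_real (norm (Complex 1 r))" by (simp add: w_def sgn_eq)
    then have "Re (d * w) = (Re d - r * Im d) / norm (Complex 1 r)"
      by (simp add: Re_divide_of_real Im_divide_of_real diff_divide_distrib mult.commute)
    moreover have "norm (Complex 1 r) \<noteq> 0" by (simp add: complex_eq_iff)
    ultimately have eq: "Re d = r * Im d" by simp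
    show False
    proof (cases "Im d = 0")
      case True
      then show False using eq assms(2) d by (metis complex_eqI mult_zero_right zero_complex.simps)
    next
      case False
      then have "r = Re d / Im d" using eq by simp
      then show False using r d by blast
    qed
  qed
  ultimately show ?thesis using that by blast
qed

context eigen_functional
begin

text \<open>Extendability of the far primitive over one fibre, phrased through paths whose ends
  alone are restricted. In this form it is compared between fibres by moving paths.\<close>

definition fibre_ok :: "real \<Rightarrow> complex \<Rightarrow> bool" where
  "fibre_ok R s \<longleftrightarrow> (\<forall>p. path p \<longrightarrow> path_image p \<subseteq> F \<inter> {v. fst v = s} \<longrightarrow>
     R < norm (fst (snd (pathstart p))) \<longrightarrow> R < norm (fst (snd (pathfinish p))) \<longrightarrow>
     P p = far_primitive (pathfinish p) - far_primitive (pathstart p))"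

text \<open>The straight move from \<open>s'\<close> to \<open>s\<close>, corrected by
  \<open>g\<close> in the second coordinate, changes each \<open>q i\<close> by less than its norm,
  hence never passes through 0. Beyond \<open>R\<close> the correction vanishes, so the ends travel
  inside \<open>far_region\<close> and contribute only values of
  \<open>far_primitive\<close>.\<close>

lemma transport:
  assumes p: "path p" "path_image p \<subseteq> F \<inter> {v. fst v = s'}"
    and R: "R < norm (fst (snd (pathstart p)))" "R < norm (fst (snd (pathfinish p)))" "K * (1 + S) \<le> R"
    and S: "norm s < S" "norm s' < S" and ok: "fibre_ok R s"
    and g: "continuous_on UNIV g" "\<And>y. R < norm y \<Longrightarrow> g y = 0"
    and less: "\<And>t i. t \<in> {0..1} \<Longrightarrow> i \<in> I \<Longrightarrow>
      norm (g (fst (snd (p t))) - al i * (s - s')) < norm (q i (base (p t)))"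
  shows "P p = far_primitive (pathfinish p) - far_primitive (pathstart p)"
proof -
  have pF: "p t \<in> F" "fst (p t) = s'" if "t \<in> {0..1}" for t using p that unfolding path_image_def by blast+
  define G where "G x = (s' + of_real (snd x) * (s - s'), fst (snd (p (fst x))) + of_real (snd x) * g (fst (snd (p (fst x)))))"
    for x :: "real \<times> real"
  have cp: "continuous_on ({0..1} \<times> {0..1}) (\<lambda>x. p (fst x))"
    using p(1) unfolding path_def by (rule continuous_on_compose2) (auto intro!: continuous_intros)
  have "continuous_on ({0..1} \<times> {0..1}) (\<lambda>x. g (fst (snd (p (fst x)))))"
    by (rule continuous_on_compose2[OF g(1)]) (auto intro!: continuous_intros cp)
  then have G: "continuous_on ({0..1} \<times> {0..1}) G" unfolding G_def by (intro continuous_intros cp)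
  have pF': "path_image p \<subseteq> F" using p by auto
  have G0: "G (t, 0) = base (p t)" if "t \<in> {0..1}" for t using pF that by (simp add: G_def base_def)
  have r: "q i (G (t, u)) / q i (base (p t)) \<notin> \<real>\<^sub>\<le>\<^sub>0" if "t \<in> {0..1}" "u \<in> {0..1}" "i \<in> I" for t u i
  proof -
    let ?d = "of_real u * (g (fst (snd (p t))) - al i * (s - s'))"
    have "q i (G (t, u)) = q i (base (p t)) + ?d"
      using pF(2)[OF that(1)] by (simp add: G_def q_def base_def algebra_simps)
    moreover have "norm ?d \<le> 1 * norm (g (fst (snd (p t))) - al i * (s - s'))"
      unfolding norm_mult using that(2) by (intro mult_right_mono) auto
    ultimately show ?thesis
      using norm_less_imp_ratio_notin_nonpos_Reals[of 0 "q i (base (p t))" ?d] less[OF that(1,3)]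
      by (simp add: F_nonzero(1)[OF pF(1)[OF that(1)] that(3)])
  qed
  note pu = push[OF p(1) pF' G G0 r]
  have side_path: "path (\<lambda>u. relocate (p t) (G (t, u)))" "path_image (\<lambda>u. relocate (p t) (G (t, u))) \<subseteq> F"
    if "t \<in> {0..1}" for t
    using pu(4,5)[where t = t] that by simp_all
  have top_path: "path (\<lambda>t. relocate (p t) (G (t, 1)))" "path_image (\<lambda>t. relocate (p t) (G (t, 1))) \<subseteq> F"
    using pu(2,3)[where u = 1] by simp_all
  have side: "P (\<lambda>u. relocate (p t) (G (t, u))) = far_primitive (relocate (p t) (G (t, 1))) - far_primitive (p t)"
    if t: "t \<in> {0..1}" and Rt: "R < norm (fst (snd (p t)))" for t
  proof -
    have "relocate (p t) (G (t, u)) \<in> far_region" if u: "u \<in> {0..1}" for u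
    proof (rule far_region_large)
      \<comment> \<open>The disc of radius \<open>S\<close> is convex, so \<open>R\<close> is large
        enough for all intermediate fibres.\<close>
      have "s' + of_real u * (s - s') \<in> ball 0 S"
        using convexD_alt[OF convex_ball[of 0 S], of s' s u] S u by (simp add: scaleR_conv_of_real algebra_simps)
      then have "K * (1 + norm (s' + of_real u * (s - s'))) \<le> K * (1 + S)"
        using B_le_K B_pos by (intro mult_left_mono) auto
      then show "K * (1 + norm (fst (relocate (p t) (G (t, u))))) < norm (fst (snd (relocate (p t) (G (t, u)))))"
        using Rt R(3) g(2)[OF Rt] by (simp add: G_def)
    qed
    then have "path_image (\<lambda>u. relocate (p t) (G (t, u))) \<subseteq> far_region \<inter> F"
      using side_path(2)[OF t] unfolding path_image_def by blast
    then show ?thesis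
      using primitive_onD[OF primitive_on_far_region side_path(1)[OF t]] relocate_self[OF pF(1)[OF t]] G0[OF t]
      by (simp add: pathfinish_def pathstart_def)
  qed
  have 01: "R < norm (fst (snd (p 0)))" "R < norm (fst (snd (p 1)))" using R by (simp_all add: pathfinish_def pathstart_def)
  have "P (\<lambda>t. relocate (p t) (G (t, 1))) = far_primitive (relocate (p 1) (G (1, 1))) - far_primitive (relocate (p 0) (G (0, 1)))"
  proof -
    have "path_image (\<lambda>t. relocate (p t) (G (t, 1))) \<subseteq> F \<inter> {v. fst v = s}"
      using top_path(2) unfolding path_image_def by (auto simp: G_def)
    moreover have "fst (snd (relocate (p t) (G (t, 1)))) = fst (snd (p t))" if "R < norm (fst (snd (p t)))" for t
      using g(2)[OF that] by (simp add: G_def)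
    ultimately show ?thesis
      using ok top_path(1) 01 unfolding fibre_ok_def by (simp add: pathfinish_def pathstart_def)
  qed
  then show ?thesis using pu(1) side[of 0] side[of 1] 01
    by (simp add: pathfinish_def pathstart_def algebra_simps)
qed

text \<open>By compactness a path keeps a positive distance from all lines and can be pushed with
  \<open>g = 0\<close> into a close fibre. How close depends on the path, so this yields limits but
  not openness; in return, punctures may collide in the limit.\<close>

lemma fibre_ok_limit:
  assumes R: "K * (1 + S) \<le> R" and s': "norm s' < S"
    and lim: "\<And>d. 0 < d \<Longrightarrow> \<exists>s. dist s s' < d \<and> norm s < S \<and> fibre_ok R s"
  shows "fibre_ok R s'"
  unfolding fibre_ok_def
proof (intro allI impI)
  fix p assume p: "path p" "path_image p \<subseteq> F \<inter> {v. fst v = s'}"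
    "R < norm (fst (snd (pathstart p)))" "R < norm (fst (snd (pathfinish p)))"
  have pF: "p t \<in> F" if "t \<in> {0..1}" for t using p that by (auto simp: path_image_def)
  have "\<exists>d>0. \<forall>t\<in>{0..1}. d \<le> norm (q i (base (p t)))" if i: "i \<in> I" for i
  proof -
    have "continuous_on {0..1} (\<lambda>t. norm (q i (base (p t))))"
      using p(1) unfolding path_def by (intro continuous_intros)
    then obtain t0 where t0: "t0 \<in> {0..1}" "\<And>t. t \<in> {0..1} \<Longrightarrow> norm (q i (base (p t0))) \<le> norm (q i (base (p t)))"
      using continuous_attains_inf[of "{0..1::real}"] by (metis atLeastAtMost_iff compact_Icc empty_iff order_refl zero_le_one)
    have "0 < norm (q i (base (p t0)))" using F_nonzero(1)[OF pF[OF t0(1)] i] by simp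
    then show ?thesis using t0(2) by blast
  qed
  then obtain d where d: "\<And>i. i \<in> I \<Longrightarrow> 0 < d i" "\<And>i t. i \<in> I \<Longrightarrow> t \<in> {0..1} \<Longrightarrow> d i \<le> norm (q i (base (p t)))"
    by metis
  obtain d0 where d0: "0 < d0" "\<And>x. x \<in> d ` I \<Longrightarrow> d0 \<le> x"
    using finite_positive_lower_bound[of "d ` I"] finite_I d(1) by blast
  have K: "0 < K" using B_le_K B_pos by linarith
  then obtain s where s: "dist s s' < d0 / K" "norm s < S" "fibre_ok R s" using lim[of "d0 / K"] d0 by auto
  show "P p = far_primitive (pathfinish p) - far_primitive (pathstart p)"
  proof (rule transport[OF p(1,2,3,4) R s(2) s' s(3), where g = "\<lambda>_. 0"])
    fix t :: real and i assume ti: "t \<in> {0..1}" "i \<in> I"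
    have "norm (al i) * norm (s - s') \<le> K * norm (s - s')"
      using al_le_K[OF ti(2)] B_pos by (intro mult_right_mono) auto
    also have "\<dots> < d0" using s(1) K by (simp add: dist_norm field_simps)
    also have "\<dots> \<le> norm (q i (base (p t)))" using d0(2)[of "d i"] d(2)[OF ti(2,1)] ti(2) by force
    finally show "norm (0 - al i * (s - s')) < norm (q i (base (p t)))" by (simp add: norm_mult)
  qed simp_all
qed

text \<open>Near a parameter \<open>s0\<close> whose fibre meets the lines in distinct points, a path is carried from one
  fibre to another by dragging discs around these points along with the punctures.\<close>

lemma fibre_ok_nearby:
  assumes R: "K * (1 + S) \<le> R" and s0: "norm s0 < S"
    and inj: "\<And>i j. i \<in> I \<Longrightarrow> j \<in> I \<Longrightarrow> i \<noteq> j \<Longrightarrow> al i * s0 + be i \<noteq> al j * s0 + be j"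
  obtains d where "0 < d" "\<And>s s'. dist s s0 < d \<Longrightarrow> dist s' s0 < d \<Longrightarrow> norm s < S \<Longrightarrow> norm s' < S \<Longrightarrow>
    fibre_ok R s \<Longrightarrow> fibre_ok R s'"
proof -
  define eta where "eta i = al i * s0 + be i" for i
  have K: "0 < K" using B_le_K B_pos by linarith
  have "finite ((\<lambda>i. B - norm (be i)) ` I)" "\<And>x. x \<in> (\<lambda>i. B - norm (be i)) ` I \<Longrightarrow> 0 < x"
    using finite_I be_less_B by auto
  then obtain r1 where r1': "0 < r1" "\<And>x. x \<in> (\<lambda>i. B - norm (be i)) ` I \<Longrightarrow> r1 \<le> x"
    using finite_positive_lower_bound by blast
  then have r1: "0 < r1" "\<And>i. i \<in> I \<Longrightarrow> r1 \<le> B - norm (be i)" by blast+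
  obtain r2 where r2: "0 < r2" "\<And>i j. i \<in> I \<Longrightarrow> j \<in> I \<Longrightarrow> i \<noteq> j \<Longrightarrow> r2 \<le> norm (eta i - eta j)"
  proof -
    let ?A = "(\<lambda>(i, j). norm (eta i - eta j)) ` {x \<in> I \<times> I. fst x \<noteq> snd x}"
    have fin: "finite ?A" using finite_I by simp
    have pos: "0 < x" if "x \<in> ?A" for x using that inj by (auto simp: eta_def)
    obtain r where r: "0 < r" "\<And>x. x \<in> ?A \<Longrightarrow> r \<le> x"
      using finite_positive_lower_bound[of ?A, OF fin pos] by blast
    have "r \<le> norm (eta i - eta j)" if "i \<in> I" "j \<in> I" "i \<noteq> j" for i j
      by (rule r(2)) (use that in \<open>auto intro!: image_eqI[where x = "(i, j)"]\<close>)
    then show ?thesis using that r(1) by blast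
  qed
  \<comment> \<open>\<open>2 * eps \<le> r1\<close> keeps the discs inside radius \<open>R\<close>,
    so that the drag vanishes beyond it; \<open>4 * eps \<le> r2\<close> makes the open discs of
    radius \<open>2 * eps\<close> disjoint.\<close>
  define eps where "eps = min (r1 / 2) (r2 / 4)"
  have eps: "0 < eps" "2 * eps \<le> r1" "4 * eps \<le> r2" using r1 r2 by (auto simp: eps_def)
  define bump where "bump i y = max 0 (min 1 (2 - norm (y - eta i) / eps))" for i y
  have bump01: "0 \<le> bump i y" "bump i y \<le> 1" for i y by (auto simp: bump_def)
  have bump1: "bump i y = 1" if "norm (y - eta i) \<le> eps" for i y
  proof -
    have "norm (y - eta i) / eps \<le> 1" using that eps(1) by simp
    then show ?thesis by (simp add: bump_def)
  qed
  have bump0: "bump i y = 0" if "2 * eps \<le> norm (y - eta i)" for i y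
  proof -
    have "2 \<le> norm (y - eta i) / eps" using that eps(1) by (simp add: field_simps)
    then show ?thesis by (simp add: bump_def)
  qed
  \<comment> \<open>Outside the \<open>eps\<close>-disc the move changes \<open>q i\<close> by at
    most \<open>4 * K * d\<close>, while \<open>norm (q i)\<close> exceeds
    \<open>eps - K * d\<close>; \<open>10 * K * d = eps\<close> suffices for all paths at
    once.\<close>
  define d where "d = eps / (10 * K)"
  have d: "0 < d" "10 * K * d = eps" using eps K by (auto simp: d_def)
  have "fibre_ok R s'" if s: "dist s s0 < d" "dist s' s0 < d" "norm s < S" "norm s' < S" "fibre_ok R s" for s s'
    unfolding fibre_ok_def
  proof (intro allI impI)
    fix p assume p: "path p" "path_image p \<subseteq> F \<inter> {v. fst v = s'}"
      "R < norm (fst (snd (pathstart p)))" "R < norm (fst (snd (pathfinish p)))"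
    define h where "h y = (\<Sum>j\<in>I. of_real (bump j y) * al j)" for y
    have pF: "p t \<in> F" "fst (p t) = s'" if "t \<in> {0..1}" for t using p that unfolding path_image_def by blast+
    show "P p = far_primitive (pathfinish p) - far_primitive (pathstart p)"
    proof (rule transport[OF p R s(3,4,5), where g = "\<lambda>y. h y * (s - s')"])
      show "continuous_on UNIV (\<lambda>y. h y * (s - s'))"
        unfolding h_def bump_def using eps(1) by (intro continuous_intros) auto
    next
      fix y :: complex assume y: "R < norm y"
      have "bump i y = 0" if i: "i \<in> I" for i
      proof (rule bump0)
        have "norm (al i) * norm s0 \<le> K * S"
          using al_le_K[OF i] B_pos s0 K by (intro mult_mono) auto
        then have "norm (eta i) \<le> K * S + (B - r1)"
          using norm_triangle_ineq[of "al i * s0" "be i"] r1(2)[OF i] by (simp add: eta_def norm_mult)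
        moreover have "K * S + B < norm y" using y R B_le_K by (simp add: algebra_simps)
        ultimately show "2 * eps \<le> norm (y - eta i)"
          using norm_triangle_ineq2[of y "eta i"] eps(2) by linarith
      qed
      then show "h y * (s - s') = 0" by (simp add: h_def)
    next
      fix t :: real and i assume ti: "t \<in> {0..1}" "i \<in> I"
      let ?y = "fst (snd (p t))"
      have q: "q i (base (p t)) = (?y - eta i) - al i * (s' - s0)"
        using pF(2)[OF ti(1)] by (simp add: q_def base_def eta_def algebra_simps)
      show "norm (h ?y * (s - s') - al i * (s - s')) < norm (q i (base (p t)))"
      proof (cases "norm (?y - eta i) \<le> eps")
        case True
        have "bump j ?y = 0" if "j \<in> I" "j \<noteq> i" for j
        proof (rule bump0)
          have "r2 \<le> norm (eta i - eta j)" using r2(2)[OF ti(2) that(1)] that(2) by blast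
          then show "2 * eps \<le> norm (?y - eta j)"
            using True eps norm_triangle_ineq4[of "?y - eta j" "?y - eta i"] by (simp add: algebra_simps)
        qed
        then have "h ?y = (\<Sum>j\<in>I. if j = i then al i else 0)"
          unfolding h_def using bump1[OF True] by (intro sum.cong) auto
        \<comment> \<open>Inside the inner disc the point is dragged exactly as the puncture, so
          \<open>q i\<close> does not change.\<close>
        then have "h ?y = al i" using finite_I ti(2) by simp
        then show ?thesis using F_nonzero(1)[OF pF(1)[OF ti(1)] ti(2)] by simp
      next
        case False
        have "norm (h ?y) \<le> (\<Sum>j\<in>I. norm (al j))"
          unfolding h_def using bump01 by (intro sum_norm_le) (simp add: norm_mult mult_left_le_one_le)
        then have "norm (h ?y) \<le> K" using B_pos by (simp add: K_def)
        moreover have ali: "norm (al i) \<le> K" using al_le_K[OF ti(2)] B_pos by simp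
        ultimately have "norm (h ?y - al i) \<le> 2 * K" using norm_triangle_ineq4[of "h ?y" "al i"] by linarith
        moreover have "norm (s - s') \<le> 2 * d"
          using s(1,2) dist_triangle2[of s s' s0] by (simp add: dist_norm)
        ultimately have "norm ((h ?y - al i) * (s - s')) \<le> (2 * K) * (2 * d)"
          unfolding norm_mult using K by (intro mult_mono) auto
        moreover have "norm (al i * (s' - s0)) \<le> K * d"
          unfolding norm_mult using s(2) ali K by (intro mult_mono) (auto simp: dist_norm)
        moreover have "norm (?y - eta i) - norm (al i * (s' - s0)) \<le> norm (q i (base (p t)))"
          unfolding q by (rule norm_triangle_ineq2)
        moreover have "K * d > 0" using K d(1) by simp
        ultimately have "norm ((h ?y - al i) * (s - s')) < norm (q i (base (p t)))"
          using False d(2) by linarith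
        then show ?thesis by (simp add: algebra_simps)
      qed
    qed
  qed
  then show ?thesis using that d(1) by blast
qed

lemma finite_collisions: "finite {s. \<exists>i\<in>I. \<exists>j\<in>I. i \<noteq> j \<and> al i * s + be i = al j * s + be j}"
proof -
  have "{s. \<exists>i\<in>I. \<exists>j\<in>I. i \<noteq> j \<and> al i * s + be i = al j * s + be j} \<subseteq> (\<lambda>(i, j). (be j - be i) / (al i - al j)) ` (I \<times> I)"
  proof
    fix s assume "s \<in> {s. \<exists>i\<in>I. \<exists>j\<in>I. i \<noteq> j \<and> al i * s + be i = al j * s + be j}"
    then obtain i j where ij: "i \<in> I" "j \<in> I" "i \<noteq> j" and eq: "al i * s + be i = al j * s + be j" by blast
    have "al i \<noteq> al j" using be_distinct[OF ij] eq by auto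
    then have "s = (be j - be i) / (al i - al j)" using eq by (simp add: field_simps)
    then show "s \<in> (\<lambda>(i, j). (be j - be i) / (al i - al j)) ` (I \<times> I)" using ij by force
  qed
  then show ?thesis by (rule finite_subset) (use finite_I in simp)
qed

text \<open>A disc minus the finitely many collision parameters is connected, and the property is
  locally constant there. Collision fibres follow as limits. Since \<open>S\<close> and
  \<open>R\<close> stay fixed, the criterion is the same for all fibres.\<close>

lemma fibre_ok_sweep:
  assumes R: "K * (1 + S) \<le> R"
    and s_gen: "norm s_gen < S" "fibre_ok R s_gen" "\<And>i j. i \<in> I \<Longrightarrow> j \<in> I \<Longrightarrow> i \<noteq> j \<Longrightarrow> al i * s_gen + be i \<noteq> al j * s_gen + be j"
    and s: "norm s < S"
  shows "fibre_ok R s"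
proof -
  define bad where "bad = {s. \<exists>i\<in>I. \<exists>j\<in>I. i \<noteq> j \<and> al i * s + be i = al j * s + be j}"
  have fin: "finite bad" unfolding bad_def by (rule finite_collisions)
  define A where "A = ball 0 S - bad"
  have "connected A" unfolding A_def
    using fin by (intro connected_open_diff_countable) (auto simp: countable_finite)
  have ok: "fibre_ok R z" if "z \<in> A" for z
  proof (rule connected_induction_simple[where P = "fibre_ok R", OF \<open>connected A\<close> _ that s_gen(2)])
    show "s_gen \<in> A" using s_gen(1,3) by (auto simp: A_def bad_def)
    fix a assume a: "a \<in> A"
    then have a': "norm a < S" "\<And>i j. i \<in> I \<Longrightarrow> j \<in> I \<Longrightarrow> i \<noteq> j \<Longrightarrow> al i * a + be i \<noteq> al j * a + be j"
      by (auto simp: A_def bad_def)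
    obtain d where d: "0 < d" "\<And>s s'. dist s a < d \<Longrightarrow> dist s' a < d \<Longrightarrow> norm s < S \<Longrightarrow> norm s' < S \<Longrightarrow>
        fibre_ok R s \<Longrightarrow> fibre_ok R s'" using fibre_ok_nearby[OF R a'] by blast
    have "openin (top_of_set A) (A \<inter> ball a d)" by (simp add: openin_open_Int)
    then show "\<exists>T. openin (top_of_set A) T \<and> a \<in> T \<and> (\<forall>x\<in>T. \<forall>y\<in>T. fibre_ok R x \<longrightarrow> fibre_ok R y)"
      using d a by (intro exI[of _ "A \<inter> ball a d"]) (auto simp: A_def dist_commute)
  qed
  show ?thesis
  proof (rule fibre_ok_limit[OF R s])
    fix d :: real assume "0 < d"
    have "open (ball s d \<inter> ball 0 S)" "s \<in> ball s d \<inter> ball 0 S" using s \<open>0 < d\<close> by auto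
    then have "infinite (ball s d \<inter> ball 0 S)" using finite_imp_not_open by blast
    then obtain z where "z \<in> ball s d \<inter> ball 0 S" "z \<notin> bad" using fin by (meson finite_subset subsetI)
    then show "\<exists>z. dist z s < d \<and> norm z < S \<and> fibre_ok R z" using ok[of z] by (auto simp: A_def dist_commute)
  qed
qed

lemma ex_ray_free:
  assumes "v \<in> F" obtains w where "norm w = 1" "v \<in> ray_free w"
proof -
  have "finite ((\<lambda>i. q i (base v)) ` I)" "0 \<notin> (\<lambda>i. q i (base v)) ` I"
    using finite_I F_nonzero(1)[OF assms] by auto
  then obtain u where u: "norm u = 1" "\<And>d. d \<in> (\<lambda>i. q i (base v)) ` I \<Longrightarrow> Re (d * u) \<noteq> 0"
    using generic_direction by blast
  have u0: "u \<noteq> 0" using u(1) by auto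
  \<comment> \<open>For this direction the quotient is \<open>\<i>\<close> times a number with
    nonzero real part, hence not real.\<close>
  have "q i (base v) / (1 / (\<i> * u)) \<notin> \<real>\<^sub>\<le>\<^sub>0" if "i \<in> I" for i
  proof -
    have "q i (base v) / (1 / (\<i> * u)) = \<i> * (q i (base v) * u)" using u0 by simp
    then show ?thesis using u(2)[of "q i (base v)"] that by (auto simp: complex_nonpos_Reals_iff)
  qed
  then show ?thesis using that[of "1 / (\<i> * u)"] u(1) by (simp add: ray_free_def norm_mult norm_divide)
qed

text \<open>Two free rays from \<open>v\<close>, one of them reversed, form a path in the fibre of
  \<open>v\<close> with both ends beyond the radius of \<open>fibre_ok\<close>; so all directions
  give the same value at \<open>v\<close>. Every point has a free direction, which stays free
  nearby.\<close>

lemma primitive_on_F: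
  assumes s: "0 \<le> s" and ok: "\<And>z. fibre_ok (K * (2 + norm z + s)) z"
  shows "\<exists>\<psi>. primitive_on P F \<psi>"
proof -
  have eq: "ray_primitive s w v = ray_primitive s w' v" if v: "v \<in> F" "v \<in> ray_free w" "v \<in> ray_free w'" and w: "norm w = 1" "norm w' = 1" for v w w'
  proof -
    have w0: "w \<noteq> 0" "w' \<noteq> 0" using w by auto
    note pr = path_ray[OF v(1,2) w0(1) s] path_ray[OF v(1,3) w0(2) s]
    let ?p = "reversepath (ray s w v) +++ ray s w' v"
    have c: "pathfinish (reversepath (ray s w v)) = pathstart (ray s w' v)"
      using ray_0[OF v(1)] by (simp add: pathstart_def)
    have "path_image (ray s u v) \<subseteq> {x. fst x = fst v}" for u
      unfolding path_image_def image_subset_iff by simp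
    then have "path_image ?p \<subseteq> F \<inter> {x. fst x = fst v}"
      using pr(2,4) c by (simp add: path_image_join)
    moreover have "path ?p" using pr c by simp
    ultimately have "P ?p = far_primitive (pathfinish ?p) - far_primitive (pathstart ?p)"
      using ok[of "fst v"] ray_end_norm[OF w(1) s, of v] ray_end_norm[OF w(2) s, of v]
      unfolding fibre_ok_def by (simp add: pathfinish_def reversepath_def pathstart_def joinpaths_def)
    then have "P ?p = far_primitive (ray s w' v 1) - far_primitive (ray s w v 1)"
      by (simp only: pathstart_join pathfinish_join pathstart_reversepath) (simp add: pathfinish_def)
    moreover have "P ?p = - P (ray s w v) + P (ray s w' v)"
      using join[of "reversepath (ray s w v)" "ray s w' v"] reverse[of "ray s w v"] pr c by simp
    ultimately have "far_primitive (ray s w' v 1) - far_primitive (ray s w v 1) = - P (ray s w v) + P (ray s w' v)" by (simp only:)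
    then show ?thesis by (simp add: ray_primitive_def algebra_simps)
  qed
  define W where "W v = (SOME w. norm w = 1 \<and> v \<in> ray_free w)" for v
  have W: "norm (W v) = 1" "v \<in> ray_free (W v)" if "v \<in> F" for v
    using someI_ex[of "\<lambda>w. norm w = 1 \<and> v \<in> ray_free w"] ex_ray_free[OF that] unfolding W_def by metis+
  have "primitive_on P F (\<lambda>v. ray_primitive s (W v) v)"
    unfolding primitive_on_def
  proof (intro allI impI)
    fix p assume p: "path p" "path_image p \<subseteq> F"
    show "P p = ray_primitive s (W (pathfinish p)) (pathfinish p) - ray_primitive s (W (pathstart p)) (pathstart p)"
    proof (rule local_primitive[OF order_refl p])
      fix v assume "v \<in> path_image p"
      then have v: "v \<in> F" using p by auto
      have "primitive_on P (ray_free (W v) \<inter> F) (\<lambda>x. ray_primitive s (W x) x)"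
        by (rule primitive_on_cong[OF primitive_on_ray_free[OF W(1)[OF v] s]]) (use eq W W(1)[OF v] in auto)
      then show "\<exists>N. open N \<and> v \<in> N \<and> primitive_on P (N \<inter> F) (\<lambda>v. ray_primitive s (W v) v)"
        using open_ray_free W(2)[OF v] by blast
    qed
  qed
  then show ?thesis by blast
qed

end

lemma (in generic_functional) ex_primitive_on_F: "\<exists>\<psi>. primitive_on P F \<psi>"
proof (rule primitive_on_F[OF norm_ge_zero[of s1]])
  fix z
  have K: "0 < K" using B_le_K B_pos by linarith
  show "fibre_ok (K * (2 + norm z + norm s1)) z"
  \<comment> \<open>This \<open>S\<close> exceeds \<open>norm z\<close> and \<open>norm s1\<close>,
    and \<open>K * (1 + S)\<close> is the radius that the rays over \<open>z\<close> exceed.\<close>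
  proof (rule fibre_ok_sweep[where S = "1 + norm z + norm s1" and s_gen = s1])
    have "K * (1 + norm s1) \<le> K * (2 + norm z + norm s1)" using K by (intro mult_left_mono) auto
    then show "fibre_ok (K * (2 + norm z + norm s1)) s1"
      unfolding fibre_ok_def using fibre_primitive by blast
    show "al i * s1 + be i \<noteq> al j * s1 + be j" if "i \<in> I" "j \<in> I" "i \<noteq> j" for i j
      using Re_q_distinct[OF that] by metis
  qed (auto simp: algebra_simps add_pos_nonneg)
qed

section \<open>Counting\<close>

text \<open>Gaussian elimination: equation \<open>j\<close> with a nonzero coefficient at
  \<open>k\<close> removes the unknown \<open>k\<close> from the others, and its value is recovered
  from equation \<open>j\<close>.\<close>

lemma homogeneous_system_nontrivial:
  fixes M :: "'j \<Rightarrow> 'i \<Rightarrow> 'a::field"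
  assumes "finite J" "finite S" "card J < card S"
  shows "\<exists>a. (\<exists>i\<in>S. a i \<noteq> 0) \<and> (\<forall>j\<in>J. (\<Sum>i\<in>S. a i * M j i) = 0)"
  using assms
proof (induction J arbitrary: S M rule: finite_induct)
  case empty
  then have "S \<noteq> {}" by auto
  then show ?case by (intro exI[of _ "\<lambda>_. 1"]) auto
next
  case (insert j J)
  show ?case
  proof (cases "\<forall>i\<in>S. M j i = 0")
    case True
    then show ?thesis using insert.IH[OF insert.prems(1), of M] insert by auto
  next
    case False
    then obtain k where k: "k \<in> S" "M j k \<noteq> 0" by blast
    have "card J < card (S - {k})" using insert k by simp
    then obtain a where a: "\<exists>i\<in>S - {k}. a i \<noteq> 0"
      "\<And>l. l \<in> J \<Longrightarrow> (\<Sum>i\<in>S - {k}. a i * (M l i - M l k * M j i / M j k)) = 0"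
      using insert.IH[of "S - {k}" "\<lambda>l i. M l i - M l k * M j i / M j k"] insert.prems by auto
    define s where "s = (\<Sum>i\<in>S - {k}. a i * M j i)"
    define b where "b = a(k := - s / M j k)"
    have sum_b: "(\<Sum>i\<in>S. b i * M l i) = (\<Sum>i\<in>S - {k}. a i * M l i) - s / M j k * M l k" for l
    proof -
      have "(\<Sum>i\<in>S. b i * M l i) = b k * M l k + (\<Sum>i\<in>S - {k}. b i * M l i)"
        using k insert.prems(1) by (simp add: sum.remove)
      also have "(\<Sum>i\<in>S - {k}. b i * M l i) = (\<Sum>i\<in>S - {k}. a i * M l i)"
        by (intro sum.cong) (auto simp: b_def)
      finally show ?thesis by (simp add: b_def)
    qed
    have "(\<Sum>i\<in>S. b i * M l i) = 0" if "l \<in> J" for l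
    proof -
      have "(\<Sum>i\<in>S - {k}. a i * (M l i - M l k * M j i / M j k)) = (\<Sum>i\<in>S - {k}. a i * M l i) - M l k / M j k * s"
        by (simp add: s_def algebra_simps sum_subtractf sum_distrib_left sum_divide_distrib)
      then show ?thesis using a(2)[OF that] by (simp add: sum_b)
    qed
    moreover have "(\<Sum>i\<in>S. b i * M j i) = 0" using k by (simp add: sum_b s_def[symmetric])
    moreover have "\<exists>i\<in>S. b i \<noteq> 0" using a(1) by (auto simp: b_def)
    ultimately show ?thesis by auto
  qed
qed

lemma path_functional_sum:
  fixes P :: "'i \<Rightarrow> (real \<Rightarrow> 'a::real_normed_vector) \<Rightarrow> complex"
  assumes "\<And>i. i \<in> S \<Longrightarrow> path_functional X (P i)"
  shows "path_functional X (\<lambda>p. \<Sum>i\<in>S. c i * P i p)"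
proof
  fix p q :: "real \<Rightarrow> 'a" assume "\<And>t. t \<in> {0..1} \<Longrightarrow> p t = q t"
  then show "(\<Sum>i\<in>S. c i * P i p) = (\<Sum>i\<in>S. c i * P i q)"
    using path_functional.cong[OF assms, of _ p q] by (intro sum.cong) auto
next
  fix p :: "real \<Rightarrow> 'a" and u v w :: real
  assume "path p" "path_image p \<subseteq> X" "u \<in> {0..1}" "v \<in> {0..1}" "w \<in> {0..1}"
  then show "(\<Sum>i\<in>S. c i * P i (subpath u v p)) + (\<Sum>i\<in>S. c i * P i (subpath v w p)) = (\<Sum>i\<in>S. c i * P i (subpath u w p))"
    unfolding sum.distrib[symmetric] distrib_left[symmetric]
    by (intro sum.cong refl) (simp add: path_functional.subpath_add[OF assms])
next
  fix G :: "real \<times> real \<Rightarrow> 'a"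
  assume "continuous_on ({0..1} \<times> {0..1}) G" "G ` ({0..1} \<times> {0..1}) \<subseteq> X"
  then show "(\<Sum>i\<in>S. c i * P i (\<lambda>t. G (t, 0))) + (\<Sum>i\<in>S. c i * P i (\<lambda>t. G (1, t))) =
     (\<Sum>i\<in>S. c i * P i (\<lambda>t. G (0, t))) + (\<Sum>i\<in>S. c i * P i (\<lambda>t. G (t, 1)))"
    unfolding sum.distrib[symmetric] distrib_left[symmetric]
    by (intro sum.cong refl) (simp add: path_functional.square[OF assms])
qed

context lines
begin

lemma eigen_functional_sum:
  assumes "\<And>i. i \<in> S \<Longrightarrow> eigen_functional I al be C B (Pf i) e" "e \<noteq> 1"
  shows "eigen_functional I al be C B (\<lambda>p. \<Sum>i\<in>S. c i * Pf i p) e"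
proof -
  interpret s: path_functional F "\<lambda>p. \<Sum>i\<in>S. c i * Pf i p"
    using assms by (intro path_functional_sum) (auto simp: eigen_functional_def)
  show ?thesis
  proof
    fix p assume p: "path p" "path_image p \<subseteq> F"
    have "Pf i (deck 1 \<circ> p) = e * Pf i p" if "i \<in> S" for i
      using eigen_functional.deck_1[OF assms(1)[OF that] p] .
    then show "(\<Sum>i\<in>S. c i * Pf i (deck 1 \<circ> p)) = e * (\<Sum>i\<in>S. c i * Pf i p)"
      by (simp add: sum_distrib_left mult_ac cong: sum.cong)
  qed (use assms in auto)
qed

lemma ex_point_over:
  assumes "\<And>i. i \<in> I \<Longrightarrow> q i b \<noteq> 0"
  obtains v where "v \<in> F" "base v = b"
proof -
  let ?c = "C * (\<Prod>i\<in>I. q i b)"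
  have c: "?c \<noteq> 0" using C_nonzero assms finite_I by simp
  define v where "v = (fst b, snd b, exp (- Ln ?c / of_nat m))"
  have "exp (- Ln ?c / of_nat m) ^ m = exp (- Ln ?c)" using m_pos by (simp flip: exp_of_nat_mult)
  also have "\<dots> = 1 / ?c" using c by (simp add: exp_minus inverse_eq_divide)
  finally have "C * snd (snd v) ^ m * (\<Prod>i\<in>I. q i b) = 1" using c by (simp add: v_def)
  moreover have "base v = b" by (simp add: v_def base_def)
  ultimately show ?thesis using that[of v] by (simp add: F_def)
qed

lemma ex_generic_line:
  obtains s1 ep pt where "generic_line I al be C B s1 ep pt"
proof -
  let ?D = "(\<lambda>(i, j). al i - al j) ` {x \<in> I \<times> I. al (fst x) \<noteq> al (snd x)}"
  have D: "finite ?D" "0 \<notin> ?D" using finite_I by auto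
  obtain w where w: "norm w = 1" "\<And>d. d \<in> ?D \<Longrightarrow> Re (d * w) \<noteq> 0" 
    using generic_direction[OF D] by blast
  have fin: "finite ((\<lambda>d. \<bar>Re (d * w)\<bar>) ` ?D)" using D(1) by (rule finite_imageI)
  have pos: "0 < x" if x: "x \<in> (\<lambda>d. \<bar>Re (d * w)\<bar>) ` ?D" for x
  proof -
    obtain d where "d \<in> ?D" "x = \<bar>Re (d * w)\<bar>" using x by blast
    then show ?thesis using w(2)[of d] by (simp only: zero_less_abs_iff) simp
  qed
  obtain d0 where d0: "0 < d0" "\<And>x. x \<in> (\<lambda>d. \<bar>Re (d * w)\<bar>) ` ?D \<Longrightarrow> d0 \<le> x"
    using finite_positive_lower_bound[OF fin pos] by blast
  \<comment> \<open>\<open>d0\<close> bounds the separation of the clusters per unit length from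
    below, so that \<open>r * d0 = 8 * B + 1\<close>.\<close>
  define r where "r = (8 * B + 1) / d0"
  have r: "0 < r" "8 * B < r * d0" using d0(1) B_pos by (simp_all add: r_def)
  define s1 where "s1 = of_real r * w"
  have sep: "8 * B < \<bar>Re ((al i - al j) * s1)\<bar>" if "i \<in> I" "j \<in> I" "al i \<noteq> al j" for i j
  proof -
    have "al i - al j \<in> ?D" using that by (auto intro!: image_eqI[where x = "(i, j)"])
    then have "d0 \<le> \<bar>Re ((al i - al j) * w)\<bar>" using d0(2) by blast
    then have "r * d0 \<le> r * \<bar>Re ((al i - al j) * w)\<bar>" using r(1) by (intro mult_left_mono) auto
    moreover have "Re ((al i - al j) * s1) = r * Re ((al i - al j) * w)" by (simp add: s1_def algebra_simps)
    then have "\<bar>Re ((al i - al j) * s1)\<bar> = r * \<bar>Re ((al i - al j) * w)\<bar>" using r(1) by (simp only: abs_mult)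
    ultimately show ?thesis using r(2) by linarith
  qed
  let ?E = "(\<lambda>(i, j). \<bar>Re (be i) - Re (be j)\<bar>) ` {x \<in> I \<times> I. fst x \<noteq> snd x \<and> al (fst x) = al (snd x)}"
  have E: "finite ?E" using finite_I by simp
  have E': "0 < x" if "x \<in> ?E" for x using that be_distinct by force
  obtain e0 where e0: "0 < e0" "\<And>x. x \<in> ?E \<Longrightarrow> e0 \<le> x" using finite_positive_lower_bound[OF E E'] by blast
  define ep where "ep = min B (e0 / 2)"
  have ep: "0 < ep" "ep \<le> B" "ep < e0" using e0(1) B_pos by (auto simp: ep_def)
  have ep_less: "ep < \<bar>Re (be i) - Re (be j)\<bar>" if "i \<in> I" "j \<in> I" "i \<noteq> j" "al i = al j" for i j
  proof -
    have "\<bar>Re (be i) - Re (be j)\<bar> \<in> ?E" using that by (auto intro!: image_eqI[where x = "(i, j)"])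
    then show ?thesis using e0(2) ep(3) by force
  qed
  have "\<exists>v. v \<in> F \<and> base v = (s1, al i * s1 + be i + of_real ep)" if i: "i \<in> I" for i
  proof -
    have "q j (s1, al i * s1 + be i + of_real ep) \<noteq> 0" if j: "j \<in> I" for j
    proof
      assume "q j (s1, al i * s1 + be i + of_real ep) = 0"
      then have "Re ((al i - al j) * s1 + be i - be j + of_real ep) = 0" by (simp add: q_def algebra_simps)
      then have eq: "Re ((al i - al j) * s1) + Re (be i) - Re (be j) + ep = 0" by simp
      show False
      proof (cases "al i = al j")
        case True
        then show False using eq ep(1) ep_less[OF i j] by (cases "i = j") auto
      next
        case False
        have "\<bar>Re (be i)\<bar> < B" "\<bar>Re (be j)\<bar> < B"
          using be_less_B[OF i] be_less_B[OF j] abs_Re_le_cmod[of "be i"] abs_Re_le_cmod[of "be j"] by linarith+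
        then show False using eq sep[OF i j False] ep by linarith
      qed
    qed
    then show ?thesis using ex_point_over by metis
  qed
  then obtain pt where "\<And>i. i \<in> I \<Longrightarrow> pt i \<in> F \<and> base (pt i) = (s1, al i * s1 + be i + of_real ep)" by metis
  then have "generic_line I al be C B s1 ep pt"
    using sep ep(1,2) ep_less by unfold_locales auto
  then show ?thesis using that by blast
qed

text \<open>The defects at the test points are linear in the functional and thus impose
  \<open>card (gaps e)\<close> linear equations on \<open>n\<close> coefficients.\<close>

lemma eigen_functionals_dependent:
  assumes Pf: "\<And>i. i < n \<Longrightarrow> eigen_functional I al be C B (Pf i) e" and e: "e \<noteq> 1" and n: "card (gaps e) < n"
  obtains a i0 \<psi> where "i0 < n" "a i0 \<noteq> 0" "primitive_on (\<lambda>p. \<Sum>i<n. a i * Pf i p) F \<psi>"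
proof -
  obtain s1 ep pt where "generic_line I al be C B s1 ep pt" by (rule ex_generic_line)
  then interpret g: generic_line I al be C B s1 ep pt .
  \<comment> \<open>\<open>kappa\<close> belongs to one fixed functional; with \<open>P\<close> as
    an argument its linearity becomes available.\<close>
  define kap where "kap P v = (let far_primitive = (\<lambda>v. P (rot snd I v) / (e - 1));
      ray_primitive = (\<lambda>w v. far_primitive (ray (norm s1) w v 1) - P (ray (norm s1) w v)) in ray_primitive \<i> v - ray_primitive (- \<i>) v)" for P v
  have kap: "eigen_functional.kappa I al be B P e (norm s1) v = kap P v"
    if "eigen_functional I al be C B P e" for P v
  proof -
    interpret eigen_functional I al be C B P e by fact
    show ?thesis by (simp add: kap_def kappa_def ray_primitive_def far_primitive_def Let_def)
  qed
  have "finite (gaps e)" using finite_I by (simp add: gaps_def)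
  then obtain a where a: "\<exists>i\<in>{..<n}. a i \<noteq> 0" "\<And>j. j \<in> gaps e \<Longrightarrow> (\<Sum>i<n. a i * kap (Pf i) (pt j)) = 0"
    using homogeneous_system_nontrivial[of "gaps e" "{..<n}" "\<lambda>j i. kap (Pf i) (pt j)"] n by auto
  let ?P = "\<lambda>p. \<Sum>i<n. a i * Pf i p"
  have P: "eigen_functional I al be C B ?P e" using Pf e by (intro eigen_functional_sum) auto
  then interpret p: eigen_functional I al be C B ?P e .
  interpret generic_functional I al be C B s1 ep pt ?P e
  proof
    fix j assume "j \<in> gaps e"
    moreover have "kap ?P (pt j) = (\<Sum>i<n. a i * kap (Pf i) (pt j))"
      by (simp add: kap_def Let_def right_diff_distrib sum_subtractf flip: sum_divide_distrib)
    ultimately show "p.kappa (norm s1) (pt j) = 0" using a(2) kap[OF P] by simp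
  qed
  show ?thesis using that a(1) ex_primitive_on_F by blast
qed

end

section \<open>Adapted coordinates\<close>

lemma lf_add: "lf a (u + v) = lf a u + lf a v"
  by (simp add: lf_def sum.distrib distrib_left)

lemma lf_scale: "lf a (c *s v) = c * lf a v"
  by (simp add: lf_def sum_distrib_left mult_ac)

lemma lf_axis: "lf a (axis j 1) = a $ j"
  by (simp add: lf_def axis_def if_distrib cong: if_cong)

lemma lf_eq_imp_scaled:
  assumes "\<And>v. lf a v = c * lf b v" shows "a = c *s b"
  using assms[of "axis _ 1"] by (simp add: lf_axis vec_eq_iff)

lemma continuous_on_lf [continuous_intros]: "continuous_on S f \<Longrightarrow> continuous_on S (\<lambda>x. lf a (f x))"
  unfolding lf_def by (intro continuous_intros)

text \<open>\<open>e1\<close> and \<open>e2\<close> span the plane of \<open>H\<close>, and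
  \<open>e3\<close> normalises \<open>lf H\<close>. The point \<open>e2\<close> of \<open>H\<close>
  is chosen off all other lines, so that none of them is parallel to the y-axis; the scale of
  \<open>e2\<close> then turns the intercepts until parallel lines differ in real part.\<close>

lemma adapted_coordinates:
  assumes A: "line_arrangement A" "H \<in> A"
  obtains e1 e2 e3 :: "complex^3" and f1 f2 :: "complex^3 \<Rightarrow> complex"
  where "continuous_on UNIV f1" "continuous_on UNIV f2"
    "\<And>v. v = f1 v *s e1 + f2 v *s e2 + lf H v *s e3"
    "\<And>x y z. f1 (x *s e1 + y *s e2 + z *s e3) = x" "\<And>x y z. f2 (x *s e1 + y *s e2 + z *s e3) = y"
    "lf H e1 = 0" "lf H e2 = 0" "lf H e3 = 1"
    "\<And>a. a \<in> A - {H} \<Longrightarrow> lf a e2 \<noteq> 0"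
    "\<And>a b. a \<in> A - {H} \<Longrightarrow> b \<in> A - {H} \<Longrightarrow> a \<noteq> b \<Longrightarrow> lf a e1 / lf a e2 = lf b e1 / lf b e2 \<Longrightarrow>
       Re (lf a e3 / lf a e2) \<noteq> Re (lf b e3 / lf b e2)"
proof -
  have fin: "finite A" and H0: "H \<noteq> 0"
    and np: "\<And>a b c. a \<in> A \<Longrightarrow> b \<in> A \<Longrightarrow> a \<noteq> b \<Longrightarrow> a \<noteq> c *s b"
    using A by (auto simp: line_arrangement_def)
  obtain j k l :: 3 where jkl: "H $ j \<noteq> 0" "j \<noteq> k" "k \<noteq> l" "j \<noteq> l" and U: "UNIV = {j, k, l}"
  proof -
    obtain j where j: "H $ j \<noteq> 0" using H0 by (metis vec_eq_iff zero_index)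
    consider "j = 1" | "j = 2" | "j = 3" using exhaust_3 by blast
    then show ?thesis
    proof cases
      case 1 then show ?thesis using that[of 1 2 3] j UNIV_3 by auto
    next
      case 2 then show ?thesis using that[of 2 1 3] j UNIV_3 by auto
    next
      case 3 then show ?thesis using that[of 3 1 2] j UNIV_3 by auto
    qed
  qed
  have all: "(\<forall>i. Q i) \<longleftrightarrow> Q j \<and> Q k \<and> Q l" for Q :: "3 \<Rightarrow> bool" using U by (metis UNIV_I insert_iff singletonD)
  have lf3: "lf a v = a $ j * v $ j + a $ k * v $ k + a $ l * v $ l" for a v
    unfolding lf_def U using jkl by simp
  define d1 :: "complex^3" where "d1 = axis k 1 - (H $ k / H $ j) *s axis j 1"
  define d2 :: "complex^3" where "d2 = axis l 1 - (H $ l / H $ j) *s axis j 1"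
  define e3 :: "complex^3" where "e3 = (1 / H $ j) *s axis j 1"
  have comp: "d1 $ j = - H $ k / H $ j" "d1 $ k = 1" "d1 $ l = 0" "d2 $ j = - H $ l / H $ j" "d2 $ k = 0" "d2 $ l = 1"
    "e3 $ j = 1 / H $ j" "e3 $ k = 0" "e3 $ l = 0"
    using jkl by (auto simp: d1_def d2_def e3_def axis_def)
  have dec: "v = v $ k *s d1 + v $ l *s d2 + lf H v *s e3" for v
    unfolding vec_eq_iff all using jkl by (simp add: comp lf3 field_simps)
  have Hd: "lf H d1 = 0" "lf H d2 = 0" "lf H e3 = 1" using jkl by (simp_all add: lf3 comp)
  have lfdec: "lf a v = v $ k * lf a d1 + v $ l * lf a d2 + lf H v * lf a e3" for a v
    by (subst dec[of v]) (simp only: lf_add lf_scale)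
  \<comment> \<open>A form that vanishes at \<open>d2 + t *s d1\<close> excludes one
    \<open>t\<close>, unless it vanishes at both \<open>d1\<close> and \<open>d2\<close>; then it
    would be proportional to \<open>H\<close>.\<close>
  obtain t where t: "t \<notin> (\<lambda>a. - lf a d2 / lf a d1) ` A"
    using ex_new_if_finite[OF infinite_UNIV_char_0, of "(\<lambda>a. - lf a d2 / lf a d1) ` A"] fin by auto
  define e2' where "e2' = d2 + t *s d1"
  have e2': "lf a e2' \<noteq> 0" if a: "a \<in> A - {H}" for a
  proof
    assume "lf a e2' = 0"
    then have 0: "lf a d2 = - t * lf a d1" by (simp add: e2'_def lf_add lf_scale eq_neg_iff_add_eq_0)
    have "lf a d1 \<noteq> 0"
    proof
      assume d1: "lf a d1 = 0"
      then have "lf a v = lf a e3 * lf H v" for v using lfdec[of a v] 0 by simp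
      then have "a = lf a e3 *s H" by (rule lf_eq_imp_scaled)
      then show False using np[of a H] a A(2) by blast
    qed
    then have "t = - lf a d2 / lf a d1" using 0 by simp
    then show False using t a by blast
  qed
  \<comment> \<open>Equal slopes and intercepts would make two forms proportional, so these
    differences are nonzero.\<close>
  let ?D = "(\<lambda>(a, b). lf a e3 / lf a e2' - lf b e3 / lf b e2') `
    {x \<in> (A - {H}) \<times> (A - {H}). fst x \<noteq> snd x \<and> lf (fst x) d1 / lf (fst x) e2' = lf (snd x) d1 / lf (snd x) e2'}"
  have "finite ?D" using fin by simp
  moreover have "0 \<notin> ?D"
  proof
    assume "0 \<in> ?D"
    then obtain x where x: "x \<in> (A - {H}) \<times> (A - {H})" "fst x \<noteq> snd x"
        "lf (fst x) d1 / lf (fst x) e2' = lf (snd x) d1 / lf (snd x) e2'"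
        "lf (fst x) e3 / lf (fst x) e2' = lf (snd x) e3 / lf (snd x) e2'"
      by (elim imageE) (simp add: case_prod_beta, blast)
    define a b where "a = fst x" and "b = snd x"
    have ab: "a \<in> A - {H}" "b \<in> A - {H}" "a \<noteq> b" "lf a d1 / lf a e2' = lf b d1 / lf b e2'"
      "lf a e3 / lf a e2' = lf b e3 / lf b e2'" using x by (auto simp: a_def b_def mem_Times_iff)
    define c where "c = lf a e2' / lf b e2'"
    have c: "lf a e2' = c * lf b e2'" "lf a d1 = c * lf b d1" "lf a e3 = c * lf b e3"
      using ab(4,5) e2'[OF ab(1)] e2'[OF ab(2)] by (simp_all add: c_def field_simps)
    have "lf a d2 = c * lf b d2"
      using c(1,2) by (simp add: e2'_def lf_add lf_scale algebra_simps)
    then have "lf a v = c * lf b v" for v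
      using c lfdec[of a v] lfdec[of b v] by (simp add: algebra_simps)
    then have "a = c *s b" by (rule lf_eq_imp_scaled)
    then show False using np[of a b] ab by blast
  qed
  ultimately obtain w where w: "norm w = 1" "\<And>d. d \<in> ?D \<Longrightarrow> Re (d * w) \<noteq> 0" using generic_direction by blast
  have w0: "w \<noteq> 0" using w(1) by auto
  \<comment> \<open>Dividing by \<open>w\<close> multiplies slopes and intercepts by
    \<open>w\<close>.\<close>
  define e2 where "e2 = (1 / w) *s e2'"
  define f1 where "f1 v = v $ k - t * v $ l" for v :: "complex^3"
  define f2 where "f2 v = w * v $ l" for v :: "complex^3"
  have lfe2: "lf a e2 = lf a e2' / w" for a by (simp add: e2_def lf_scale)
  show ?thesis
  proof
    show "continuous_on UNIV f1" "continuous_on UNIV f2" unfolding f1_def f2_def by (intro continuous_intros)+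
    show "v = f1 v *s d1 + f2 v *s e2 + lf H v *s e3" for v
      by (subst dec[of v]) (use w0 in \<open>simp add: f1_def f2_def e2_def e2'_def vec_eq_iff algebra_simps\<close>)
    show "f1 (x *s d1 + y *s e2 + z *s e3) = x" "f2 (x *s d1 + y *s e2 + z *s e3) = y" for x y z
      using w0 by (simp_all add: f1_def f2_def e2_def e2'_def comp)
    show "lf H d1 = 0" "lf H e2 = 0" "lf H e3 = 1"
      using Hd by (simp_all add: lfe2 e2'_def lf_add lf_scale)
    show "lf a e2 \<noteq> 0" if "a \<in> A - {H}" for a using e2'[OF that] w0 by (simp add: lfe2)
    show "Re (lf a e3 / lf a e2) \<noteq> Re (lf b e3 / lf b e2)"
      if "a \<in> A - {H}" "b \<in> A - {H}" "a \<noteq> b" "lf a d1 / lf a e2 = lf b d1 / lf b e2" for a b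
    proof -
      have "lf a d1 / lf a e2' * w = lf b d1 / lf b e2' * w" using that(4) by (simp add: lfe2)
      then have "lf a d1 / lf a e2' = lf b d1 / lf b e2'" by (simp only: mult_right_cancel[OF w0])
      then have "lf a e3 / lf a e2' - lf b e3 / lf b e2' \<in> ?D"
        using that by (auto intro!: image_eqI[where x = "(a, b)"])
      from w(2)[OF this] have "Re ((lf a e3 / lf a e2' - lf b e3 / lf b e2') * w) \<noteq> 0" .
      moreover have "(lf a e3 / lf a e2' - lf b e3 / lf b e2') * w = lf a e3 / lf a e2 - lf b e3 / lf b e2"
        by (simp add: lfe2 left_diff_distrib)
      ultimately show ?thesis by (metis diff_self minus_complex.simps(1))
    qed
  qed
qed

text \<open>Averaging over the deck group makes a functional that is an eigenvector modulo exact ones an honest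
  eigenvector.\<close>

context lines
begin

lemma deck_deck: "deck 1 (deck l v) = deck (Suc l) v"
  by (simp add: deck_def)

lemma deck_0 [simp]: "deck 0 v = v"
  by (simp add: deck_def)

lemma deck_m [simp]: "deck m v = v"
  by (simp only: deck_def root_of_unity_pow) simp

lemma ex_eigen_functional:
  assumes P: "path_functional F P" and e: "e ^ m = 1" "e \<noteq> 1"
    and eig: "\<exists>\<psi>. primitive_on (\<lambda>p. P (deck 1 \<circ> p) - e * P p) F \<psi>"
  obtains P' \<psi> where "eigen_functional I al be C B P' e" "primitive_on (\<lambda>p. P' p - P p) F \<psi>"
proof -
  have e0: "e \<noteq> 0" using e m_pos by (metis power_0_left zero_neq_one less_irrefl)
  obtain \<psi> where \<psi>: "primitive_on (\<lambda>p. P (deck 1 \<circ> p) - e * P p) F \<psi>" using eig by blast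
  have deckp: "path (deck j \<circ> p)" "path_image (deck j \<circ> p) \<subseteq> F" if "path p" "path_image p \<subseteq> F" for j p
  proof -
    show "path (deck j \<circ> p)" using that(1) unfolding path_def o_def by (rule continuous_on_deck)
    show "path_image (deck j \<circ> p) \<subseteq> F" using that(2) deck_in_F unfolding path_image_compose by blast
  qed
  have dd: "deck 1 \<circ> (deck j \<circ> p) = deck (Suc j) \<circ> p" for j and p :: "real \<Rightarrow> complex \<times> complex \<times> complex"
    by (simp add: fun_eq_iff deck_deck del: One_nat_def)
  have "\<exists>\<psi>. primitive_on (\<lambda>p. P (deck j \<circ> p) - e ^ j * P p) F \<psi>" for j
  proof (induction j)
    case 0
    have "deck 0 \<circ> p = p" for p :: "real \<Rightarrow> complex \<times> complex \<times> complex" by (simp add: fun_eq_iff)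
    then show ?case by (intro exI[of _ "\<lambda>_. 0"]) (simp add: primitive_on_def)
  next
    case (Suc j)
    then obtain \<psi>j where \<psi>j: "primitive_on (\<lambda>p. P (deck j \<circ> p) - e ^ j * P p) F \<psi>j" by blast
    have "primitive_on (\<lambda>p. P (deck (Suc j) \<circ> p) - e ^ Suc j * P p) F (\<lambda>v. \<psi> (deck j v) + e * \<psi>j v)"
      unfolding primitive_on_def
    proof (intro allI impI)
      fix p assume p: "path p" "path_image p \<subseteq> F"
      have "P (deck (Suc j) \<circ> p) - e * P (deck j \<circ> p) = \<psi> (deck j (pathfinish p)) - \<psi> (deck j (pathstart p))"
        using primitive_onD[OF \<psi> deckp[OF p, of j]] unfolding dd by (simp add: pathfinish_def pathstart_def)
      moreover have "P (deck j \<circ> p) - e ^ j * P p = \<psi>j (pathfinish p) - \<psi>j (pathstart p)"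
        using primitive_onD[OF \<psi>j p] .
      then have "e * P (deck j \<circ> p) - e ^ Suc j * P p = e * \<psi>j (pathfinish p) - e * \<psi>j (pathstart p)"
        by (metis mult.assoc power_Suc right_diff_distrib)
      ultimately show "P (deck (Suc j) \<circ> p) - e ^ Suc j * P p =
         \<psi> (deck j (pathfinish p)) + e * \<psi>j (pathfinish p) - (\<psi> (deck j (pathstart p)) + e * \<psi>j (pathstart p))"
        by (simp add: algebra_simps)
    qed
    then show ?case by blast
  qed
  then obtain \<psi>s where \<psi>s: "\<And>j. primitive_on (\<lambda>p. P (deck j \<circ> p) - e ^ j * P p) F (\<psi>s j)" by metis
  \<comment> \<open>The weights of the projection to the eigenspace:
    \<open>c j * e ^ j = 1 / m\<close>, which leaves eigenvectors unchanged.\<close>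
  define c where "c j = inverse (of_nat m * e ^ j)" for j
  define P' where "P' p = (\<Sum>j<m. c j * P (deck j \<circ> p))" for p
  have "path_functional F P'"
    unfolding P'_def
  proof (rule path_functional_sum)
    fix j show "path_functional F (\<lambda>p. P (deck j \<circ> p))"
    proof (rule path_functional.pullback[OF P])
      show "continuous_on F (deck j)" by (rule continuous_on_deck) (rule continuous_on_id)
      show "deck j ` F \<subseteq> F" using deck_in_F by blast
    qed
  qed
  then interpret P': path_functional F P' .
  have "P' (deck 1 \<circ> p) = e * P' p" for p
  proof -
    define g where "g j = c j * P (deck j \<circ> p)" for j
    \<comment> \<open>The cyclic shift of the summands closes up because \<open>deck m\<close> is
      the identity and \<open>e ^ m = 1\<close>.\<close>
    have g: "g m = g 0"
    proof -
      have "deck m \<circ> p = p" "deck 0 \<circ> p = p" by (simp_all add: fun_eq_iff)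
      then show ?thesis by (simp add: g_def c_def e)
    qed
    have "P' (deck 1 \<circ> p) = (\<Sum>j<m. c j * P (deck (Suc j) \<circ> p))"
    proof -
      have "deck j \<circ> (deck 1 \<circ> p) = deck (Suc j) \<circ> p" for j
        by (simp add: fun_eq_iff deck_def)
      then show ?thesis by (simp add: P'_def)
    qed
    also have "\<dots> = (\<Sum>j<m. e * g (Suc j))"
    proof (rule sum.cong[OF refl])
      fix j have "c j = e * c (Suc j)" using e0 by (simp add: c_def)
      then show "c j * P (deck (Suc j) \<circ> p) = e * g (Suc j)" by (simp only: g_def mult.assoc)
    qed
    also have "\<dots> = e * (\<Sum>j<m. g (Suc j))" by (simp add: sum_distrib_left)
    also have "(\<Sum>j<m. g (Suc j)) = (\<Sum>j<m. g j)"
      using sum.lessThan_Suc_shift[of g m] sum.lessThan_Suc[of g m] g by simp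
    finally have "P' (deck 1 \<circ> p) = e * (\<Sum>j<m. g j)" .
    moreover have "P' p = (\<Sum>j<m. g j)" by (simp add: P'_def g_def)
    ultimately show ?thesis by (simp only:)
  qed
  then have 1: "eigen_functional I al be C B P' e" using e(2) by unfold_locales auto
  have "primitive_on (\<lambda>p. P' p - P p) F (\<lambda>v. \<Sum>j<m. c j * \<psi>s j v)"
    unfolding primitive_on_def
  proof (intro allI impI)
    fix p assume p: "path p" "path_image p \<subseteq> F"
    have "P p = (\<Sum>j<m. c j * (e ^ j * P p))"
    proof -
      have "c j * (e ^ j * P p) = P p / of_nat m" for j using e0 by (simp add: c_def inverse_eq_divide)
      then show ?thesis using m_pos by simp
    qed
    then have "P' p - P p = (\<Sum>j<m. c j * (P (deck j \<circ> p) - e ^ j * P p))"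
      by (simp add: P'_def right_diff_distrib sum_subtractf)
    also have "\<dots> = (\<Sum>j<m. c j * (\<psi>s j (pathfinish p) - \<psi>s j (pathstart p)))"
      using primitive_onD[OF \<psi>s p] by simp
    finally show "P' p - P p = (\<Sum>j<m. c j * \<psi>s j (pathfinish p)) - (\<Sum>j<m. c j * \<psi>s j (pathstart p))"
      by (simp add: right_diff_distrib sum_subtractf)
  qed
  with 1 show ?thesis using that by blast
qed

text \<open>Each resonant cluster has a gap after every puncture except its right-most one.\<close>

lemma card_gaps_le: "card (gaps e) \<le> (\<Sum>a\<in>{a\<in>al ` I. e ^ Suc (card {j\<in>I. al j = a}) = 1}. card {j\<in>I. al j = a} - 1)"
proof -
  let ?S = "{a\<in>al ` I. e ^ Suc (card {j\<in>I. al j = a}) = 1}"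
  have "gaps e = (\<Union>a\<in>?S. {i\<in>gaps e. al i = a})" by (auto simp: gaps_def)
  then have "card (gaps e) \<le> (\<Sum>a\<in>?S. card {i\<in>gaps e. al i = a})"
    using finite_I card_UN_le[of ?S "\<lambda>a. {i\<in>gaps e. al i = a}"] by simp
  also have "\<dots> \<le> (\<Sum>a\<in>?S. card {j\<in>I. al j = a} - 1)"
  proof (rule sum_mono)
    fix a assume "a \<in> ?S"
    let ?c = "{j\<in>I. al j = a}"
    have c: "finite ?c" "?c \<noteq> {}" using finite_I \<open>a \<in> ?S\<close> by auto
    then have "Max ((\<lambda>j. Re (be j)) ` ?c) \<in> (\<lambda>j. Re (be j)) ` ?c" by (intro Max_in) auto
    then obtain t where t: "t \<in> ?c" "Re (be t) = Max ((\<lambda>j. Re (be j)) ` ?c)" by auto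
    have top: "Re (be j) \<le> Re (be t)" if "j \<in> ?c" for j using t(2) that c(1) by simp
    have "{i\<in>gaps e. al i = a} \<subseteq> ?c - {t}"
    proof
      fix i assume i: "i \<in> {i\<in>gaps e. al i = a}"
      then obtain j where "j \<in> ?c" "Re (be i) < Re (be j)" by (auto simp: gaps_def)
      then have "i \<noteq> t" using top[of j] by auto
      then show "i \<in> ?c - {t}" using i by (auto simp: gaps_def)
    qed
    then have "card {i\<in>gaps e. al i = a} \<le> card (?c - {t})" using c by (intro card_mono) auto
    then show "card {i\<in>gaps e. al i = a} \<le> card ?c - 1" using t(1) c by simp
  qed
  finally show ?thesis .
qed

end

lemma root_of_unity_power_eq_1_iff:
  assumes "m > 0" shows "exp (2 * pi * \<i> / of_nat m) ^ j = 1 \<longleftrightarrow> m dvd j"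
proof -
  have "exp (2 * pi * \<i> / of_nat m) ^ j = exp (of_nat j * (2 * pi * \<i> / of_nat m))"
    by (rule exp_of_nat_mult[symmetric])
  also have "of_nat j * (2 * pi * \<i> / of_nat m) = 2 * of_real pi * \<i> * of_nat j / of_nat m"
    by simp
  finally show ?thesis using complex_root_unity_eq_1[of m j] assms by simp
qed

lemma lf_proj_point: "(\<forall>v\<in>proj_point p. lf a v = 0) \<longleftrightarrow> lf a p = 0"
  by (auto simp: proj_point_def lf_scale)

lemma mem_proj_point: "p \<in> proj_point p"
  unfolding proj_point_def by (metis (mono_tags, lifting) mem_Collect_eq vector_smult_lid)

lemma proj_point_scale:
  assumes "c \<noteq> 0" shows "proj_point (c *s p) = proj_point p"
proof
  show "proj_point (c *s p) \<subseteq> proj_point p"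
    unfolding proj_point_def vector_smult_assoc by blast
  show "proj_point p \<subseteq> proj_point (c *s p)"
  proof
    fix x assume "x \<in> proj_point p"
    then obtain d where "x = d *s p" by (auto simp: proj_point_def)
    then have "x = (d / c) *s (c *s p)" using assms by (simp add: vector_smult_assoc)
    then show "x \<in> proj_point (c *s p)" unfolding proj_point_def by blast
  qed
qed

section \<open>The chart of the Milnor fibre adapted to \<open>H\<close>\<close>

locale adapted_arrangement =
  fixes A :: "(complex^3) set" and H e1 e2 e3 :: "complex^3" and f1 f2 :: "complex^3 \<Rightarrow> complex"
  assumes finite_A: "finite A" and H_in_A: "H \<in> A"
    and continuous_f: "continuous_on UNIV f1" "continuous_on UNIV f2"
    and decomp: "v = f1 v *s e1 + f2 v *s e2 + lf H v *s e3"
    and f1_coord: "f1 (x *s e1 + y *s e2 + z *s e3) = x"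
    and f2_coord: "f2 (x *s e1 + y *s e2 + z *s e3) = y"
    and lf_H: "lf H e1 = 0" "lf H e2 = 0" "lf H e3 = 1"
    and lf_e2: "a \<in> A - {H} \<Longrightarrow> lf a e2 \<noteq> 0"
    and generic: "a \<in> A - {H} \<Longrightarrow> b \<in> A - {H} \<Longrightarrow> a \<noteq> b \<Longrightarrow> lf a e1 / lf a e2 = lf b e1 / lf b e2 \<Longrightarrow>
       Re (lf a e3 / lf a e2) \<noteq> Re (lf b e3 / lf b e2)"
begin

definition slope :: "complex^3 \<Rightarrow> complex" where "slope a = - (lf a e1 / lf a e2)"

definition icept :: "complex^3 \<Rightarrow> complex" where "icept a = - (lf a e3 / lf a e2)"

text \<open>On \<open>x e1 + y e2 + e3\<close> the form \<open>lf a\<close> is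
  \<open>lf a e2 * (y - slope a * x - icept a)\<close>, which explains the constant
  \<open>C\<close>. The summand 1 makes the bound on the intercepts strict and positive.\<close>

sublocale lines "A - {H}" slope icept "\<Prod>a\<in>A - {H}. lf a e2" "1 + (\<Sum>a\<in>A - {H}. norm (icept a))"
proof
  fix a assume a: "a \<in> A - {H}"
  show "norm (icept a) < 1 + (\<Sum>a\<in>A - {H}. norm (icept a))"
    using member_le_sum[of a "A - {H}" "\<lambda>a. norm (icept a)"] a finite_A by simp
next
  show "0 < 1 + (\<Sum>a\<in>A - {H}. norm (icept a))" by (simp add: add_pos_nonneg sum_nonneg)
  show "(\<Prod>a\<in>A - {H}. lf a e2) \<noteq> 0" using lf_e2 finite_A by simp
next
  fix a b assume "a \<in> A - {H}" "b \<in> A - {H}" "a \<noteq> b" "slope a = slope b"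
  then show "Re (icept a) \<noteq> Re (icept b)" using generic[of a b] by (simp add: slope_def icept_def)
qed (use finite_A in simp)

lemma m_eq: "m = card A"
  using card_Suc_Diff1[OF finite_A H_in_A] by (simp add: m_def)

definition chart :: "complex \<times> complex \<times> complex \<Rightarrow> complex^3" where
  "chart v = snd (snd v) *s (fst v *s e1 + fst (snd v) *s e2 + e3)"

definition chart_inv :: "complex^3 \<Rightarrow> complex \<times> complex \<times> complex" where
  "chart_inv v = (f1 v / lf H v, f2 v / lf H v, lf H v)"

lemma lf_chart_H: "lf H (chart v) = snd (snd v)"
  by (simp add: chart_def lf_add lf_scale lf_H del: vector_add_ldistrib)

lemma lf_chart: "a \<in> A - {H} \<Longrightarrow> lf a (chart v) = snd (snd v) * (lf a e2 * q a (base v))"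
  using lf_e2[of a] by (simp add: chart_def lf_add lf_scale q_def base_def slope_def icept_def field_simps del: vector_add_ldistrib)

text \<open>By homogeneity each of the \<open>m\<close> forms contributes one factor
  \<open>snd (snd v)\<close>; that of \<open>H\<close> contributes nothing else.\<close>

lemma chart_in_milnor_fiber_iff: "chart v \<in> milnor_fiber A \<longleftrightarrow> v \<in> F"
proof -
  have "defQ A (chart v) = lf H (chart v) * (\<Prod>a\<in>A - {H}. lf a (chart v))"
    unfolding defQ_def using prod.remove[OF finite_A H_in_A] .
  also have "(\<Prod>a\<in>A - {H}. lf a (chart v)) = (\<Prod>a\<in>A - {H}. snd (snd v) * (lf a e2 * q a (base v)))"
    by (rule prod.cong[OF refl]) (rule lf_chart)
  also have "lf H (chart v) * \<dots> = (\<Prod>a\<in>A - {H}. lf a e2) * snd (snd v) ^ m * (\<Prod>a\<in>A - {H}. q a (base v))"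
    by (simp add: prod.distrib lf_chart_H m_def)
  finally show ?thesis by (simp add: milnor_fiber_def F_def)
qed

lemma chart_chart_inv:
  assumes "v \<in> milnor_fiber A" shows "chart (chart_inv v) = v"
proof -
  have "lf H v \<noteq> 0"
  proof
    assume "lf H v = 0"
    then have "defQ A v = 0" unfolding defQ_def using finite_A H_in_A by auto
    then show False using assms by (simp add: milnor_fiber_def)
  qed
  then have "chart (chart_inv v) = f1 v *s e1 + f2 v *s e2 + lf H v *s e3"
    by (simp add: chart_def chart_inv_def)
  then show ?thesis using decomp[of v] by simp
qed

lemma chart_inv_in_F: "v \<in> milnor_fiber A \<Longrightarrow> chart_inv v \<in> F"
  using chart_in_milnor_fiber_iff[of "chart_inv v"] chart_chart_inv by simp

lemma continuous_on_vector_smult: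
  "continuous_on S f \<Longrightarrow> continuous_on S (\<lambda>x. f x *s (g :: complex^3))"
  unfolding vector_scalar_mult_def by (intro continuous_intros)

lemma continuous_on_chart: "continuous_on S chart"
proof -
  have "chart = (\<lambda>v. (snd (snd v) * fst v) *s e1 + (snd (snd v) * fst (snd v)) *s e2 + snd (snd v) *s e3)"
    by (simp add: chart_def fun_eq_iff)
  then show ?thesis by (simp only:) (intro continuous_on_add continuous_on_vector_smult continuous_intros)
qed

lemma continuous_on_chart_inv: "continuous_on (milnor_fiber A) chart_inv"
proof -
  have "lf H v \<noteq> 0" if "v \<in> milnor_fiber A" for v
    using F_nonzero(2)[OF chart_inv_in_F[OF that]] by (simp add: chart_inv_def)
  then show ?thesis
    unfolding chart_inv_def
    by (intro continuous_intros continuous_on_subset[OF continuous_f(1)] continuous_on_subset[OF continuous_f(2)]) auto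
qed

lemma monodromy_chart: "monodromy m (chart v) = chart (deck 1 v)"
  by (simp add: monodromy_def chart_def deck_def mult.assoc)

text \<open>If there are more classes than gaps, their pullbacks, averaged to strict eigenvectors,
  have a nontrivial exact combination. Averaging adds exact terms only, so the same combination of
  the given cocycles is exact.\<close>

lemma eigen_family_le_card_gaps:
  assumes fam: "eigen_family (top_of_set (milnor_fiber A)) (monodromy m) e n c" and e: "e ^ m = 1" "e \<noteq> 1"
  shows "n \<le> card (gaps e)"
proof (rule ccontr)
  assume n: "\<not> n \<le> card (gaps e)"
  let ?X = "milnor_fiber A"
  define Q where "Q i p = c i (path_simplex p)" for i p
  define P where "P i p = Q i (chart \<circ> p)" for i p
  have coc: "cocycle1 (top_of_set ?X) (c i)"
    and eig: "coboundary1 (top_of_set ?X) (\<lambda>\<sigma>. pullback1 (monodromy m) (c i) \<sigma> - e * c i \<sigma>)" if "i < n" for i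
    using fam that by (auto simp: eigen_family_def)
  have indep: "\<forall>i<n. a i = 0" if "coboundary1 (top_of_set ?X) (\<lambda>\<sigma>. \<Sum>i<n. a i * c i \<sigma>)" for a
    using fam that by (auto simp: eigen_family_def)
  have chart_X: "chart ` F \<subseteq> ?X" using chart_in_milnor_fiber_iff by blast
  have chart_path: "path (chart \<circ> p)" "path_image (chart \<circ> p) \<subseteq> ?X" if "path p" "path_image p \<subseteq> F" for p
    using that chart_X path_continuous_image[OF that(1) continuous_on_chart] by (auto simp: path_image_compose)
  \<comment> \<open>Functional and primitive form one pair, so that both come from a single
    choice.\<close>
  define good where "good i x \<longleftrightarrow> eigen_functional (A - {H}) slope icept (\<Prod>a\<in>A - {H}. lf a e2)
      (1 + (\<Sum>a\<in>A - {H}. norm (icept a))) (fst x) e \<and> primitive_on (\<lambda>p. fst x p - P i p) F (snd x)" for i x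
  have ex: "\<exists>x. good i x" if i: "i < n" for i
  proof -
    have pf: "path_functional F (P i)"
      unfolding P_def Q_def
      by (rule path_functional.pullback[OF path_functional_cocycle1[OF coc[OF i]] continuous_on_chart chart_X])
    obtain \<psi> where \<psi>: "primitive_on (\<lambda>p. pullback1 (monodromy m) (c i) (path_simplex p) - e * c i (path_simplex p)) ?X \<psi>"
      using eig[OF i] unfolding coboundary1_iff_primitive_on by blast
    have "primitive_on (\<lambda>p. P i (deck 1 \<circ> p) - e * P i p) F (\<psi> \<circ> chart)"
      unfolding primitive_on_def
    proof (intro allI impI)
      fix p assume p: "path p" "path_image p \<subseteq> F"
      have "monodromy m \<circ> (chart \<circ> p) = chart \<circ> (deck 1 \<circ> p)"
        by (simp add: fun_eq_iff monodromy_chart del: One_nat_def)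
      then show "P i (deck 1 \<circ> p) - e * P i p = (\<psi> \<circ> chart) (pathfinish p) - (\<psi> \<circ> chart) (pathstart p)"
        using primitive_onD[OF \<psi> chart_path[OF p]]
        by (simp add: P_def Q_def pullback1_path_simplex pathfinish_def pathstart_def del: One_nat_def)
    qed
    then obtain P' \<psi>' where "eigen_functional (A - {H}) slope icept (\<Prod>a\<in>A - {H}. lf a e2)
      (1 + (\<Sum>a\<in>A - {H}. norm (icept a))) P' e" "primitive_on (\<lambda>p. P' p - P i p) F \<psi>'"
      using ex_eigen_functional[OF pf e] by blast
    then show ?thesis by (intro exI[of _ "(P', \<psi>')"]) (simp add: good_def)
  qed
  then have "\<forall>i\<in>{..<n}. \<exists>x. good i x" by simp
  from bchoice[OF this] obtain g where g: "\<And>i. i < n \<Longrightarrow> good i (g i)" by auto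
  define P' \<psi> where "P' i = fst (g i)" and "\<psi> i = snd (g i)" for i
  have P': "eigen_functional (A - {H}) slope icept (\<Prod>a\<in>A - {H}. lf a e2)
      (1 + (\<Sum>a\<in>A - {H}. norm (icept a))) (P' i) e"
    and \<psi>: "primitive_on (\<lambda>p. P' i p - P i p) F (\<psi> i)" if "i < n" for i
    using g[OF that] by (simp_all add: good_def P'_def \<psi>_def)
  obtain a i0 \<psi>' where i0: "i0 < n" "a i0 \<noteq> 0" and \<psi>': "primitive_on (\<lambda>p. \<Sum>i<n. a i * P' i p) F \<psi>'"
  proof (rule eigen_functionals_dependent[of n P' e])
    show "eigen_functional (A - {H}) slope icept (\<Prod>a\<in>A - {H}. lf a e2)
      (1 + (\<Sum>a\<in>A - {H}. norm (icept a))) (P' i) e" if "i < n" for i by (rule P'[OF that])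
    show "e \<noteq> 1" by (rule e(2))
    show "card (gaps e) < n" using n by simp
  qed (rule that)
  let ?\<phi> = "\<lambda>v. \<psi>' v - (\<Sum>i<n. a i * \<psi> i v)"
  have "primitive_on (\<lambda>p. \<Sum>i<n. a i * c i (path_simplex p)) ?X (?\<phi> \<circ> chart_inv)"
    unfolding primitive_on_def
  proof (intro allI impI)
    fix p assume p: "path p" "path_image p \<subseteq> ?X"
    let ?r = "chart_inv \<circ> p"
    have r: "path ?r" "path_image ?r \<subseteq> F"
      using p chart_inv_in_F path_continuous_image[OF p(1) continuous_on_subset[OF continuous_on_chart_inv p(2)]]
      unfolding path_image_compose by blast+
    have "chart (chart_inv (p t)) = p t" if "t \<in> {0..1}" for t
      using p(2) that by (intro chart_chart_inv) (auto simp: path_image_def)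
    \<comment> \<open>The simplex of a path sees only parameters in the unit interval, where the
      chart cancels its inverse.\<close>
    then have "path_simplex (chart \<circ> ?r) = path_simplex p"
      using standard_simplex_1_eq unfolding path_simplex_def by (intro restrict_ext) (auto simp del: One_nat_def)
    then have "c i (path_simplex p) = P i ?r" for i by (simp add: P_def Q_def)
    moreover have "P i ?r = P' i ?r - (\<psi> i (pathfinish ?r) - \<psi> i (pathstart ?r))" if "i < n" for i
      using primitive_onD[OF \<psi>[OF that] r] by (simp add: algebra_simps)
    ultimately have "(\<Sum>i<n. a i * c i (path_simplex p)) =
        (\<Sum>i<n. a i * (P' i ?r - (\<psi> i (pathfinish ?r) - \<psi> i (pathstart ?r))))"
      by (intro sum.cong) auto
    also have "\<dots> = ?\<phi> (pathfinish ?r) - ?\<phi> (pathstart ?r)"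
      using primitive_onD[OF \<psi>' r] by (simp add: right_diff_distrib sum_subtractf)
    finally show "(\<Sum>i<n. a i * c i (path_simplex p)) = (?\<phi> \<circ> chart_inv) (pathfinish p) - (?\<phi> \<circ> chart_inv) (pathstart p)"
      by (simp add: pathfinish_def pathstart_def)
  qed
  then have "coboundary1 (top_of_set ?X) (\<lambda>\<sigma>. \<Sum>i<n. a i * c i \<sigma>)"
    unfolding coboundary1_iff_primitive_on by blast
  then show False using indep i0 by blast
qed

section \<open>Points of \<open>H\<close> and slopes of the other lines\<close>

definition point :: "complex \<Rightarrow> (complex^3) set" where "point s = proj_point (e1 + s *s e2)"

lemma inj_point: "inj point"
proof
  fix s t assume "point s = point t"
  then have "e1 + s *s e2 \<in> proj_point (e1 + t *s e2)" using mem_proj_point by (metis point_def)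
  then obtain d where "e1 + s *s e2 = d *s (e1 + t *s e2)" by (auto simp: proj_point_def)
  then have eq: "1 *s e1 + s *s e2 + 0 *s e3 = d *s e1 + (d * t) *s e2 + 0 *s e3" by simp
  have "1 = d" using f1_coord[of 1 s 0] f1_coord[of d "d * t" 0] eq by simp
  moreover have "s = d * t" using f2_coord[of 1 s 0] f2_coord[of d "d * t" 0] eq by simp
  ultimately show "s = t" by simp
qed

lemma lf_point: "(\<forall>v\<in>point s. lf a v = 0) \<longleftrightarrow> lf a e1 + s * lf a e2 = 0"
  by (simp add: point_def lf_proj_point lf_add lf_scale)

text \<open>The successor accounts for \<open>H\<close> itself, in accordance with the exponent in
  \<open>gaps\<close>.\<close>

lemma mult_point: "mult_pt A (point s) = Suc (card {a\<in>A - {H}. slope a = s})"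
proof -
  have *: "slope a = s \<longleftrightarrow> lf a e1 + s * lf a e2 = 0" if "a \<in> A - {H}" for a
  proof -
    have "slope a = s \<longleftrightarrow> - lf a e1 = s * lf a e2"
      unfolding slope_def minus_divide_left using lf_e2[OF that] by (rule nonzero_divide_eq_eq)
    then show ?thesis by (simp only: neg_eq_iff_add_eq_0)
  qed
  have "{a\<in>A. \<forall>v\<in>point s. lf a v = 0} = insert H {a\<in>A - {H}. slope a = s}"
  proof (rule Set.set_eqI)
    fix a
    show "a \<in> {a\<in>A. \<forall>v\<in>point s. lf a v = 0} \<longleftrightarrow> a \<in> insert H {a\<in>A - {H}. slope a = s}"
    proof (cases "a \<in> A - {H}")
      case True
      then show ?thesis using *[OF True] by (simp add: lf_point)
    next
      case False
      then show ?thesis using H_in_A lf_H by (auto simp: lf_point)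
    qed
  qed
  then show ?thesis using finite_A by (simp add: mult_pt_def)
qed

lemma point_in_P2: "point s \<in> P2"
proof -
  have "f1 (0 *s e1 + 0 *s e2 + 0 *s e3) \<noteq> f1 (1 *s e1 + s *s e2 + 0 *s e3)" by (simp only: f1_coord, simp)
  then have "e1 + s *s e2 \<noteq> 0" by auto
  then show ?thesis by (auto simp: P2_def point_def)
qed

text \<open>A second line through the point excludes \<open>e2\<close>, so the point has a slope,
  namely that of the second line.\<close>

lemma multiple_point_on_H:
  assumes "x \<in> P2" "\<forall>v\<in>x. lf H v = 0" "mult_pt A x > 2"
  shows "x \<in> point ` slope ` (A - {H})"
proof -
  obtain p where p: "p \<noteq> 0" "x = proj_point p" using assms(1) by (auto simp: P2_def)
  have Hp: "lf H p = 0" using assms(2) p(2) mem_proj_point by blast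
  have "\<not> {a\<in>A. \<forall>v\<in>x. lf a v = 0} \<subseteq> {H}"
    using assms(3) card_mono[of "{H}" "{a\<in>A. \<forall>v\<in>x. lf a v = 0}"] by (auto simp: mult_pt_def)
  then obtain a where a: "a \<in> A - {H}" "lf a p = 0" using p(2) mem_proj_point by blast
  have dec: "p = f1 p *s e1 + f2 p *s e2" using decomp[of p] Hp by simp
  then have 0: "f1 p * lf a e1 + f2 p * lf a e2 = 0" using a(2) lf_add lf_scale by metis
  have "f1 p \<noteq> 0" using 0 dec p(1) lf_e2[OF a(1)] by auto
  then have "f2 p = f1 p * slope a" using 0 lf_e2[OF a(1)] by (simp add: slope_def field_simps eq_neg_iff_add_eq_0)
  then have "p = f1 p *s (e1 + slope a *s e2)" using dec by simp
  then have "x = point (slope a)" using p(2) proj_point_scale[OF \<open>f1 p \<noteq> 0\<close>] unfolding point_def by metis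
  then show ?thesis using a(1) by blast
qed

lemma card_gaps_le_sum:
  assumes "0 < m"
  shows "card (gaps (exp (2 * pi * \<i> / of_nat m) ^ k)) \<le>
    (\<Sum>x\<in>{x\<in>P2. (\<forall>v\<in>x. lf H v = 0) \<and> mult_pt A x > 2 \<and> m dvd k * mult_pt A x}. mult_pt A x - 2)"
proof -
  let ?e = "exp (2 * pi * \<i> / of_nat m) ^ k"
  let ?n = "\<lambda>s. card {a\<in>A - {H}. slope a = s}"
  let ?S = "{s\<in>slope ` (A - {H}). ?e ^ Suc (?n s) = 1}"
  let ?S' = "{s\<in>?S. 1 < ?n s}"
  let ?X = "{x\<in>P2. (\<forall>v\<in>x. lf H v = 0) \<and> mult_pt A x > 2 \<and> m dvd k * mult_pt A x}"
  have e: "?e ^ Suc j = 1 \<longleftrightarrow> m dvd k * Suc j" for j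
    using root_of_unity_power_eq_1_iff[OF assms, of "k * Suc j"] by (simp only: power_mult)
  have "card (gaps ?e) \<le> (\<Sum>s\<in>?S. ?n s - 1)" by (rule card_gaps_le)
  \<comment> \<open>A slope with a single line contributes 0; the slopes that remain belong to
    points of multiplicity above 2.\<close>
  also have "\<dots> = (\<Sum>s\<in>?S'. ?n s - 1)"
    using finite_A by (intro sum.mono_neutral_right) auto
  also have "\<dots> = (\<Sum>s\<in>?S'. mult_pt A (point s) - 2)"
    by (simp add: mult_point)
  also have "\<dots> = (\<Sum>x\<in>point ` ?S'. mult_pt A x - 2)"
    using inj_point by (subst sum.reindex) (auto simp: inj_on_def inj_def)
  also have "\<dots> \<le> (\<Sum>x\<in>?X. mult_pt A x - 2)"
  proof (rule sum_mono2)
    have "?X \<subseteq> point ` slope ` (A - {H})" using multiple_point_on_H by blast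
    then show "finite ?X" using finite_A by (meson finite_Diff finite_imageI finite_subset)
    have "\<forall>v\<in>point s. lf H v = 0" for s by (simp add: lf_point lf_H)
    then show "point ` ?S' \<subseteq> ?X"
      using e point_in_P2 by (auto simp: mult_point simp del: power_Suc mult_Suc_right)
  qed simp
  finally show ?thesis .
qed

end

theorem theorem5p1:
  fixes A :: "(complex^3) set" and H :: "complex^3" and m k :: nat
  assumes "line_arrangement A" and "card A = m" and "0 < k" and "k < m" and "H \<in> A"
  shows "H1_eigendim (top_of_set (milnor_fiber A)) (monodromy m)
           (exp (2 * pi * \<i> / of_nat m) ^ k)
         \<le> enat (\<Sum>x\<in>{x\<in>P2. (\<forall>v\<in>x. lf H v = 0) \<and> mult_pt A x > 2 \<and> m dvd k * mult_pt A x}.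
                    mult_pt A x - 2)"
proof -
  let ?e = "exp (2 * pi * \<i> / of_nat m) ^ k"
  obtain e1 e2 e3 f1 f2 where "adapted_arrangement A H e1 e2 e3 f1 f2"
  proof (rule adapted_coordinates[OF assms(1,5)])
    fix e1 e2 e3 :: "complex^3" and f1 f2
    assume coords: "continuous_on UNIV f1" "continuous_on UNIV f2"
      "\<And>v. v = f1 v *s e1 + f2 v *s e2 + lf H v *s e3"
      "\<And>x y z. f1 (x *s e1 + y *s e2 + z *s e3) = x" "\<And>x y z. f2 (x *s e1 + y *s e2 + z *s e3) = y"
      "lf H e1 = 0" "lf H e2 = 0" "lf H e3 = 1"
      "\<And>a. a \<in> A - {H} \<Longrightarrow> lf a e2 \<noteq> 0"
      "\<And>a b. a \<in> A - {H} \<Longrightarrow> b \<in> A - {H} \<Longrightarrow> a \<noteq> b \<Longrightarrow> lf a e1 / lf a e2 = lf b e1 / lf b e2 \<Longrightarrow>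
         Re (lf a e3 / lf a e2) \<noteq> Re (lf b e3 / lf b e2)"
    show ?thesis
    proof (rule that, unfold_locales)
      show "finite A" using assms(1) by (simp add: line_arrangement_def)
    qed (fact assms(5) coords)+
  qed
  then interpret a: adapted_arrangement A H e1 e2 e3 f1 f2 .
  have m: "a.m = m" using a.m_eq assms(2) by simp
  have "?e ^ m = (exp (2 * pi * \<i> / of_nat m) ^ m) ^ k" by (simp only: power_mult[symmetric] mult.commute)
  also have "\<dots> = 1" using root_of_unity_power_eq_1_iff[of m m] assms(3,4) by simp
  finally have e1: "?e ^ m = 1" .
  \<comment> \<open>\<open>0 < k < m\<close> excludes that \<open>m\<close> divides
    \<open>k\<close>.\<close>
  have e2: "?e \<noteq> 1" using root_of_unity_power_eq_1_iff[of m k] assms(3,4) by (auto dest: dvd_imp_le)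
  have 1: "n \<le> card (a.gaps ?e)" if "eigen_family (top_of_set (milnor_fiber A)) (monodromy m) ?e n c" for n c
    by (rule a.eigen_family_le_card_gaps[unfolded m, OF that e1 e2])
  have 2: "card (a.gaps ?e) \<le> (\<Sum>x\<in>{x\<in>P2. (\<forall>v\<in>x. lf H v = 0) \<and> mult_pt A x > 2 \<and> m dvd k * mult_pt A x}.
                    mult_pt A x - 2)"
    using a.card_gaps_le_sum[of k] a.m_pos unfolding m by blast
  \<comment> \<open>The dimension is a supremum over sizes of independent families, so a uniform
    bound on these sizes suffices, and finiteness is part of the result.\<close>
  show ?thesis
    unfolding H1_eigendim_def
  proof (rule Sup_least)
    fix d assume "d \<in> {enat n | n. \<exists>c. eigen_family (top_of_set (milnor_fiber A)) (monodromy m) ?e n c}"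
    then obtain n c where d: "d = enat n" and c: "eigen_family (top_of_set (milnor_fiber A)) (monodromy m) ?e n c"
      by blast
    show "d \<le> enat (\<Sum>x\<in>{x\<in>P2. (\<forall>v\<in>x. lf H v = 0) \<and> mult_pt A x > 2 \<and> m dvd k * mult_pt A x}.
                    mult_pt A x - 2)"
      unfolding d enat_ord_simps using 1[OF c] 2 by (rule order_trans)
  qed
qed

end
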